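(* There is a randomized polynomial-time algorithm (in the value-oracle model) for the problem of maximizing a monotone submodular function $f:2^{[n]}\to\mathbb{R}_+$ subject to $k$-column sparse packing constraints, i.e. $\max\{f(T)\mid \sum_{i\in T}s_{ij}\le c_j\ \forall j\in[m],\ T\subseteq[n]\}$, achieving approximation ratio $\frac{e^2}{e-1}k+o(k)$: it always outputs a feasible set $T$ with $E[f(T)]\ge \mathrm{OPT}/\left(\frac{e^2}{e-1}k+o(k)\right)$, where $o(k)/k\to0$ as $k\to\infty$.
   Context: Here $S=(s_{ij})\in\mathbb{R}_+^{m\times n}$ and $c\in\mathbb{R}^m_+$, and the constraint matrix is $k$-column sparse: for each item $i\in[n]$ there are at most $k$ constraints $j$ with $s_{ij}>0$. The function $f$ is monotone ($A\subseteq B\Rightarrow f(A)\le f(B)$) and submodular, and is accessed only through a value oracle returning $f(T)$ for any queried $T\subseteq[n]$. $\mathrm{OPT}$ is the maximum value of $f$ over feasible sets. *)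

theory Defs
  imports "HOL-Probability.Probability" "HOL-Library.Landau_Symbols"
    "HOL-Computational_Algebra.Polynomial"
begin

section \<open>Packing constraints and submodular functions\<close>

text \<open>Items are \<open>{..<n}\<close> and constraints are \<open>{..<m}\<close>; \<open>S i j\<close> is the size of item \<open>i\<close> in
  constraint \<open>j\<close> (first index: item, as in \<open>s\<^sub>i\<^sub>j\<close>). Only values at indices in range matter.\<close>

definition nonneg_data :: "nat \<Rightarrow> nat \<Rightarrow> (nat \<Rightarrow> nat \<Rightarrow> real) \<Rightarrow> (nat \<Rightarrow> real) \<Rightarrow> bool" where
  "nonneg_data n m S c \<longleftrightarrow> (\<forall>i<n. \<forall>j<m. 0 \<le> S i j) \<and> (\<forall>j<m. 0 \<le> c j)"

definition column_sparse :: "nat \<Rightarrow> nat \<Rightarrow> nat \<Rightarrow> (nat \<Rightarrow> nat \<Rightarrow> real) \<Rightarrow> bool" where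
  "column_sparse k n m S \<longleftrightarrow> (\<forall>i<n. card {j. j < m \<and> S i j > 0} \<le> k)"

definition feasible :: "nat \<Rightarrow> nat \<Rightarrow> (nat \<Rightarrow> nat \<Rightarrow> real) \<Rightarrow> (nat \<Rightarrow> real) \<Rightarrow> nat set \<Rightarrow> bool" where
  "feasible n m S c T \<longleftrightarrow> T \<subseteq> {..<n} \<and> (\<forall>j<m. (\<Sum>i\<in>T. S i j) \<le> c j)"

definition OPT ::
  "nat \<Rightarrow> nat \<Rightarrow> (nat \<Rightarrow> nat \<Rightarrow> real) \<Rightarrow> (nat \<Rightarrow> real) \<Rightarrow> (nat set \<Rightarrow> real) \<Rightarrow> real" where
  "OPT n m S c f = Max (f ` {T. feasible n m S c T})"

definition nonneg_set_fun :: "'a set \<Rightarrow> ('a set \<Rightarrow> real) \<Rightarrow> bool" where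
  "nonneg_set_fun V f \<longleftrightarrow> (\<forall>A. A \<subseteq> V \<longrightarrow> 0 \<le> f A)"

definition monotone_set_fun :: "'a set \<Rightarrow> ('a set \<Rightarrow> real) \<Rightarrow> bool" where
  "monotone_set_fun V f \<longleftrightarrow> (\<forall>A B. A \<subseteq> B \<and> B \<subseteq> V \<longrightarrow> f A \<le> f B)"

definition submodular :: "'a set \<Rightarrow> ('a set \<Rightarrow> real) \<Rightarrow> bool" where
  "submodular V f \<longleftrightarrow> (\<forall>A B. A \<subseteq> V \<and> B \<subseteq> V \<longrightarrow> f (A \<union> B) + f (A \<inter> B) \<le> f A + f B)"


section \<open>Randomized real-RAM programs with a value oracle\<close>

text \<open>
  The input data are arbitrary reals, so running time is measured in the real-RAM (arithmetic)
  model: field operations and comparisons of reals have unit cost. There is no rounding from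
  reals to integers, and the only constants a program may contain are natural numbers (an arbitrary
  real constant could serve as advice). Index arithmetic on naturals is restricted to addition
  and truncated subtraction, so that \<open>t\<close> steps produce only indices of bit length \<open>O(t)\<close>.
  Randomness consists of fair coin flips.

  Memory consists of arrays of naturals and arrays of reals. The cell \<open>(a, i, j)\<close> is entry
  \<open>(i, j)\<close> of the array named \<open>a\<close>; names are fixed in the program text, indices are computed.
\<close>

type_synonym 'v mem = "nat \<times> nat \<times> nat \<Rightarrow> 'v"

type_synonym state = "nat mem \<times> real mem"

datatype nexp =
    NConst nat
  | NGet nat nexp nexp
  | NAdd nexp nexp
  | NSub nexp nexp

datatype rexp =
    ROfNat nexp
  | RGet nat nexp nexp
  | RAdd rexp rexp
  | RSub rexp rexp
  | RMul rexp rexp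
  | RDiv rexp rexp

datatype bexp =
    NLess nexp nexp
  | RLess rexp rexp
  | BNot bexp
  | BAnd bexp bexp

text \<open>
  \<open>Query a x b y z\<close> asks for the value of the set whose indicator is row \<open>x\<close> of the
  natural array \<open>a\<close>, and stores the answer in cell \<open>(b, y, z)\<close> of the real memory.
\<close>

datatype com =
    Skip
  | NSet nat nexp nexp nexp
  | RSet nat nexp nexp rexp
  | Flip nat nexp nexp
  | Query nat nexp nat nexp nexp
  | Seq com com
  | Cond bexp com com
  | While bexp com

primrec nval :: "nexp \<Rightarrow> state \<Rightarrow> nat" where
  "nval (NConst v) s = v"
| "nval (NGet a x y) s = fst s (a, nval x s, nval y s)"
| "nval (NAdd x y) s = nval x s + nval y s"
| "nval (NSub x y) s = nval x s - nval y s"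

primrec rval :: "rexp \<Rightarrow> state \<Rightarrow> real" where
  "rval (ROfNat x) s = real (nval x s)"
| "rval (RGet a x y) s = snd s (a, nval x s, nval y s)"
| "rval (RAdd u v) s = rval u s + rval v s"
| "rval (RSub u v) s = rval u s - rval v s"
| "rval (RMul u v) s = rval u s * rval v s"
| "rval (RDiv u v) s = rval u s / rval v s"

primrec bval :: "bexp \<Rightarrow> state \<Rightarrow> bool" where
  "bval (NLess x y) s \<longleftrightarrow> nval x s < nval y s"
| "bval (RLess u v) s \<longleftrightarrow> rval u s < rval v s"
| "bval (BNot b) s \<longleftrightarrow> \<not> bval b s"
| "bval (BAnd b b') s \<longleftrightarrow> bval b s \<and> bval b' s"

definition row_set :: "nat \<Rightarrow> nat \<Rightarrow> nat \<Rightarrow> state \<Rightarrow> nat set" where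
  "row_set n a x s = {l. l < n \<and> fst s (a, x, l) \<noteq> 0}"

text \<open>
  One step of a program on an instance with \<open>n\<close> items and oracle \<open>f\<close>. A step evaluates at most
  the expressions of one command, whose sizes are bounded by the fixed program, so the number of
  steps equals the number of elementary operations up to a constant factor (a query is one step).
\<close>

primrec step :: "nat \<Rightarrow> (nat set \<Rightarrow> real) \<Rightarrow> com \<Rightarrow> state \<Rightarrow> (com \<times> state) pmf" where
  "step n f Skip s = return_pmf (Skip, s)"
| "step n f (NSet a x y v) s =
     return_pmf (Skip, ((fst s)((a, nval x s, nval y s) := nval v s), snd s))"
| "step n f (RSet a x y v) s =
     return_pmf (Skip, (fst s, (snd s)((a, nval x s, nval y s) := rval v s)))"
| "step n f (Flip a x y) s =
     map_pmf (\<lambda>b. (Skip, ((fst s)((a, nval x s, nval y s) := (if b then 1 else 0)), snd s)))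
       (bernoulli_pmf (1 / 2))"
| "step n f (Query a x b y z) s =
     return_pmf (Skip,
       (fst s, (snd s)((b, nval y s, nval z s) := f (row_set n a (nval x s) s))))"
| "step n f (Seq C D) s =
     (if C = Skip then return_pmf (D, s)
      else map_pmf (\<lambda>(C', s'). (Seq C' D, s')) (step n f C s))"
| "step n f (Cond b C D) s = return_pmf (if bval b s then C else D, s)"
| "step n f (While b C) s = return_pmf (if bval b s then Seq C (While b C) else Skip, s)"

text \<open>
  Input convention: natural array 0 holds \<open>n\<close> and \<open>m\<close> in its cells \<open>(0, 0)\<close> and \<open>(0, 1)\<close>, real
  array 0 holds \<open>S\<close>, row 0 of real array 1 holds \<open>c\<close>, and all other cells are 0. The sparsity
  parameter is not supplied separately.
\<close>

definition init_state :: "nat \<Rightarrow> nat \<Rightarrow> (nat \<Rightarrow> nat \<Rightarrow> real) \<Rightarrow> (nat \<Rightarrow> real) \<Rightarrow> state" where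
  "init_state n m S c =
     ((\<lambda>_. 0)((0, 0, 0) := n, (0, 0, 1) := m),
      (\<lambda>(a, i, j).
         if a = 0 \<and> i < n \<and> j < m then S i j
         else if a = 1 \<and> i = 0 \<and> j < m then c j
         else 0))"

definition run ::
  "com \<Rightarrow> nat \<Rightarrow> nat \<Rightarrow> (nat \<Rightarrow> nat \<Rightarrow> real) \<Rightarrow> (nat \<Rightarrow> real) \<Rightarrow> (nat set \<Rightarrow> real) \<Rightarrow> nat
    \<Rightarrow> (com \<times> state) pmf" where
  "run P n m S c f t =
     ((\<lambda>D. bind_pmf D (\<lambda>(C, s). step n f C s)) ^^ t) (return_pmf (P, init_state n m S c))"

definition halts_within ::
  "com \<Rightarrow> nat \<Rightarrow> nat \<Rightarrow> (nat \<Rightarrow> nat \<Rightarrow> real) \<Rightarrow> (nat \<Rightarrow> real) \<Rightarrow> (nat set \<Rightarrow> real) \<Rightarrow> nat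
    \<Rightarrow> bool" where
  "halts_within P n m S c f t \<longleftrightarrow> (\<forall>(C, s) \<in> set_pmf (run P n m S c f t). C = Skip)"

text \<open>
  The output set is read from row 0 of natural array 1. Since \<open>Skip\<close> steps to itself, the
  distribution below does not depend on \<open>t\<close> once the program halts within \<open>t\<close> steps.
\<close>

definition out_dist ::
  "com \<Rightarrow> nat \<Rightarrow> nat \<Rightarrow> (nat \<Rightarrow> nat \<Rightarrow> real) \<Rightarrow> (nat \<Rightarrow> real) \<Rightarrow> (nat set \<Rightarrow> real) \<Rightarrow> nat
    \<Rightarrow> nat set pmf" where
  "out_dist P n m S c f t = map_pmf (\<lambda>(C, s). row_set n 1 0 s) (run P n m S c f t)"

end

theory Submission imports Defs begin

text \<open>
  Call an item big for a constraint if it takes more than half of its capacity. A feasible set has at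
  most one big item per constraint, so after normalization it is a point of the polytope with one row
  for the big and one row for the small items of each constraint, and one row per item. Multiplicative
  weights on these rows pick, one after the other, items with the best ratio of marginal value to
  price until some row has received load \<open>D\<close>; each picked item is sampled with probability \<open>p\<close>,
  where \<open>p * D = 1 / (2 * k)\<close>. A sampled item survives if the others do not conflict with it: no
  big item at any of its constraints, and no pairwise products of small sizes adding up to \<open>1/9\<close>. The
  latter has probability \<open>O(1 / k\<^sup>2)\<close> per constraint, the former at most \<open>1 / (2 * k)\<close>, so by the union
  bound over \<open>k\<close> constraints about half of the value survives.

  The picks depend on earlier samples, so survival is measured by a pessimistic estimator (\<open>risk\<close>) that
  never increases in expectation, and marginal values are discounted by it. As only a \<open>1 / (2 * k)\<close>
  fraction of a fractional solution is sampled, the sampled set has negligible value compared with the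
  optimum, and no factor \<open>1 - 1 / e\<close> is lost to the submodularity of \<open>f\<close>. This gives ratio
  \<open>4 * k\<close> up to constants close to \<open>1\<close>, which leaves room for a bound of \<open>17 / 4 * k\<close>,
  below \<open>e\<^sup>2 / (e - 1) * k\<close>.
\<close>

section \<open>Submodular functions\<close>

text \<open>Solving a relaxation first and rounding afterwards would require estimates of the
  multilinear extension of \<open>f\<close>. Interleaving the two avoids this: only
  \<open>f R\<close> and \<open>f (insert a R)\<close> for the actual sample \<open>R\<close> are
  queried. The price is that the run is an adaptive process. It is therefore controlled by a single
  submartingale, \<open>potential\<close>, through a start, a step and a stop inequality, so that
  each round involves just one biased coin. If \<open>p * D = x\<close>, about a fraction
  \<open>x\<close> of the optimum is sampled and each item is lost with probability at most about
  \<open>k * x\<close>; the product \<open>x * (1 - k * x)\<close> is largest at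
  \<open>x = 1 / (2 * k)\<close>, where it equals \<open>1 / (4 * k)\<close>. Making
  \<open>D\<close> large and \<open>p\<close> small for this \<open>x\<close> renders the
  granularity of single picks and the term \<open>ln M / \<epsilon>\<close> negligible against
  \<open>D\<close>. Logarithms and exponentials occur only in the analysis; the program just
  multiplies weights. Errors of order \<open>1 / k\<close> are kept small by running with at least
  \<open>10000\<close> in place of \<open>k\<close>, at the cost of an additive constant that
  \<open>o(k)\<close> absorbs.\<close>

lemma submodular_marginal_antimono:
  assumes sub: "submodular V f" and mono: "monotone_set_fun V f"
    and "A \<subseteq> B" "B \<subseteq> V" "a \<in> V"
  shows "f (insert a B) - f B \<le> f (insert a A) - f A"
proof (cases "a \<in> B")
  case True
  have "f A \<le> f (insert a A)"
    using mono assms(3-5) unfolding monotone_set_fun_def by (metis insert_subset subset_insertI subset_trans)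
  with True show ?thesis by (simp add: insert_absorb)
next
  case False
  have eqs: "insert a A \<union> B = insert a B" "insert a A \<inter> B = A" using assms(3) False by auto
  have "f (insert a A \<union> B) + f (insert a A \<inter> B) \<le> f (insert a A) + f B"
    using sub assms(3-5) unfolding submodular_def by (metis insert_subset subset_trans)
  with eqs show ?thesis by simp
qed

text \<open>Telescoping along the natural order of the indices. Because the order does not depend on
  \<open>R\<close>, the marginals over \<open>R\<close> can be compared item by item with those over
  the empty set.\<close>

definition chain_marginal :: "(nat set \<Rightarrow> real) \<Rightarrow> nat set \<Rightarrow> nat set \<Rightarrow> nat \<Rightarrow> real" where
  "chain_marginal f R A i = f (R \<union> A \<inter> {..i}) - f (R \<union> A \<inter> {..<i})"

lemma sum_chain_marginal:
  assumes "A \<subseteq> {..<n}"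
  shows "(\<Sum>i\<in>A. chain_marginal f R A i) = f (R \<union> A) - f R"
proof -
  have *: "(\<Sum>i<l. if i \<in> A then chain_marginal f R A i else 0) = f (R \<union> A \<inter> {..<l}) - f R" for l
  proof (induction l)
    case 0
    show ?case by simp
  next
    case (Suc l)
    have 1: "{..<Suc l} = {..l}" by auto
    have 2: "A \<inter> {..l} = A \<inter> {..<l}" if "l \<notin> A"
      using that by (auto simp: le_less)
    show ?case using Suc 2 by (simp add: 1[symmetric] chain_marginal_def)
  qed
  have "(\<Sum>i\<in>A. chain_marginal f R A i) = (\<Sum>i<n. if i \<in> A then chain_marginal f R A i else 0)"
    using assms by (simp add: sum.If_cases Int_absorb1)
  also have "\<dots> = f (R \<union> A \<inter> {..<n}) - f R" by (rule *)
  also have "A \<inter> {..<n} = A" using assms by auto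
  finally show ?thesis .
qed


section \<open>Pairwise products of small sizes\<close>

lemma sum_squares_le_square_sum:
  fixes q :: "'a \<Rightarrow> real"
  assumes "finite X" "\<And>i. i \<in> X \<Longrightarrow> 0 \<le> q i"
  shows "(\<Sum>i\<in>X. (q i)\<^sup>2) \<le> (\<Sum>i\<in>X. q i)\<^sup>2"
  using assms
proof (induction X rule: finite_induct)
  case (insert x X)
  have "0 \<le> q x * (\<Sum>i\<in>X. q i)" using insert by (simp add: sum_nonneg)
  then show ?case using insert by (simp add: power2_sum)
qed simp

text \<open>The difference of the two sums is the sum of \<open>q i * q i'\<close> over ordered
  pairs of distinct elements, so a larger set only adds nonnegative terms.\<close>

lemma pair_sum_mono:
  fixes q :: "'a \<Rightarrow> real"
  assumes "finite Y" "X \<subseteq> Y" "\<And>i. i \<in> Y \<Longrightarrow> 0 \<le> q i"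
  shows "(\<Sum>i\<in>X. q i)\<^sup>2 - (\<Sum>i\<in>X. (q i)\<^sup>2) \<le> (\<Sum>i\<in>Y. q i)\<^sup>2 - (\<Sum>i\<in>Y. (q i)\<^sup>2)"
proof -
  let ?Z = "Y - X"
  have 1: "(\<Sum>i\<in>Y. h i) = (\<Sum>i\<in>X. h i) + (\<Sum>i\<in>?Z. h i)" for h :: "'a \<Rightarrow> real"
    using assms by (metis add.commute sum.subset_diff)
  have "(\<Sum>i\<in>?Z. (q i)\<^sup>2) \<le> (\<Sum>i\<in>?Z. q i)\<^sup>2" using assms by (intro sum_squares_le_square_sum) auto
  moreover have "0 \<le> (\<Sum>i\<in>X. q i) * (\<Sum>i\<in>?Z. q i)" using assms by (intro mult_nonneg_nonneg sum_nonneg) auto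
  ultimately show ?thesis unfolding 1[of q] 1[of "\<lambda>i. (q i)\<^sup>2"] by (simp add: power2_sum)
qed

text \<open>The constant here is the source of the factor \<open>9\<close> in \<open>row_risk\<close> below.\<close>

lemma overflow_pairs:
  fixes q :: "'a \<Rightarrow> real"
  assumes fin: "finite T" and q: "\<And>i. i \<in> T \<Longrightarrow> 0 < q i \<and> q i \<le> 1 / 2" and over: "1 < (\<Sum>i\<in>T. q i)"
  obtains i where "i \<in> T" "1 / 9 \<le> (\<Sum>i'\<in>T - {i}. q i')\<^sup>2 - (\<Sum>i'\<in>T - {i}. (q i')\<^sup>2)"
proof -
  have ne: "T \<noteq> {}" using over by auto
  obtain i where i: "i \<in> T" and min: "\<And>i'. i' \<in> T \<Longrightarrow> q i \<le> q i'"
    using ne fin by (metis arg_min_if_finite(1) arg_min_least)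
  define L where "L = (\<Sum>i'\<in>T - {i}. q i')"
  have sumL: "(\<Sum>i\<in>T. q i) = q i + L" unfolding L_def using fin i by (simp add: sum.remove)
  \<comment> \<open>Two sizes of at most 1/2 cannot exceed 1, so at least two elements remain
    besides the smallest one. Hence the total is at most \<open>3 / 2 * L\<close>, which gives
    \<open>2 / 3 \<le> L\<close>.\<close>
  have "2 * q i \<le> L"
  proof -
    have "T - {i} \<noteq> {}" using over sumL q[OF i] unfolding L_def by fastforce
    then obtain x where x: "x \<in> T - {i}" by blast
    have Lx: "L = q x + (\<Sum>i'\<in>T - {i} - {x}. q i')" unfolding L_def using fin x by (simp add: sum.remove)
    have "T - {i} - {x} \<noteq> {}"
    proof
      assume e: "T - {i} - {x} = {}"
      have "L = q x" using Lx unfolding e by simp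
      then show False using over sumL q[OF i] q[of x] x by simp
    qed
    then obtain y where y: "y \<in> T - {i} - {x}" by blast
    have "q y \<le> (\<Sum>i'\<in>T - {i} - {x}. q i')" using y fin q by (intro member_le_sum) (auto intro: less_imp_le)
    then show ?thesis using Lx min[of x] min[of y] x y by simp
  qed
  then have L: "2 / 3 \<le> L" using over sumL by simp
  have "(\<Sum>i'\<in>T - {i}. (q i')\<^sup>2) \<le> (\<Sum>i'\<in>T - {i}. q i' * (1 / 2))"
    unfolding power2_eq_square using q by (intro sum_mono mult_left_mono) (auto intro: less_imp_le)
  also have "\<dots> = L / 2" unfolding L_def by (simp add: sum_divide_distrib)
  finally have s: "(\<Sum>i'\<in>T - {i}. (q i')\<^sup>2) \<le> L / 2" .
  \<comment> \<open>Sizes of at most 1/2 have squares summing to at most \<open>L / 2\<close>, so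
    the pairs are worth at least \<open>L * (L - 1 / 2)\<close>, and
    \<open>2 / 3 * (2 / 3 - 1 / 2) = 1 / 9\<close>.\<close>
  have "2 / 3 * (1 / 6) \<le> L * (L - 1 / 2)" using L by (intro mult_mono) auto
  then have "1 / 9 \<le> L\<^sup>2 - L / 2" by (simp add: power2_eq_square algebra_simps)
  with s have "1 / 9 \<le> L\<^sup>2 - (\<Sum>i'\<in>T - {i}. (q i')\<^sup>2)" by linarith
  then show thesis using that i unfolding L_def by blast
qed

section \<open>Sampling with multiplicative weights\<close>

text \<open>Rows \<open>j\<close> and \<open>m + j\<close> hold the big indicator and the small size
  at constraint \<open>j\<close>. Row \<open>2 * m + a\<close> is private to item \<open>a\<close>:
  an item that was picked but not sampled may be picked again, and this row limits how often.
  \<open>A\<close> is the optimum to compare with; it occurs only in the analysis.\<close>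

locale sampled_packing =
  fixes n m :: nat and C :: "nat \<Rightarrow> nat \<Rightarrow> real" and G A :: "nat set"
    and f :: "nat set \<Rightarrow> real" and p D \<epsilon> \<delta> :: real
  assumes G_sub: "G \<subseteq> {..<n}"
    and C_nonneg: "\<And>a r. a \<in> G \<Longrightarrow> 0 \<le> C a r"
    and C_le_1: "\<And>a r. a \<in> G \<Longrightarrow> C a r \<le> 1"
    and C_own: "\<And>a. a \<in> G \<Longrightarrow> C a (2 * m + a) = 1"
    and A_sub: "A \<subseteq> G"
    and A_packed: "\<And>r. r < 2 * m + n \<Longrightarrow> (\<Sum>e\<in>A. C e r) \<le> 1"
    and f_mono: "monotone_set_fun {..<n} f"
    and f_sub: "submodular {..<n} f"
    and p_pos: "0 < p" and p_le_1: "p \<le> 1" and D_ge_1: "1 \<le> D"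
    and eps_pos: "0 < \<epsilon>" and eps_le_1: "\<epsilon> \<le> 1" and del_pos: "0 < \<delta>" and del_le_1: "\<delta> \<le> 1"
begin

abbreviation "M \<equiv> 2 * m + n"

definition touched :: "nat \<Rightarrow> nat set" where
  "touched a = {j. j < m \<and> 0 < C a j + C a (m + j)}"

text \<open>Conditioned on the samples \<open>X\<close> drawn so far, this bounds the expected number of big items plus
  nine times the expected sum of pairwise products of small sizes at constraint \<open>j\<close> at the end: each
  row can still receive an expected load of at most \<open>p * (D - c r)\<close>.\<close>

definition row_risk :: "nat set \<Rightarrow> (nat \<Rightarrow> real) \<Rightarrow> nat \<Rightarrow> real" where
  "row_risk X c j = (\<Sum>i\<in>X. C i j) + p * (D - c j)
     + 9 * (((\<Sum>i\<in>X. C i (m + j)) + p * (D - c (m + j)))\<^sup>2 - (\<Sum>i\<in>X. (C i (m + j))\<^sup>2))"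

definition risk :: "nat set \<Rightarrow> (nat \<Rightarrow> real) \<Rightarrow> nat \<Rightarrow> real" where
  "risk X c a = (\<Sum>j\<in>touched a. row_risk X c j)"

definition advance :: "nat \<Rightarrow> (nat \<Rightarrow> real) \<Rightarrow> nat \<Rightarrow> real" where
  "advance a c r = c r + C a r"

definition reweight :: "nat \<Rightarrow> (nat \<Rightarrow> real) \<Rightarrow> nat \<Rightarrow> real" where
  "reweight a w r = w r * (1 + \<epsilon> * C a r)"

definition price :: "(nat \<Rightarrow> real) \<Rightarrow> nat \<Rightarrow> real" where
  "price w a = (\<Sum>r<M. C a r * w r)"

text \<open>The marginal value, discounted by the estimated chance that the item is later discarded
  because of a conflict.\<close>

definition gain :: "nat set \<Rightarrow> (nat \<Rightarrow> real) \<Rightarrow> nat \<Rightarrow> real" where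
  "gain R c a = (f (insert a R) - f R) * (1 - risk R c a)"

text \<open>The cut at \<open>1 - \<delta>\<close> makes the raw marginal value at most
  \<open>gain / \<delta>\<close>, so growth of \<open>f R\<close> can be charged to gain. It costs a
  \<open>\<delta>\<close> fraction of the optimum.\<close>

definition candidates :: "nat set \<Rightarrow> (nat \<Rightarrow> real) \<Rightarrow> nat set" where
  "candidates R c = {a \<in> G. a \<notin> R \<and> risk R c a \<le> 1 - \<delta>}"

text \<open>A smoothed maximum of the row loads, shifted to start at 0. It serves as continuous
  time: a pick advances it by at most its price divided by the total weight.\<close>

definition clock :: "(nat \<Rightarrow> real) \<Rightarrow> real" where
  "clock w = ln ((\<Sum>r<M. w r) / real M) / \<epsilon>"

text \<open>The time that the clock has certainly reached once some load exceeds
  \<open>D - 1\<close>; the losses against \<open>D - 1\<close> come from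
  \<open>ln (1 + x) \<ge> x - x\<^sup>2\<close> and from averaging the weights over \<open>M\<close>
  rows.\<close>

definition horizon :: real where
  "horizon = (D - 1) * (1 - \<epsilon>) - ln (real M) / \<epsilon>"

definition survivors :: "nat set \<Rightarrow> (nat \<Rightarrow> real) \<Rightarrow> nat set" where
  "survivors R c = {i \<in> R. risk (R - {i}) c i < 1}"

text \<open>The amount by which the candidates may fall short of the value of \<open>A\<close>: the
  share of each item of \<open>A\<close> lost to its risk, plus the value that \<open>R\<close>
  already covers.\<close>

definition debt :: "nat set \<Rightarrow> (nat \<Rightarrow> real) \<Rightarrow> real" where
  "debt R c = (\<Sum>e\<in>A. chain_marginal f {} A e * risk R c e) + (f R - f {})"

text \<open>The first sum estimates the surviving value of \<open>R\<close>. The second part is the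
  income still guaranteed: optimum minus debt per unit of clock, where income is counted only until
  \<open>horizon\<close>, but debt until the latest possible time \<open>D\<close>. The factor
  \<open>1 + p * D / \<delta>\<close> is a reserve paying for the debt that sampled items will
  add.\<close>

definition potential :: "nat set \<Rightarrow> (nat \<Rightarrow> real) \<Rightarrow> (nat \<Rightarrow> real) \<Rightarrow> (nat \<Rightarrow> real) \<Rightarrow> real" where
  "potential R c w g =
     (1 + p * D / \<delta>) * (\<Sum>i\<in>R. g i * (1 - risk (R - {i}) c i))
     + p * ((1 - \<delta>) * (f A - f {}) * (horizon - clock w) - debt R c * (D - clock w))"

text \<open>The ghost function \<open>g\<close> records the marginal value of each item at the moment it was sampled.\<close>

definition consistent :: "nat set \<Rightarrow> (nat \<Rightarrow> real) \<Rightarrow> (nat \<Rightarrow> real) \<Rightarrow> (nat \<Rightarrow> real) \<Rightarrow> bool" where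
  "consistent R c w g \<longleftrightarrow> R \<subseteq> G
     \<and> (\<forall>r<M. 0 \<le> c r \<and> c r \<le> D \<and> exp ((\<epsilon> - \<epsilon>\<^sup>2) * c r) \<le> w r \<and> w r \<le> exp (\<epsilon> * c r))
     \<and> (\<forall>i\<in>R. 0 \<le> g i) \<and> (\<forall>T\<subseteq>R. (\<Sum>i\<in>T. g i) \<le> f T - f {})"

section \<open>The pessimistic estimator and its drift\<close>

lemma finite_G: "finite G" using G_sub finite_subset by blast

lemma finite_sub_G: "X \<subseteq> G \<Longrightarrow> finite X" using finite_G finite_subset by blast

lemma finite_A: "finite A" using A_sub by (rule finite_sub_G)

lemma finite_touched: "finite (touched a)" unfolding touched_def by auto

lemma mono_on_G: "X \<subseteq> Y \<Longrightarrow> Y \<subseteq> G \<Longrightarrow> f X \<le> f Y"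
  using f_mono G_sub unfolding monotone_set_fun_def by (meson order_trans)

lemma marginal_antimono:
  "X \<subseteq> Y \<Longrightarrow> Y \<subseteq> G \<Longrightarrow> a \<in> G \<Longrightarrow> f (insert a Y) - f Y \<le> f (insert a X) - f X"
  using submodular_marginal_antimono[OF f_sub f_mono] G_sub by (meson order_trans subsetD)

text \<open>Dropping the nonnegative loads still to come leaves the conflicts already present in
  \<open>X\<close>.\<close>

lemma row_risk_ge:
  assumes "X \<subseteq> G" "j < m" "\<forall>r<M. c r \<le> D"
  shows "row_risk X c j \<ge> (\<Sum>i\<in>X. C i j) + 9 * ((\<Sum>i\<in>X. C i (m + j))\<^sup>2 - (\<Sum>i\<in>X. (C i (m + j))\<^sup>2))"
proof -
  have "0 \<le> p * (D - c j)" "0 \<le> p * (D - c (m + j))" using assms p_pos by auto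
  moreover have "0 \<le> (\<Sum>i\<in>X. C i (m + j))" using assms(1) C_nonneg by (auto intro!: sum_nonneg)
  ultimately have "(\<Sum>i\<in>X. C i (m + j))\<^sup>2 \<le> ((\<Sum>i\<in>X. C i (m + j)) + p * (D - c (m + j)))\<^sup>2"
    by (intro power_mono) auto
  then have "9 * ((\<Sum>i\<in>X. C i (m + j))\<^sup>2 - (\<Sum>i\<in>X. (C i (m + j))\<^sup>2))
      \<le> 9 * (((\<Sum>i\<in>X. C i (m + j)) + p * (D - c (m + j)))\<^sup>2 - (\<Sum>i\<in>X. (C i (m + j))\<^sup>2))"
    by simp
  with \<open>0 \<le> p * (D - c j)\<close> show ?thesis unfolding row_risk_def by (intro add_mono) auto
qed

lemma row_risk_nonneg:
  assumes "X \<subseteq> G" "j < m" "\<forall>r<M. c r \<le> D"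
  shows "0 \<le> row_risk X c j"
proof -
  have "0 \<le> (\<Sum>i\<in>X. C i j)" using assms(1) C_nonneg by (auto intro!: sum_nonneg)
  moreover have "(\<Sum>i\<in>X. (C i (m + j))\<^sup>2) \<le> (\<Sum>i\<in>X. C i (m + j))\<^sup>2"
    using assms(1) C_nonneg finite_sub_G by (intro sum_squares_le_square_sum) auto
  ultimately have "0 \<le> (\<Sum>i\<in>X. C i j)
      + 9 * ((\<Sum>i\<in>X. C i (m + j))\<^sup>2 - (\<Sum>i\<in>X. (C i (m + j))\<^sup>2))" by simp
  then show ?thesis using row_risk_ge[OF assms] by (rule order_trans)
qed

lemma row_risk_le_risk:
  assumes "X \<subseteq> G" "j \<in> touched a" "\<forall>r<M. c r \<le> D"
  shows "row_risk X c j \<le> risk X c a"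
  unfolding risk_def
  using assms row_risk_nonneg finite_touched
  by (intro member_le_sum) (auto simp: touched_def)

lemma risk_nonneg: "X \<subseteq> G \<Longrightarrow> \<forall>r<M. c r \<le> D \<Longrightarrow> 0 \<le> risk X c a"
  unfolding risk_def by (rule sum_nonneg) (auto simp: touched_def intro: row_risk_nonneg)

text \<open>The terms linear in the load balance exactly: a sampled coefficient is present with
  probability \<open>p\<close> and the remaining expected load shrinks by \<open>p\<close> times it.
  For the squared load, sampling adds the variance \<open>p * (1 - p) * q\<^sup>2\<close> while the
  diagonal term removes \<open>p * q\<^sup>2\<close>, so the slack is
  \<open>9 * p\<^sup>2 * q\<^sup>2\<close>.\<close>

lemma row_risk_step:
  assumes "X \<subseteq> G" "a \<notin> X"
  shows "p * row_risk (insert a X) (advance a c) j + (1 - p) * row_risk X (advance a c) j \<le> row_risk X c j"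
proof -
  define B L S2 q b where defs: "B = (\<Sum>i\<in>X. C i j)" "L = (\<Sum>i\<in>X. C i (m + j))"
    "S2 = (\<Sum>i\<in>X. (C i (m + j))\<^sup>2)" "q = C a (m + j)" "b = C a j"
  have fin: "finite X" using assms finite_sub_G by blast
  have "row_risk X c j - (p * row_risk (insert a X) (advance a c) j + (1 - p) * row_risk X (advance a c) j)
      = 9 * p\<^sup>2 * q\<^sup>2"
    unfolding row_risk_def advance_def using fin assms(2)
    by (simp add: defs[symmetric]) (simp add: power2_eq_square algebra_simps)
  moreover have "0 \<le> 9 * p\<^sup>2 * q\<^sup>2" by simp
  ultimately show ?thesis by linarith
qed

lemma risk_step:
  assumes "X \<subseteq> G" "a \<notin> X"
  shows "p * risk (insert a X) (advance a c) i + (1 - p) * risk X (advance a c) i \<le> risk X c i"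
  unfolding risk_def sum_distrib_left sum.distrib[symmetric]
  by (rule sum_mono) (rule row_risk_step[OF assms])

lemma risk_advance_le:
  assumes "X \<subseteq> G" "a \<in> G" "\<forall>r<M. advance a c r \<le> D"
  shows "risk X (advance a c) i \<le> risk X c i"
  unfolding risk_def
proof (rule sum_mono)
  fix j assume "j \<in> touched i"
  hence j: "j < m" by (simp add: touched_def)
  have L: "0 \<le> (\<Sum>i\<in>X. C i (m + j))" using assms(1) C_nonneg by (auto intro!: sum_nonneg)
  have 0: "0 \<le> p * (D - advance a c (m + j))" using assms(3) j p_pos by auto
  have le: "p * (D - advance a c r) \<le> p * (D - c r)" for r
    using C_nonneg[OF assms(2), of r] p_pos by (simp add: advance_def)
  have "((\<Sum>i\<in>X. C i (m + j)) + p * (D - advance a c (m + j)))\<^sup>2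
      \<le> ((\<Sum>i\<in>X. C i (m + j)) + p * (D - c (m + j)))\<^sup>2"
    using L 0 le[of "m + j"] by (intro power_mono) auto
  then show "row_risk X (advance a c) j \<le> row_risk X c j"
    unfolding row_risk_def using le[of j] by simp
qed

section \<open>The optimum measured against the current sample\<close>

lemma chain_marginal_nonneg:
  assumes "R \<subseteq> G"
  shows "0 \<le> chain_marginal f R A i"
proof -
  have "f (R \<union> A \<inter> {..<i}) \<le> f (R \<union> A \<inter> {..i})" using assms A_sub by (intro mono_on_G) auto
  then show ?thesis by (simp add: chain_marginal_def)
qed

lemma chain_marginal_bounds:
  assumes "R \<subseteq> G" "i \<in> A"
  shows "chain_marginal f R A i \<le> chain_marginal f {} A i"
    and "chain_marginal f R A i \<le> f (insert i R) - f R"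
proof -
  have "A \<inter> {..i} = insert i (A \<inter> {..<i})" using assms(2) by auto
  then have eq: "chain_marginal f X A i = f (insert i (X \<union> A \<inter> {..<i})) - f (X \<union> A \<inter> {..<i})" for X
    by (simp add: chain_marginal_def)
  show "chain_marginal f R A i \<le> chain_marginal f {} A i"
    and "chain_marginal f R A i \<le> f (insert i R) - f R"
    unfolding eq using assms A_sub by (auto intro!: marginal_antimono)
qed

lemma gain_nonneg:
  assumes "R \<subseteq> G" "a \<in> candidates R c"
  shows "0 \<le> gain R c a"
proof -
  have "f R \<le> f (insert a R)" using assms by (intro mono_on_G) (auto simp: candidates_def)
  then show ?thesis using assms(2) del_pos unfolding gain_def candidates_def by auto
qed

text \<open>Charging is done item by item on \<open>A\<close>. A candidate loses only its risk
  share; an item of \<open>R\<close> has no marginal value left; an item rejected for its risk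
  satisfies \<open>1 \<le> \<delta> + risk\<close>, so its whole value fits into the
  \<open>\<delta>\<close> share and the risk share. Summing uses
  \<open>f A \<le> f (R \<union> A)\<close>, and \<open>f R - f {}\<close> enters the debt.\<close>

lemma candidate_gains_ge:
  assumes "R \<subseteq> G" "\<forall>r<M. c r \<le> D"
  shows "(1 - \<delta>) * (f A - f {}) - debt R c \<le> (\<Sum>e\<in>A \<inter> candidates R c. gain R c e)"
proof -
  let ?h = "chain_marginal f {} A" and ?c = "chain_marginal f R A"
  have each: "?c e - \<delta> * ?h e - ?h e * risk R c e \<le> (if e \<in> candidates R c then gain R c e else 0)"
    if e: "e \<in> A" for e
  proof -
    have h0: "0 \<le> ?h e" and c0: "0 \<le> ?c e" using chain_marginal_nonneg assms by auto
    have K0: "0 \<le> risk R c e" using risk_nonneg assms by blast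
    note b = chain_marginal_bounds[OF assms(1) e]
    consider "e \<in> candidates R c" | "e \<in> R" | "e \<notin> candidates R c" "e \<notin> R" by blast
    then show ?thesis
    proof cases
      case 1
      then have y: "0 \<le> 1 - risk R c e" using del_pos by (auto simp: candidates_def)
      have "?c e * (1 - risk R c e) \<le> gain R c e"
        unfolding gain_def by (rule mult_right_mono[OF b(2) y])
      moreover have "?c e * risk R c e \<le> ?h e * risk R c e" by (rule mult_right_mono[OF b(1) K0])
      moreover have "0 \<le> \<delta> * ?h e" using h0 del_pos by simp
      ultimately show ?thesis using 1 by (simp add: right_diff_distrib)
    next
      case 2
      then have "?c e \<le> 0" using b(2) by (simp add: insert_absorb)
      moreover have "0 \<le> \<delta> * ?h e" "0 \<le> ?h e * risk R c e" using h0 K0 del_pos by auto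
      moreover have "e \<notin> candidates R c" using 2 by (simp add: candidates_def)
      ultimately show ?thesis by simp
    next
      case 3
      then have "1 \<le> \<delta> + risk R c e" using e A_sub by (auto simp: candidates_def)
      then have "?h e * 1 \<le> ?h e * (\<delta> + risk R c e)" using h0 by (intro mult_left_mono)
      then show ?thesis using 3 b(1) by (simp add: algebra_simps)
    qed
  qed
  have "f A \<le> f (R \<union> A)" using assms A_sub by (intro mono_on_G) auto
  have An: "A \<subseteq> {..<n}" using A_sub G_sub by blast
  have "(1 - \<delta>) * (f A - f {}) - debt R c
      \<le> (f (R \<union> A) - f R) - \<delta> * (f A - f {}) - (\<Sum>e\<in>A. ?h e * risk R c e)"
    using \<open>f A \<le> f (R \<union> A)\<close> unfolding debt_def by (simp add: algebra_simps)
  also have "\<dots> = (\<Sum>e\<in>A. ?c e - \<delta> * ?h e - ?h e * risk R c e)"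
    using sum_chain_marginal[OF An, of f R] sum_chain_marginal[OF An, of f "{}"]
    by (simp add: sum_subtractf sum_distrib_left[symmetric])
  also have "\<dots> \<le> (\<Sum>e\<in>A. if e \<in> candidates R c then gain R c e else 0)"
    by (rule sum_mono) (rule each)
  also have "\<dots> = (\<Sum>e\<in>A \<inter> candidates R c. gain R c e)"
    using finite_A by (simp add: sum.inter_restrict)
  finally show ?thesis .
qed

section \<open>Loads, weights and the clock along a run\<close>

context
  fixes R c w g
  assumes cons: "consistent R c w g"
begin

lemma R_sub: "R \<subseteq> G" and c_le_D: "\<forall>r<M. c r \<le> D"
  and w_pos: "r < M \<Longrightarrow> 0 < w r"
  using cons unfolding consistent_def by (auto intro: less_le_trans[OF exp_gt_zero])

lemma M_pos: "a \<in> G \<Longrightarrow> 0 < M" using G_sub by auto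

lemma W_pos: "0 < M \<Longrightarrow> 0 < (\<Sum>r<M. w r)"
  using w_pos by (intro sum_pos) (auto simp: lessThan_empty_iff)

lemma price_pos: "a \<in> G \<Longrightarrow> 0 < price w a"
  unfolding price_def
proof (rule sum_pos2)
  assume a: "a \<in> G"
  show "2 * m + a \<in> {..<M}" using a G_sub by auto
  then show "0 < C a (2 * m + a) * w (2 * m + a)" using w_pos C_own[OF a] by simp
  show "0 \<le> C a r * w r" if "r \<in> {..<M}" for r
    using that w_pos[of r] C_nonneg[OF a] by simp
qed simp

lemma clock_le_D: "clock w \<le> D"
proof (cases "M = 0")
  \<comment> \<open>With no rows, both the quotient \<open>0 / 0\<close> and its logarithm have the
    default value 0.\<close>
  case True
  then show ?thesis unfolding clock_def using D_ge_1 by simp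
next
  case False
  then have assms: "0 < M" by simp
  have "w r \<le> exp (\<epsilon> * D)" if "r < M" for r
  proof -
    have "w r \<le> exp (\<epsilon> * c r)" using cons that unfolding consistent_def by blast
    also have "\<dots> \<le> exp (\<epsilon> * D)" using c_le_D that eps_pos by simp
    finally show ?thesis .
  qed
  then have "(\<Sum>r<M. w r) \<le> real M * exp (\<epsilon> * D)"
    using sum_bounded_above[of "{..<M}" w "exp (\<epsilon> * D)"] by simp
  moreover have M0: "0 < real M" using assms by (simp only: of_nat_0_less_iff)
  ultimately have "(\<Sum>r<M. w r) / real M \<le> exp (\<epsilon> * D)"
    by (simp only: pos_divide_le_eq mult.commute)
  then have "ln ((\<Sum>r<M. w r) / real M) \<le> \<epsilon> * D"
    using divide_pos_pos[OF W_pos[OF assms] M0] by (metis exp_le_cancel_iff exp_ln)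
  then show ?thesis unfolding clock_def using eps_pos by (simp add: divide_simps mult.commute)
qed

text \<open>One heavy row alone has weight at least
  \<open>exp ((\<epsilon> - \<epsilon>\<^sup>2) * (D - 1))\<close>, and the total weight is no
  smaller; dividing by \<open>M\<close> costs \<open>ln M / \<epsilon>\<close>.\<close>

lemma horizon_le_clock:
  assumes "r < M" "D - 1 < c r"
  shows "horizon \<le> clock w"
proof -
  have M0: "0 < real M" using assms by linarith
  have e: "0 \<le> \<epsilon> - \<epsilon>\<^sup>2" using eps_pos eps_le_1 by (simp add: power2_eq_square)
  have "exp ((\<epsilon> - \<epsilon>\<^sup>2) * (D - 1)) \<le> exp ((\<epsilon> - \<epsilon>\<^sup>2) * c r)"
    using assms e by (simp add: mult_left_mono)
  also have "\<dots> \<le> w r" using cons assms unfolding consistent_def by blast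
  also have "\<dots> \<le> (\<Sum>r<M. w r)" using assms w_pos by (intro member_le_sum) (auto intro: less_imp_le)
  finally have "(\<epsilon> - \<epsilon>\<^sup>2) * (D - 1) \<le> ln (\<Sum>r<M. w r)"
    using W_pos assms by (metis exp_le_cancel_iff exp_ln gr_zeroI not_less_zero)
  then have "(\<epsilon> - \<epsilon>\<^sup>2) * (D - 1) - ln (real M) \<le> ln ((\<Sum>r<M. w r) / real M)"
    using ln_divide_pos[OF W_pos M0] M0 by (simp only: of_nat_0_less_iff)
  then have "((\<epsilon> - \<epsilon>\<^sup>2) * (D - 1) - ln (real M)) / \<epsilon> \<le> clock w"
    unfolding clock_def using eps_pos by (simp add: divide_right_mono)
  moreover have "((\<epsilon> - \<epsilon>\<^sup>2) * (D - 1) - ln (real M)) / \<epsilon> = horizon"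
    unfolding horizon_def using eps_pos by (simp add: field_simps power2_eq_square)
  ultimately show ?thesis by simp
qed

lemma W_reweight: "(\<Sum>r<M. reweight a w r) = (\<Sum>r<M. w r) + \<epsilon> * price w a"
  unfolding reweight_def price_def by (simp add: algebra_simps sum.distrib sum_distrib_left)

text \<open>The total weight grows by \<open>\<epsilon> * price w a\<close>, and
  \<open>ln (1 + x) \<le> x\<close>.\<close>

lemma clock_reweight:
  assumes "a \<in> G"
  shows "clock w \<le> clock (reweight a w)"
    and "clock (reweight a w) - clock w \<le> price w a / (\<Sum>r<M. w r)"
proof -
  let ?W = "\<Sum>r<M. w r"
  have M0: "0 < M" using M_pos assms by blast
  have W0: "0 < ?W" using W_pos M0 by blast
  have P0: "0 < price w a" using price_pos assms by blast
  have "clock (reweight a w) - clock w = (ln (?W + \<epsilon> * price w a) - ln ?W) / \<epsilon>"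
  proof -
    have Mr: "0 < real M" using M0 by (simp only: of_nat_0_less_iff)
    have W1: "0 < ?W + \<epsilon> * price w a" using W0 P0 eps_pos by (simp add: add_pos_pos)
    show ?thesis
      unfolding clock_def W_reweight ln_divide_pos[OF W0 Mr] ln_divide_pos[OF W1 Mr]
      by (simp add: diff_divide_distrib)
  qed
  also have "ln (?W + \<epsilon> * price w a) - ln ?W = ln (1 + \<epsilon> * price w a / ?W)"
  proof -
    have "0 < ?W + \<epsilon> * price w a" using W0 P0 eps_pos by (simp add: add_pos_pos)
    from ln_divide_pos[OF this W0] show ?thesis using W0 by (simp add: add_divide_distrib)
  qed
  finally have eq: "clock (reweight a w) - clock w = ln (1 + \<epsilon> * price w a / ?W) / \<epsilon>" .
  have x0: "0 \<le> \<epsilon> * price w a / ?W" using W0 P0 eps_pos by simp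
  have "ln (1 + \<epsilon> * price w a / ?W) \<le> \<epsilon> * price w a / ?W" by (rule ln_add_one_self_le_self[OF x0])
  then show "clock (reweight a w) - clock w \<le> price w a / ?W"
    unfolding eq using eps_pos by (simp add: field_simps)
  have "0 \<le> ln (1 + \<epsilon> * price w a / ?W)" using x0 by simp
  then show "clock w \<le> clock (reweight a w)" using eq eps_pos
    by (metis diff_ge_0_iff_ge divide_nonneg_pos)
qed

text \<open>Coefficients are at most 1, so one unit of room suffices. The lower exponent
  \<open>\<epsilon> - \<epsilon>\<^sup>2\<close> is what
  \<open>ln (1 + x) \<ge> x - x\<^sup>2\<close> yields at \<open>x = \<epsilon> * C a r\<close>,
  because \<open>(C a r)\<^sup>2 \<le> C a r\<close>.\<close>

lemma consistent_advance:
  assumes a: "a \<in> G" and room: "\<forall>r<M. c r \<le> D - 1"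
  shows "consistent R (advance a c) (reweight a w) g"
proof -
  have "0 \<le> advance a c r \<and> advance a c r \<le> D \<and> exp ((\<epsilon> - \<epsilon>\<^sup>2) * advance a c r) \<le> reweight a w r
      \<and> reweight a w r \<le> exp (\<epsilon> * advance a c r)" if r: "r < M" for r
  proof -
    let ?x = "C a r"
    have x: "0 \<le> ?x" "?x \<le> 1" using C_nonneg C_le_1 a by auto
    have cr: "0 \<le> c r" "exp ((\<epsilon> - \<epsilon>\<^sup>2) * c r) \<le> w r" "w r \<le> exp (\<epsilon> * c r)"
      using cons r unfolding consistent_def by auto
    have ex: "0 \<le> \<epsilon> * ?x" "\<epsilon> * ?x \<le> 1" using x eps_pos eps_le_1 by (auto simp: mult_le_one)
    have "\<epsilon> * ?x - (\<epsilon> * ?x)\<^sup>2 \<le> ln (1 + \<epsilon> * ?x)" by (rule ln_one_plus_pos_lower_bound[OF ex])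
    moreover have "(\<epsilon> * ?x)\<^sup>2 \<le> \<epsilon>\<^sup>2 * ?x"
      unfolding power_mult_distrib using x by (intro mult_left_mono) (auto simp: power2_eq_square mult_left_le)
    ultimately have "(\<epsilon> - \<epsilon>\<^sup>2) * ?x \<le> ln (1 + \<epsilon> * ?x)" by (simp add: algebra_simps)
    then have lo: "exp ((\<epsilon> - \<epsilon>\<^sup>2) * ?x) \<le> 1 + \<epsilon> * ?x"
      using ex by (metis add_pos_nonneg exp_le_cancel_iff exp_ln zero_less_one)
    have hi: "1 + \<epsilon> * ?x \<le> exp (\<epsilon> * ?x)" by (rule exp_ge_add_one_self)
    have w0: "0 \<le> w r" using w_pos[OF r] by simp
    have "exp ((\<epsilon> - \<epsilon>\<^sup>2) * advance a c r) = exp ((\<epsilon> - \<epsilon>\<^sup>2) * c r) * exp ((\<epsilon> - \<epsilon>\<^sup>2) * ?x)"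
      by (simp add: advance_def exp_add[symmetric] algebra_simps)
    also have "\<dots> \<le> w r * (1 + \<epsilon> * ?x)" using cr lo w0 by (intro mult_mono) auto
    finally have 1: "exp ((\<epsilon> - \<epsilon>\<^sup>2) * advance a c r) \<le> reweight a w r" by (simp add: reweight_def)
    have "reweight a w r \<le> exp (\<epsilon> * c r) * exp (\<epsilon> * ?x)"
      unfolding reweight_def using cr hi ex by (intro mult_mono) auto
    then have 2: "reweight a w r \<le> exp (\<epsilon> * advance a c r)"
      by (simp add: advance_def exp_add[symmetric] algebra_simps)
    show ?thesis using 1 2 cr x room r by (auto simp: advance_def add_increasing)
  qed
  then show ?thesis using cons unfolding consistent_def by simp
qed

text \<open>By submodularity the marginal value recorded at sampling time is at most the marginal
  value over any subset of \<open>R\<close>. This is why the bound on \<open>g\<close> can be kept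
  for all subsets, which is needed later for the survivors.\<close>

lemma consistent_insert:
  assumes a: "a \<in> G" "a \<notin> R"
  shows "consistent (insert a R) c w (g(a := f (insert a R) - f R))"
proof -
  let ?g = "g(a := f (insert a R) - f R)"
  have "f R \<le> f (insert a R)" using R_sub a by (intro mono_on_G) auto
  moreover have "(\<Sum>i\<in>T. ?g i) \<le> f T - f {}" if T: "T \<subseteq> insert a R" for T
  proof -
    have T': "T - {a} \<subseteq> R" using T by auto
    have "(\<Sum>i\<in>T - {a}. g i) \<le> f (T - {a}) - f {}" using cons T' unfolding consistent_def by blast
    moreover have "(\<Sum>i\<in>T - {a}. ?g i) = (\<Sum>i\<in>T - {a}. g i)" by (rule sum.cong) auto
    ultimately have *: "(\<Sum>i\<in>T - {a}. ?g i) \<le> f (T - {a}) - f {}" by simp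
    show ?thesis
    proof (cases "a \<in> T")
      case True
      have fin: "finite T" using T R_sub a finite_sub_G by (meson insert_subset subset_trans)
      have "f (insert a R) - f R \<le> f (insert a (T - {a})) - f (T - {a})"
        using T' R_sub a by (intro marginal_antimono) auto
      with * True fin show ?thesis by (simp add: sum.remove insert_absorb)
    next
      case False
      with * show ?thesis by simp
    qed
  qed
  ultimately show ?thesis using cons a unfolding consistent_def by auto
qed

end

section \<open>Drift and boundary values of the potential\<close>

lemma debt_step:
  assumes "R \<subseteq> G" "a \<notin> R"
  shows "p * debt (insert a R) (advance a c) + (1 - p) * debt R (advance a c)
    \<le> debt R c + p * (f (insert a R) - f R)"
proof -
  let ?h = "chain_marginal f {} A"
  have "p * (\<Sum>e\<in>A. ?h e * risk (insert a R) (advance a c) e)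
      + (1 - p) * (\<Sum>e\<in>A. ?h e * risk R (advance a c) e)
      = (\<Sum>e\<in>A. ?h e * (p * risk (insert a R) (advance a c) e + (1 - p) * risk R (advance a c) e))"
    unfolding sum_distrib_left sum.distrib[symmetric] by (rule sum.cong) (auto simp: algebra_simps)
  also have "\<dots> \<le> (\<Sum>e\<in>A. ?h e * risk R c e)"
    using risk_step[OF assms] chain_marginal_nonneg by (intro sum_mono mult_left_mono) auto
  finally show ?thesis unfolding debt_def by (simp add: algebra_simps)
qed

lemma debt_nonneg:
  assumes "R \<subseteq> G" "\<forall>r<M. c r \<le> D"
  shows "0 \<le> debt R c"
proof -
  have "0 \<le> (\<Sum>e\<in>A. chain_marginal f {} A e * risk R c e)"
    using chain_marginal_nonneg risk_nonneg[OF assms] by (intro sum_nonneg mult_nonneg_nonneg) auto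
  moreover have "f {} \<le> f R" using assms by (intro mono_on_G) auto
  ultimately show ?thesis unfolding debt_def by simp
qed

text \<open>Sampling earns \<open>p * ?z\<close> in expectation. The clock advance \<open>dt\<close>
  uses up income worth \<open>p * (?F - debt R c) * dt\<close>, which greediness bounds by
  \<open>p * ?z\<close>. The growth of the debt is covered by the reserve, and the risks in the
  estimate of the surviving value do not grow on average.\<close>

theorem potential_step:
  assumes cons: "consistent R c w g" and room: "\<forall>r<M. c r \<le> D - 1"
    and a: "a \<in> candidates R c"
    and best: "\<And>b. b \<in> candidates R c \<Longrightarrow> gain R c b / price w b \<le> gain R c a / price w a"
  shows "potential R c w g
    \<le> p * potential (insert a R) (advance a c) (reweight a w) (g(a := f (insert a R) - f R))
      + (1 - p) * potential R (advance a c) (reweight a w) g"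
proof -
  let ?c = "advance a c" and ?w = "reweight a w" and ?v = "f (insert a R) - f R"
  let ?g = "g(a := ?v)" and ?z = "gain R c a" and ?F = "(1 - \<delta>) * (f A - f {})"
  let ?W = "\<Sum>r<M. w r"
  note RG = R_sub[OF cons]
  have aG: "a \<in> G" and aR: "a \<notin> R" and risk_a: "risk R c a \<le> 1 - \<delta>"
    using a by (auto simp: candidates_def)
  have finR: "finite R" using RG finite_sub_G by blast
  have c_le: "\<forall>r<M. c r \<le> D" using c_le_D[OF cons] .
  have cons': "consistent R ?c ?w g" by (rule consistent_advance[OF cons aG room])
  have c'_le: "\<forall>r<M. ?c r \<le> D" using c_le_D[OF cons'] .
  have M0: "0 < M" using M_pos[OF cons] aG by blast
  have W0: "0 < ?W" by (rule W_pos[OF cons M0])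
  have P0: "b \<in> candidates R c \<Longrightarrow> 0 < price w b" for b
    using price_pos[OF cons] by (auto simp: candidates_def)
  have z0: "0 \<le> ?z" using gain_nonneg[OF RG a] .
  have v0: "0 \<le> ?v" using mono_on_G[of R "insert a R"] RG aG by auto
  have vz: "?v \<le> ?z / \<delta>"
  proof -
    have "?v * \<delta> \<le> ?z" unfolding gain_def using v0 risk_a by (intro mult_left_mono) auto
    then show ?thesis using del_pos by (simp add: field_simps)
  qed
  define dt where "dt = clock ?w - clock w"
  have dt0: "0 \<le> dt" and dtP: "dt \<le> price w a / ?W"
    using clock_reweight[OF cons aG] unfolding dt_def by auto
  define left where "left = D - clock w"
  have left': "0 \<le> left - dt" using clock_le_D[OF cons'] unfolding left_def dt_def by simp
  \<comment> \<open>All weights are at least 1, hence the clock is nonnegative and at most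
    \<open>D\<close> units of time remain.\<close>
  have leftD: "left - dt \<le> D"
  proof -
    have "real M \<le> ?W"
    proof -
      have "1 \<le> w r" if "r < M" for r
      proof -
        have e: "0 \<le> \<epsilon> - \<epsilon>\<^sup>2" using eps_pos eps_le_1 by (simp add: power2_eq_square)
        have "0 \<le> c r" "exp ((\<epsilon> - \<epsilon>\<^sup>2) * c r) \<le> w r" using cons that unfolding consistent_def by auto
        moreover have "1 \<le> exp ((\<epsilon> - \<epsilon>\<^sup>2) * c r)" using e \<open>0 \<le> c r\<close> by simp
        ultimately show ?thesis by linarith
      qed
      then show ?thesis using sum_bounded_below[of "{..<M}" 1 w] by simp
    qed
    moreover have "0 < real M" using M0 by (simp only: of_nat_0_less_iff)
    ultimately have "1 \<le> ?W / real M" by (simp only: pos_le_divide_eq mult_1)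
    then have "0 \<le> clock w" unfolding clock_def using eps_pos
      by (intro divide_nonneg_nonneg ln_ge_zero) auto
    with dt0 show ?thesis unfolding left_def by simp
  qed
  \<comment> \<open>The greedy choice earns value at least at the rate of the remaining optimum per unit of clock.\<close>
  have rate: "(?F - debt R c) * dt \<le> ?z"
  proof (cases "0 \<le> ?F - debt R c")
    case True
    have "?F - debt R c \<le> (\<Sum>e\<in>A \<inter> candidates R c. gain R c e)"
      by (rule candidate_gains_ge[OF RG c_le])
    also have "\<dots> \<le> (\<Sum>e\<in>A \<inter> candidates R c. (?z / price w a) * price w e)"
    proof (rule sum_mono)
      fix e assume "e \<in> A \<inter> candidates R c"
      then show "gain R c e \<le> ?z / price w a * price w e"
        using best[of e] P0[of e] by (simp add: pos_divide_le_eq)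
    qed
    also have "\<dots> = (?z / price w a) * (\<Sum>e\<in>A \<inter> candidates R c. price w e)"
      by (simp add: sum_distrib_left)
    also have "\<dots> \<le> (?z / price w a) * ?W"
    proof (rule mult_left_mono)
      have "(\<Sum>e\<in>A \<inter> candidates R c. price w e) \<le> (\<Sum>e\<in>A. price w e)"
        using finite_A price_pos[OF cons] A_sub by (intro sum_mono2) (auto intro: less_imp_le)
      \<comment> \<open>The prices over \<open>A\<close> add up to a weighted sum of the row loads
        of \<open>A\<close>, each of which is at most 1.\<close>
      also have "\<dots> = (\<Sum>r<M. w r * (\<Sum>e\<in>A. C e r))"
        unfolding price_def by (subst sum.swap) (simp add: sum_distrib_left mult.commute)
      also have "\<dots> \<le> (\<Sum>r<M. w r * 1)"
        using A_packed w_pos[OF cons] by (intro sum_mono mult_left_mono) (auto intro: less_imp_le)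
      finally show "(\<Sum>e\<in>A \<inter> candidates R c. price w e) \<le> ?W" by simp
      show "0 \<le> ?z / price w a" using z0 P0[OF a] by simp
    qed
    finally have Z: "?F - debt R c \<le> ?z / price w a * ?W" .
    have "(?F - debt R c) * dt \<le> (?F - debt R c) * (price w a / ?W)"
      using True dtP by (rule mult_left_mono[rotated])
    also have "\<dots> \<le> (?z / price w a * ?W) * (price w a / ?W)"
      using Z P0[OF a] W0 by (intro mult_right_mono) auto
    also have "\<dots> = ?z" using P0[OF a] W0 by simp
    finally show ?thesis .
  next
    case False
    then have "(?F - debt R c) * dt \<le> 0" using dt0 by (simp add: mult_nonpos_nonneg)
    with z0 show ?thesis by linarith
  qed
  define X where "X R c g = (\<Sum>i\<in>R. g i * (1 - risk (R - {i}) c i))" for R :: "nat set" and c g :: "nat \<Rightarrow> real"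
  have X_step: "X R c g + p * ?z \<le> p * X (insert a R) ?c ?g + (1 - p) * X R ?c g"
  proof -
    have "X (insert a R) ?c ?g = ?v * (1 - risk R ?c a) + (\<Sum>i\<in>R. g i * (1 - risk (insert a (R - {i})) ?c i))"
    proof -
      have "insert a R - {a} = R" using aR by auto
      moreover have "(\<Sum>i\<in>R. ?g i * (1 - risk (insert a R - {i}) ?c i))
          = (\<Sum>i\<in>R. g i * (1 - risk (insert a (R - {i})) ?c i))"
        using aR by (intro sum.cong) (auto simp: insert_Diff_if)
      ultimately show ?thesis unfolding X_def using finR aR by simp
    qed
    moreover have "?z \<le> ?v * (1 - risk R ?c a)"
      unfolding gain_def using v0 risk_advance_le[OF RG aG c'_le, of a] by (intro mult_left_mono) auto
    ultimately have 1: "?z + (\<Sum>i\<in>R. g i * (1 - risk (insert a (R - {i})) ?c i)) \<le> X (insert a R) ?c ?g"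
      by linarith
    have "X R c g \<le> (\<Sum>i\<in>R. g i * (1 - (p * risk (insert a (R - {i})) ?c i + (1 - p) * risk (R - {i}) ?c i)))"
      unfolding X_def
    proof (intro sum_mono mult_left_mono)
      fix i assume i: "i \<in> R"
      show "0 \<le> g i" using cons i unfolding consistent_def by blast
      show "1 - risk (R - {i}) c i \<le> 1 - (p * risk (insert a (R - {i})) ?c i + (1 - p) * risk (R - {i}) ?c i)"
        using risk_step[of "R - {i}" a c i] RG aR by (simp add: subset_eq)
    qed
    also have "\<dots> = p * (\<Sum>i\<in>R. g i * (1 - risk (insert a (R - {i})) ?c i)) + (1 - p) * X R ?c g"
      unfolding X_def sum_distrib_left sum.distrib[symmetric] by (rule sum.cong) (auto simp: algebra_simps)
    also have "\<dots> \<le> p * (X (insert a R) ?c ?g - ?z) + (1 - p) * X R ?c g"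
      using 1 p_pos by (intro add_right_mono mult_left_mono) auto
    finally show ?thesis by (simp add: algebra_simps)
  qed
  define kap where "kap = p * D / \<delta>"
  have kap0: "0 \<le> kap" unfolding kap_def using p_pos D_ge_1 del_pos by simp
  have dstep: "p * debt (insert a R) ?c + (1 - p) * debt R ?c \<le> debt R c + p * ?v"
    by (rule debt_step[OF RG aR])
  \<comment> \<open>The value \<open>?v\<close> that a sampled item adds to the debt is owed for the
    rest of the clock, at most \<open>D\<close>; with \<open>?v \<le> ?z / \<delta>\<close> this
    costs exactly what the reserve \<open>kap\<close> provides.\<close>
  have "p * ?v * (left - dt) \<le> p * (?z / \<delta>) * D"
    using vz v0 leftD left' p_pos z0 del_pos by (intro mult_mono) auto
  also have "\<dots> = kap * ?z" unfolding kap_def by simp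
  finally have vbound: "p * ?v * (left - dt) \<le> kap * ?z" .
  have "(p * debt (insert a R) ?c + (1 - p) * debt R ?c) * (left - dt) \<le> (debt R c + p * ?v) * (left - dt)"
    using dstep left' by (rule mult_right_mono)
  also have "\<dots> \<le> debt R c * (left - dt) + kap * ?z" using vbound by (simp add: distrib_right)
  finally have d2: "(p * debt (insert a R) ?c + (1 - p) * debt R ?c) * (left - dt)
      \<le> debt R c * (left - dt) + kap * ?z" .
  have pot: "potential R c w g = (1 + kap) * X R c g + p * (?F * (horizon - clock w) - debt R c * left)"
    unfolding potential_def X_def kap_def left_def by simp
  have pot': "potential S ?c ?w g' = (1 + kap) * X S ?c g'
      + p * (?F * (horizon - clock w - dt) - debt S ?c * (left - dt))" for S g'
    unfolding potential_def X_def kap_def left_def dt_def by simp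
  have "p * potential (insert a R) ?c ?w ?g + (1 - p) * potential R ?c ?w g
     = (1 + kap) * (p * X (insert a R) ?c ?g + (1 - p) * X R ?c g)
       + p * (?F * (horizon - clock w - dt) - (p * debt (insert a R) ?c + (1 - p) * debt R ?c) * (left - dt))"
    unfolding pot' by (simp add: algebra_simps)
  also have "\<dots> \<ge> (1 + kap) * (X R c g + p * ?z)
       + p * (?F * (horizon - clock w - dt) - (debt R c * (left - dt) + kap * ?z))"
    using X_step kap0 d2 p_pos
    by (intro add_mono[OF mult_left_mono mult_left_mono[OF diff_mono]]) auto
  moreover have "(1 + kap) * (X R c g + p * ?z)
       + p * (?F * (horizon - clock w - dt) - (debt R c * (left - dt) + kap * ?z))
      = potential R c w g + p * (?z - (?F - debt R c) * dt)"
    unfolding pot by (simp add: algebra_simps)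
  moreover have "0 \<le> p * (?z - (?F - debt R c) * dt)" using rate p_pos by simp
  ultimately show ?thesis by linarith
qed

text \<open>An item that fails the survival test has \<open>1 - risk \<le> 0\<close> and contributes
  nothing positive; a survivor contributes at most \<open>g i\<close>. The subset bound in
  \<open>consistent\<close> converts the remaining sum into a value of \<open>f\<close>.\<close>

lemma survivors_value:
  assumes cons: "consistent R c w g"
  shows "(\<Sum>i\<in>R. g i * (1 - risk (R - {i}) c i)) \<le> f (survivors R c) - f {}"
proof -
  note RG = R_sub[OF cons]
  have finR: "finite R" using RG finite_sub_G by blast
  have g0: "i \<in> R \<Longrightarrow> 0 \<le> g i" for i using cons unfolding consistent_def by blast
  have "(\<Sum>i\<in>R. g i * (1 - risk (R - {i}) c i)) \<le> (\<Sum>i\<in>R. if i \<in> survivors R c then g i else 0)"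
  proof (rule sum_mono)
    fix i assume i: "i \<in> R"
    have "0 \<le> risk (R - {i}) c i" using RG c_le_D[OF cons] by (intro risk_nonneg) auto
    then have "g i * (1 - risk (R - {i}) c i) \<le> g i" using g0[OF i] by (simp add: mult_left_le)
    moreover have "g i * (1 - risk (R - {i}) c i) \<le> 0" if "i \<notin> survivors R c"
      using that i g0[OF i] by (auto simp: survivors_def mult_nonneg_nonpos)
    ultimately show "g i * (1 - risk (R - {i}) c i) \<le> (if i \<in> survivors R c then g i else 0)" by simp
  qed
  also have "\<dots> = (\<Sum>i\<in>survivors R c. g i)"
    using finR by (intro sum.mono_neutral_cong_right) (auto simp: survivors_def)
  also have "\<dots> \<le> f (survivors R c) - f {}"
    using cons unfolding consistent_def survivors_def by auto
  finally show ?thesis .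
qed

lemma horizon_le_D: "horizon \<le> D"
proof -
  have "0 \<le> ln (real M)" by (cases "M = 0") (auto simp del: of_nat_add of_nat_mult)
  then have "0 \<le> ln (real M) / \<epsilon>" using eps_pos by simp
  moreover have "(D - 1) * (1 - \<epsilon>) \<le> (D - 1) * 1" using D_ge_1 eps_pos by (intro mult_left_mono) auto
  ultimately show ?thesis unfolding horizon_def by simp
qed

text \<open>The income part is nonpositive for either reason to stop. After a row has filled up, the
  clock has passed \<open>horizon\<close>. If no candidate gains, \<open>candidate_gains_ge\<close>
  shows that the debt has reached the optimum, and \<open>horizon \<le> D\<close> does the
  rest.\<close>

theorem potential_stop:
  assumes cons: "consistent R c w g"
    and stop: "(\<exists>r<M. D - 1 < c r) \<or> (\<forall>a\<in>candidates R c. gain R c a \<le> 0)"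
  shows "potential R c w g \<le> (1 + p * D / \<delta>) * (f (survivors R c) - f {})"
proof -
  let ?F = "(1 - \<delta>) * (f A - f {})"
  note RG = R_sub[OF cons] and cD = c_le_D[OF cons]
  have left: "0 \<le> D - clock w" using clock_le_D[OF cons] by simp
  have F0: "0 \<le> ?F" using mono_on_G[of "{}" A] A_sub del_le_1 by simp
  have d0: "0 \<le> debt R c" by (rule debt_nonneg[OF RG cD])
  have neg: "?F * (horizon - clock w) - debt R c * (D - clock w) \<le> 0"
    using stop
  proof
    assume "\<exists>r<M. D - 1 < c r"
    then have "horizon - clock w \<le> 0" using horizon_le_clock[OF cons] by auto
    then have "?F * (horizon - clock w) \<le> 0" using F0 by (rule mult_nonneg_nonpos[rotated])
    moreover have "0 \<le> debt R c * (D - clock w)" using d0 left by simp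
    ultimately show ?thesis by linarith
  next
    assume *: "\<forall>a\<in>candidates R c. gain R c a \<le> 0"
    have "(\<Sum>e\<in>A \<inter> candidates R c. gain R c e) \<le> 0" using * by (intro sum_nonpos) auto
    then have "?F \<le> debt R c" using candidate_gains_ge[OF RG cD] by linarith
    then have "?F * (D - clock w) \<le> debt R c * (D - clock w)" using left by (rule mult_right_mono)
    moreover have "?F * (horizon - clock w) \<le> ?F * (D - clock w)" using horizon_le_D F0 by (intro mult_left_mono) auto
    ultimately show ?thesis by linarith
  qed
  have "(1 + p * D / \<delta>) * (\<Sum>i\<in>R. g i * (1 - risk (R - {i}) c i))
      \<le> (1 + p * D / \<delta>) * (f (survivors R c) - f {})"
    using survivors_value[OF cons] p_pos D_ge_1 del_pos by (intro mult_left_mono) auto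
  moreover have "p * (?F * (horizon - clock w) - debt R c * (D - clock w)) \<le> 0"
    using neg p_pos by (simp add: mult_nonneg_nonpos)
  ultimately show ?thesis unfolding potential_def by linarith
qed

lemma consistent_init: "consistent {} (\<lambda>_. 0) (\<lambda>_. 1) g"
  unfolding consistent_def using D_ge_1 by auto

text \<open>For the empty sample and zero loads every constraint has the same risk
  \<open>p * D + 9 * (p * D)\<^sup>2\<close>, and an item touches at most \<open>k\<close> of
  them.\<close>

lemma potential_init:
  assumes card: "\<And>a. a \<in> G \<Longrightarrow> real (card (touched a)) \<le> k"
  shows "p * (f A - f {}) * ((1 - \<delta>) * horizon - D * (k * (p * D + 9 * (p * D)\<^sup>2)))
    \<le> potential {} (\<lambda>_. 0) (\<lambda>_. 1) g"
proof -
  let ?h = "chain_marginal f {} A" and ?q = "p * D + 9 * (p * D)\<^sup>2"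
  have q0: "0 \<le> ?q" using p_pos D_ge_1 by simp
  have K: "risk {} (\<lambda>_. 0) a \<le> k * ?q" if "a \<in> G" for a
    unfolding risk_def row_risk_def using card[OF that] q0 by (simp add: mult_right_mono)
  have "(\<Sum>e\<in>A. ?h e * risk {} (\<lambda>_. 0) e) \<le> (\<Sum>e\<in>A. ?h e * (k * ?q))"
    using K A_sub chain_marginal_nonneg by (intro sum_mono mult_left_mono) auto
  also have "\<dots> = (f A - f {}) * (k * ?q)"
    using sum_chain_marginal[of A n f "{}"] A_sub G_sub by (simp add: sum_distrib_right[symmetric])
  finally have "debt {} (\<lambda>_. 0) \<le> (f A - f {}) * (k * ?q)" unfolding debt_def by simp
  then have "debt {} (\<lambda>_. 0) * D \<le> (f A - f {}) * (k * ?q) * D" using D_ge_1 by (intro mult_right_mono) auto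
  moreover have "clock (\<lambda>_. 1) = 0" unfolding clock_def by (cases "M = 0") auto
  ultimately have "p * ((f A - f {}) * ((1 - \<delta>) * horizon - D * (k * ?q)))
      \<le> p * ((1 - \<delta>) * (f A - f {}) * (horizon - clock (\<lambda>_. 1)) - debt {} (\<lambda>_. 0) * (D - clock (\<lambda>_. 1)))"
    using p_pos by (intro mult_left_mono) (auto simp: algebra_simps)
  then show ?thesis unfolding potential_def by (simp add: algebra_simps)
qed

text \<open>Conflicts are counted in all of \<open>R\<close>, so survivors are safe whatever else is
  discarded. A survivor of positive size sees no big item among the others, so an overload consists
  of small items only, a lone item being of size at most 1. Then \<open>overflow_pairs\<close>
  yields a survivor whose fellow items have pair products of at least 1/9, so that its risk is at
  least 1.\<close>

theorem survivors_load_le_1: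
  assumes RG: "R \<subseteq> G" and c: "\<forall>r<M. c r \<le> D" and j: "j < m"
    and size: "\<And>a. a \<in> G \<Longrightarrow> C a j = 1 \<and> C a (m + j) = 0 \<and> 0 < u a \<and> u a \<le> 1
      \<or> C a j = 0 \<and> C a (m + j) = u a \<and> 0 \<le> u a \<and> u a \<le> 1 / 2"
  shows "(\<Sum>i\<in>survivors R c. u i) \<le> 1"
proof (rule ccontr)
  assume "\<not> ?thesis"
  then have over: "1 < (\<Sum>i\<in>survivors R c. u i)" by simp
  \<comment> \<open>Items of size 0 do not touch constraint \<open>j\<close>, so their survival says
    nothing about it; they carry no load either.\<close>
  let ?T = "{i \<in> survivors R c. 0 < u i}"
  have TR: "?T \<subseteq> R" by (auto simp: survivors_def)
  have finR: "finite R" using RG finite_sub_G by blast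
  have finS: "finite (survivors R c)" using finR by (simp add: survivors_def)
  have finT: "finite ?T" using finS by simp
  have u0: "i \<in> R \<Longrightarrow> 0 \<le> u i" for i using size[of i] RG by force
  have "(\<Sum>i\<in>survivors R c. u i) = (\<Sum>i\<in>?T. u i)"
    using finS u0 by (intro sum.mono_neutral_right) (auto simp: survivors_def order.order_iff_strict)
  with over have overT: "1 < (\<Sum>i\<in>?T. u i)" by simp
  have low: "(\<Sum>i'\<in>R - {i}. C i' j)
      + 9 * ((\<Sum>i'\<in>R - {i}. C i' (m + j))\<^sup>2 - (\<Sum>i'\<in>R - {i}. (C i' (m + j))\<^sup>2)) < 1" if i: "i \<in> ?T" for i
  proof -
    have iG: "i \<in> G" using i TR RG by auto
    have tj: "j \<in> touched i" using size[OF iG] i j by (auto simp: touched_def)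
    have sub: "R - {i} \<subseteq> G" using RG by auto
    have "risk (R - {i}) c i < 1" using i by (simp add: survivors_def)
    then show ?thesis using row_risk_le_risk[OF sub tj c] row_risk_ge[OF sub j c] by linarith
  qed
  have pairs0: "0 \<le> (\<Sum>i'\<in>R - {i}. C i' (m + j))\<^sup>2 - (\<Sum>i'\<in>R - {i}. (C i' (m + j))\<^sup>2)" for i
    using sum_squares_le_square_sum[of "R - {i}" "\<lambda>i'. C i' (m + j)"] finR RG C_nonneg by auto
  have no_big: "C x j = 0" if x: "x \<in> R" and i: "i \<in> ?T" "i \<noteq> x" for x i
  proof (rule ccontr)
    assume "C x j \<noteq> 0"
    then have "1 \<le> C x j" using size[of x] x RG by auto
    also have "C x j \<le> (\<Sum>i'\<in>R - {i}. C i' j)"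
      using x i finR RG C_nonneg by (intro member_le_sum) auto
    finally show False using low[OF i(1)] pairs0[of i] by simp
  qed
  have small: "C x j = 0" if x: "x \<in> ?T" for x
  proof (cases "?T = {x}")
    case True
    then have "(\<Sum>i\<in>?T. u i) = u x" by (metis sum.empty sum.insert finite.emptyI empty_iff add_0_right)
    moreover have "u x \<le> 1" using size[OF subsetD[OF RG subsetD[OF TR x]]] by auto
    ultimately show ?thesis using overT by simp
  next
    case False
    then obtain i where "i \<in> ?T" "i \<noteq> x" using x by blast
    then show ?thesis using no_big x TR by blast
  qed
  have u: "C x (m + j) = u x" "u x \<le> 1 / 2" if "x \<in> ?T" for x
    using small[OF that] size[OF subsetD[OF RG subsetD[OF TR that]]] by auto
  obtain i where i: "i \<in> ?T" and big: "1 / 9 \<le> (\<Sum>i'\<in>?T - {i}. u i')\<^sup>2 - (\<Sum>i'\<in>?T - {i}. (u i')\<^sup>2)"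
    using overflow_pairs[OF finT _ overT] u by blast
  have "(\<Sum>i'\<in>?T - {i}. u i') = (\<Sum>i'\<in>?T - {i}. C i' (m + j))"
    "(\<Sum>i'\<in>?T - {i}. (u i')\<^sup>2) = (\<Sum>i'\<in>?T - {i}. (C i' (m + j))\<^sup>2)"
    using u by (auto intro!: sum.cong)
  then have "1 / 9 \<le> (\<Sum>i'\<in>R - {i}. C i' (m + j))\<^sup>2 - (\<Sum>i'\<in>R - {i}. (C i' (m + j))\<^sup>2)"
    using big pair_sum_mono[of "R - {i}" "?T - {i}" "\<lambda>i'. C i' (m + j)"] finR TR RG C_nonneg
    by (smt (verit, best) Diff_iff Diff_mono finite_Diff order_refl subsetD)
  moreover have "0 \<le> (\<Sum>i'\<in>R - {i}. C i' j)" using RG C_nonneg by (auto intro!: sum_nonneg)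
  ultimately show False using low[OF i] by simp
qed

end


section \<open>A calculus for expected values of randomized programs\<close>

text \<open>\<open>run\<close> appends steps at the end of a distribution; \<open>prun\<close> peels
  off the first step, which follows the structure of the program.\<close>

primrec prun :: "nat \<Rightarrow> (nat set \<Rightarrow> real) \<Rightarrow> nat \<Rightarrow> com \<Rightarrow> state \<Rightarrow> (com \<times> state) pmf" where
  "prun n f 0 C s = return_pmf (C, s)"
| "prun n f (Suc t) C s = bind_pmf (step n f C s) (\<lambda>(C', s'). prun n f t C' s')"

lemma run_eq_prun: "run P n m S c f t = prun n f t P (init_state n m S c)"
proof -
  have "((\<lambda>D. bind_pmf D (\<lambda>(C, s). step n f C s)) ^^ t) D = bind_pmf D (\<lambda>(C, s). prun n f t C s)" for D
  proof (induction t arbitrary: D)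
    case 0
    show ?case by (simp add: case_prod_unfold bind_return_pmf')
  next
    case (Suc t)
    show ?case
      unfolding funpow_Suc_right o_def Suc by (simp add: bind_assoc_pmf case_prod_unfold)
  qed
  then show ?thesis by (simp add: run_def bind_return_pmf)
qed

lemma prun_Skip: "prun n f t Skip s = return_pmf (Skip, s)"
  by (induction t) (simp_all add: bind_return_pmf)

lemma prun_add: "prun n f (t + t') C s = bind_pmf (prun n f t C s) (\<lambda>(C', s'). prun n f t' C' s')"
  by (induction t arbitrary: C s) (simp_all add: bind_return_pmf bind_assoc_pmf case_prod_unfold)

text \<open>On every branch the program has halted after \<open>t\<close> steps, and
  \<open>D\<close> is the law of the final memory. As \<open>Skip\<close> idles, \<open>t\<close> is
  only an upper bound.\<close>

definition exec :: "nat \<Rightarrow> (nat set \<Rightarrow> real) \<Rightarrow> com \<Rightarrow> state \<Rightarrow> nat \<Rightarrow> state pmf \<Rightarrow> bool" where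
  "exec n f C s t D \<longleftrightarrow> prun n f t C s = map_pmf (Pair Skip) D"

lemma exec_mono:
  assumes "exec n f C s t D" "t \<le> t'"
  shows "exec n f C s t' D"
proof -
  obtain d where d: "t' = t + d" using assms(2) le_Suc_ex by blast
  show ?thesis
    using assms(1) unfolding exec_def d prun_add
    by (simp add: bind_map_pmf prun_Skip) (simp add: map_pmf_def)
qed

lemma exec_step:
  assumes "step n f C s = return_pmf (C', s')" "exec n f C' s' t D"
  shows "exec n f C s (Suc t) D"
  using assms by (simp add: exec_def bind_return_pmf)

lemma exec_Skip: "exec n f Skip s t (return_pmf s)"
  by (simp add: exec_def prun_Skip)

text \<open>Induction on the time of the first command, conditioning on its first random step. The
  additional unit of time is the step from \<open>Seq Skip C'\<close> to \<open>C'\<close>.\<close>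

lemma exec_Seq:
  assumes "exec n f C s t D" "\<And>s'. s' \<in> set_pmf D \<Longrightarrow> exec n f C' s' t' (E s')"
  shows "exec n f (Seq C C') s (Suc (t + t')) (bind_pmf D E)"
  using assms
proof (induction t arbitrary: C s D)
  case 0
  then have eq: "map_pmf (Pair Skip) D = return_pmf (C, s)" by (simp add: exec_def)
  then have "set_pmf (map_pmf (Pair Skip) D) = {(C, s)}" by simp
  then have img: "Pair Skip ` set_pmf D = {(C, s)}" by simp
  then have C: "C = Skip" by (metis imageE insertI1 prod.inject)
  have "Pair Skip ` set_pmf D = Pair Skip ` {s}" using img C by simp
  then have D: "set_pmf D = {s}" by (subst (asm) inj_image_eq_iff) (auto simp: inj_def)
  then have "D = return_pmf s" by (subst set_pmf_subset_singleton[symmetric]) simp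
  moreover have "exec n f C' s t' (E s)" using 0(2)[of s] D by simp
  ultimately show ?case using C unfolding exec_def by (simp add: bind_return_pmf)
next
  case (Suc t)
  show ?case
  proof (cases "C = Skip")
    case True
    then have eq: "map_pmf (Pair Skip) D = return_pmf (Skip, s)"
      using Suc.prems(1) by (simp add: exec_def prun_Skip bind_return_pmf)
    then have "set_pmf (map_pmf (Pair Skip) D) = {(Skip, s)}" by simp
    then have "Pair Skip ` set_pmf D = Pair Skip ` {s}" by simp
    then have D: "set_pmf D = {s}" by (subst (asm) inj_image_eq_iff) (auto simp: inj_def)
    then have "D = return_pmf s" by (subst set_pmf_subset_singleton[symmetric]) simp
    moreover have "exec n f C' s (Suc t + t') (E s)" using Suc.prems(2)[of s] D
      by (auto elim!: exec_mono)
    ultimately show ?thesis unfolding True exec_def by (simp add: bind_return_pmf)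
  next
    case False
    define X where "X = step n f C s"
    \<comment> \<open>The law of the final memory given the configuration after one step; mixing
      these laws over \<open>X\<close> recovers \<open>D\<close>.\<close>
    define H where "H x = map_pmf snd (prun n f t (fst x) (snd x))" for x
    have eq: "bind_pmf X (\<lambda>x. prun n f t (fst x) (snd x)) = map_pmf (Pair Skip) D"
      using Suc.prems(1) by (simp add: exec_def X_def case_prod_unfold)
    have H: "exec n f (fst x) (snd x) t (H x)" if x: "x \<in> set_pmf X" for x
    proof -
      have "set_pmf (prun n f t (fst x) (snd x)) \<subseteq> set_pmf (map_pmf (Pair Skip) D)"
        unfolding eq[symmetric] using x by auto
      then have "fst y = Skip" if "y \<in> set_pmf (prun n f t (fst x) (snd x))" for y
        using that by auto
      then have "map_pmf (\<lambda>y. (Skip, snd y)) (prun n f t (fst x) (snd x)) = map_pmf id (prun n f t (fst x) (snd x))"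
        by (intro pmf.map_cong) (auto simp: prod_eq_iff)
      then show ?thesis unfolding exec_def H_def by (simp add: pmf.map_comp o_def)
    qed
    have D_eq: "D = bind_pmf X H"
    proof -
      have "D = map_pmf snd (map_pmf (Pair Skip) D)" by (simp add: pmf.map_comp o_def)
      also have "\<dots> = bind_pmf X H" unfolding eq[symmetric] H_def by (simp add: map_bind_pmf)
      finally show ?thesis .
    qed
    have IH: "exec n f (Seq (fst x) C') (snd x) (Suc (t + t')) (bind_pmf (H x) E)" if x: "x \<in> set_pmf X" for x
      by (rule Suc.IH[OF H[OF x]]) (rule Suc.prems(2), use x D_eq in auto)
    have "prun n f (Suc (Suc t + t')) (Seq C C') s
        = bind_pmf X (\<lambda>x. prun n f (Suc (t + t')) (Seq (fst x) C') (snd x))"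
      using False by (simp add: X_def bind_map_pmf case_prod_unfold)
    also have "\<dots> = bind_pmf X (\<lambda>x. map_pmf (Pair Skip) (bind_pmf (H x) E))"
      using IH by (intro bind_pmf_cong refl) (simp only: exec_def)
    also have "\<dots> = map_pmf (Pair Skip) (bind_pmf D E)"
      unfolding D_eq by (simp add: map_bind_pmf bind_assoc_pmf)
    finally show ?thesis unfolding exec_def .
  qed
qed

lemma exec_While:
  assumes "exec n f (if bval b s then Seq C (While b C) else Skip) s t D"
  shows "exec n f (While b C) s (Suc t) D"
  using assms by (intro exec_step) auto

section \<open>Deterministic program fragments\<close>

definition runs_to :: "nat \<Rightarrow> (nat set \<Rightarrow> real) \<Rightarrow> com \<Rightarrow> state \<Rightarrow> nat \<Rightarrow> (state \<Rightarrow> bool) \<Rightarrow> bool" where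
  "runs_to n f C s t Q \<longleftrightarrow> (\<exists>s'. exec n f C s t (return_pmf s') \<and> Q s')"

lemma runs_to_weaken: "runs_to n f C s t Q \<Longrightarrow> t \<le> t' \<Longrightarrow> (\<And>s'. Q s' \<Longrightarrow> Q' s') \<Longrightarrow> runs_to n f C s t' Q'"
  unfolding runs_to_def using exec_mono by blast

lemma runs_to_le: "runs_to n f C s t Q \<Longrightarrow> t \<le> t' \<Longrightarrow> runs_to n f C s t' Q"
  by (rule runs_to_weaken)

lemma runs_to_Skip: "Q s \<Longrightarrow> runs_to n f Skip s 0 Q"
  unfolding runs_to_def using exec_Skip by blast

lemma runs_to_NSet:
  "Q ((fst s)((a, nval x s, nval y s) := nval v s), snd s) \<Longrightarrow> runs_to n f (NSet a x y v) s 1 Q"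
  unfolding runs_to_def One_nat_def by (rule exI, rule conjI, rule exec_step[OF _ exec_Skip]) auto

lemma runs_to_RSet:
  "Q (fst s, (snd s)((a, nval x s, nval y s) := rval v s)) \<Longrightarrow> runs_to n f (RSet a x y v) s 1 Q"
  unfolding runs_to_def One_nat_def by (rule exI, rule conjI, rule exec_step[OF _ exec_Skip]) auto

lemma runs_to_Query:
  "Q (fst s, (snd s)((b, nval y s, nval z s) := f (row_set n a (nval x s) s))) \<Longrightarrow>
    runs_to n f (Query a x b y z) s 1 Q"
  unfolding runs_to_def One_nat_def by (rule exI, rule conjI, rule exec_step[OF _ exec_Skip]) auto

lemma runs_to_Seq:
  assumes "runs_to n f C s t (\<lambda>s'. runs_to n f C' s' t' Q)"
  shows "runs_to n f (Seq C C') s (Suc (t + t')) Q"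
proof -
  obtain s' s'' where "exec n f C s t (return_pmf s')" "exec n f C' s' t' (return_pmf s'')" "Q s''"
    using assms unfolding runs_to_def by blast
  then show ?thesis unfolding runs_to_def
    using exec_Seq[of n f C s t "return_pmf s'" C' t' "\<lambda>_. return_pmf s''"]
    by (intro exI[of _ s'']) (simp add: bind_return_pmf)
qed

lemma runs_to_Cond:
  assumes "bval b s \<Longrightarrow> runs_to n f C s t Q" "\<not> bval b s \<Longrightarrow> runs_to n f C' s t' Q"
  shows "runs_to n f (Cond b C C') s (Suc (max t t')) Q"
proof (cases "bval b s")
  case True
  with assms obtain s' where s': "exec n f C s t (return_pmf s')" "Q s'" unfolding runs_to_def by blast
  have "exec n f C s (max t t') (return_pmf s')" using s' by (auto intro: exec_mono)
  with True s' show ?thesis unfolding runs_to_def by (intro exI[of _ s'] conjI exec_step[of _ _ _ _ C s]) auto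
next
  case False
  with assms obtain s' where s': "exec n f C' s t' (return_pmf s')" "Q s'" unfolding runs_to_def by blast
  have "exec n f C' s (max t t') (return_pmf s')" using s' by (auto intro: exec_mono)
  with False s' show ?thesis unfolding runs_to_def by (intro exI[of _ s'] conjI exec_step[of _ _ _ _ C' s]) auto
qed

text \<open>The rule unrolls one iteration only; the rest of the loop sits in the postcondition, so
  invariants and variants are supplied by an induction outside. The two extra steps are the test and
  the discarding of the finished body.\<close>

lemma runs_to_While:
  assumes "bval b s \<Longrightarrow> runs_to n f C s t (\<lambda>s'. runs_to n f (While b C) s' t' Q)" "\<not> bval b s \<Longrightarrow> Q s"
  shows "runs_to n f (While b C) s (t + t' + 2) Q"
proof (cases "bval b s")
  case True
  then have "runs_to n f (Seq C (While b C)) s (Suc (t + t')) Q" using assms by (intro runs_to_Seq)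
  then show ?thesis unfolding runs_to_def using True exec_While[of n f b s C "Suc (t + t')"] by auto
next
  case False
  then have "exec n f (While b C) s (Suc 0) (return_pmf s)"
    by (intro exec_While) (simp add: exec_Skip)
  then show ?thesis unfolding runs_to_def using False assms exec_mono by fastforce
qed

definition nvar :: "nat \<Rightarrow> nexp" where "nvar x = NGet x (NConst 0) (NConst 0)"
definition rvar :: "nat \<Rightarrow> rexp" where "rvar x = RGet x (NConst 0) (NConst 0)"
definition nassign :: "nat \<Rightarrow> nexp \<Rightarrow> com" where "nassign x e = NSet x (NConst 0) (NConst 0) e"
definition rassign :: "nat \<Rightarrow> rexp \<Rightarrow> com" where "rassign x e = RSet x (NConst 0) (NConst 0) e"

definition for_loop :: "nat \<Rightarrow> nexp \<Rightarrow> com \<Rightarrow> com" where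
  "for_loop x e B = Seq (nassign x (NConst 0))
     (While (NLess (nvar x) e) (Seq B (nassign x (NAdd (nvar x) (NConst 1)))))"

definition set_nvar :: "nat \<Rightarrow> nat \<Rightarrow> state \<Rightarrow> state" where
  "set_nvar x v s = ((fst s)((x, 0, 0) := v), snd s)"

definition set_rvar :: "nat \<Rightarrow> real \<Rightarrow> state \<Rightarrow> state" where
  "set_rvar x v s = (fst s, (snd s)((x, 0, 0) := v))"

lemma nval_nvar [simp]: "nval (nvar x) s = fst s (x, 0, 0)" by (simp add: nvar_def)
lemma rval_rvar [simp]: "rval (rvar x) s = snd s (x, 0, 0)" by (simp add: rvar_def)

lemma runs_to_nassign: "Q (set_nvar x (nval v s) s) \<Longrightarrow> runs_to n f (nassign x v) s 1 Q"
  unfolding nassign_def set_nvar_def by (rule runs_to_NSet) simp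

lemma runs_to_rassign: "Q (set_rvar x (rval v s) s) \<Longrightarrow> runs_to n f (rassign x v) s 1 Q"
  unfolding rassign_def set_rvar_def by (rule runs_to_RSet) simp

lemma fst_set_nvar [simp]: "fst (set_nvar x v s) = (fst s)((x, 0, 0) := v)"
  and snd_set_nvar [simp]: "snd (set_nvar x v s) = snd s"
  and fst_set_rvar [simp]: "fst (set_rvar x u s) = fst s"
  and snd_set_rvar [simp]: "snd (set_rvar x u s) = (snd s)((x, 0, 0) := u)"
  by (simp_all add: set_nvar_def set_rvar_def)

text \<open>The invariant after the body is stated for the state with the counter already
  incremented, so the increment never has to be treated in applications. An iteration costs 4 steps
  besides the body.\<close>

lemma runs_to_for_loop:
  assumes init: "I 0 (set_nvar x 0 s)"
    and bound: "\<And>i s. I i s \<Longrightarrow> nval e s = N"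
    and body: "\<And>i s. i < N \<Longrightarrow> I i s \<Longrightarrow> fst s (x, 0, 0) = i \<Longrightarrow>
      runs_to n f B s t (\<lambda>s'. fst s' (x, 0, 0) = i \<and> I (Suc i) (set_nvar x (Suc i) s'))"
  shows "runs_to n f (for_loop x e B) s (N * (t + 4) + 4) (I N)"
proof -
  let ?W = "While (NLess (nvar x) e) (Seq B (nassign x (NAdd (nvar x) (NConst 1))))"
  have loop: "runs_to n f ?W s (d * (t + 4) + 2) (I N)" if "I i s" "fst s (x, 0, 0) = i" "i + d = N" for d i s
    using that
  proof (induction d arbitrary: i s)
    case 0
    then have "\<not> bval (NLess (nvar x) e) s" "I N s" using bound[OF 0(1)] by auto
    then have "runs_to n f ?W s (0 + 0 + 2) (I N)" by (intro runs_to_While) auto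
    then show ?case by simp
  next
    case (Suc d)
    have "runs_to n f ?W s (Suc (t + 1) + (d * (t + 4) + 2) + 2) (I N)"
    proof (rule runs_to_While)
      show "runs_to n f (Seq B (nassign x (NAdd (nvar x) (NConst 1)))) s (Suc (t + 1))
          (\<lambda>s'. runs_to n f ?W s' (d * (t + 4) + 2) (I N))"
        apply (rule runs_to_Seq)
        apply (rule runs_to_weaken[OF body[OF _ Suc.prems(1,2)] order_refl])
        subgoal using Suc.prems(3) by simp
        subgoal for s'
          apply (rule runs_to_nassign)
          apply (rule Suc.IH[of "Suc i"])
          using Suc.prems(3) by auto
        done
      show "I N s" if "\<not> bval (NLess (nvar x) e) s" using that Suc.prems bound[OF Suc.prems(1)] by simp
    qed
    then show ?case by (rule runs_to_le) simp
  qed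
  have "runs_to n f (for_loop x e B) s (Suc (1 + (N * (t + 4) + 2))) (I N)"
    unfolding for_loop_def
    by (rule runs_to_Seq, rule runs_to_nassign, rule loop[of 0]) (use init in auto)
  then show ?thesis by (rule runs_to_le) simp
qed

text \<open>A quantitative Hoare triple: \<open>r\<close> is a pre-expectation for the
  post-expectation \<open>X\<close>, and \<open>Q\<close> is a postcondition valid on every branch.
  Finite support makes every real function integrable.\<close>

definition bounds_expectation ::
  "nat \<Rightarrow> (nat set \<Rightarrow> real) \<Rightarrow> com \<Rightarrow> state \<Rightarrow> nat \<Rightarrow> real \<Rightarrow> (state \<Rightarrow> real) \<Rightarrow> (state \<Rightarrow> bool) \<Rightarrow> bool" where
  "bounds_expectation n f C s t r X Q \<longleftrightarrow> (\<exists>D. exec n f C s t D \<and> finite (set_pmf D) \<and> (\<forall>s'\<in>set_pmf D. Q s')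
     \<and> r \<le> measure_pmf.expectation D X)"

lemma bounds_expectation_runs_to:
  "runs_to n f C s t (\<lambda>s'. Q s' \<and> r \<le> X s') \<Longrightarrow> bounds_expectation n f C s t r X Q"
  unfolding runs_to_def bounds_expectation_def by (elim exE conjE, rule exI, rule conjI, assumption) simp

lemma bounds_expectation_le:
  assumes "bounds_expectation n f C s t r X Q" "t \<le> t'" "r' \<le> r"
  shows "bounds_expectation n f C s t' r' X Q"
  using assms exec_mono unfolding bounds_expectation_def by (meson order_trans)

lemma expectation_bind_ge:
  fixes X :: "'b \<Rightarrow> real"
  assumes "finite (set_pmf D)" "\<And>x. x \<in> set_pmf D \<Longrightarrow> finite (set_pmf (E x))"
    "\<And>x. x \<in> set_pmf D \<Longrightarrow> Y x \<le> measure_pmf.expectation (E x) X"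
  shows "measure_pmf.expectation D Y \<le> measure_pmf.expectation (bind_pmf D E) X"
proof -
  have "measure_pmf.expectation D Y \<le> measure_pmf.expectation D (\<lambda>x. measure_pmf.expectation (E x) X)"
    using assms by (intro integral_mono_AE integrable_measure_pmf_finite) (auto simp: AE_measure_pmf_iff)
  also have "\<dots> = measure_pmf.expectation (bind_pmf D E) X"
    using assms(1,2) pmf_expectation_bind[of "set_pmf D" E D X]
    by (simp add: integral_measure_pmf[where A = "set_pmf D"])
  finally show ?thesis .
qed

text \<open>The tower rule: the post-expectation \<open>Y\<close> of the first command is the
  pre-expectation of the second.\<close>

lemma bounds_expectation_Seq:
  assumes 1: "bounds_expectation n f C s t r Y P"
    and 2: "\<And>s'. P s' \<Longrightarrow> bounds_expectation n f C' s' t' (Y s') X Q"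
  shows "bounds_expectation n f (Seq C C') s (Suc (t + t')) r X Q"
proof -
  obtain D where D: "exec n f C s t D" "finite (set_pmf D)" "\<forall>s'\<in>set_pmf D. P s'"
    "r \<le> measure_pmf.expectation D Y" using 1 unfolding bounds_expectation_def by blast
  obtain E where E: "\<And>s'. P s' \<Longrightarrow> exec n f C' s' t' (E s') \<and> finite (set_pmf (E s')) \<and> (\<forall>s''\<in>set_pmf (E s'). Q s'')
     \<and> Y s' \<le> measure_pmf.expectation (E s') X" using 2 unfolding bounds_expectation_def by metis
  have "exec n f (Seq C C') s (Suc (t + t')) (bind_pmf D E)" using D E by (intro exec_Seq) auto
  moreover have "measure_pmf.expectation D Y \<le> measure_pmf.expectation (bind_pmf D E) X"
    using D E by (intro expectation_bind_ge) auto
  ultimately show ?thesis unfolding bounds_expectation_def using D E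
    by (intro exI[of _ "bind_pmf D E"]) auto
qed

lemma bounds_expectation_Cond:
  assumes "bval b s \<Longrightarrow> bounds_expectation n f C s t r X Q"
    and "\<not> bval b s \<Longrightarrow> bounds_expectation n f C' s t r X Q"
  shows "bounds_expectation n f (Cond b C C') s (Suc t) r X Q"
proof -
  have "bounds_expectation n f (if bval b s then C else C') s t r X Q" using assms by simp
  then obtain D where D: "exec n f (if bval b s then C else C') s t D" "finite (set_pmf D)" "\<forall>s'\<in>set_pmf D. Q s'"
    "r \<le> measure_pmf.expectation D X" unfolding bounds_expectation_def by blast
  have "exec n f (Cond b C C') s (Suc t) D" using D(1) by (rule exec_step[rotated]) simp
  with D show ?thesis unfolding bounds_expectation_def by blast
qed

lemma bounds_expectation_While:
  assumes "bval b s \<Longrightarrow> bounds_expectation n f (Seq C (While b C)) s t r X Q"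
    and "\<not> bval b s \<Longrightarrow> Q s \<and> r \<le> X s"
  shows "bounds_expectation n f (While b C) s (Suc t) r X Q"
proof -
  have "bounds_expectation n f Skip s t r X Q" if "\<not> bval b s"
    using assms(2)[OF that] by (intro bounds_expectation_le[OF bounds_expectation_runs_to[OF runs_to_Skip]]) auto
  then have "bounds_expectation n f (if bval b s then Seq C (While b C) else Skip) s t r X Q" using assms(1) by simp
  then show ?thesis unfolding bounds_expectation_def using exec_While by blast
qed

lemma bounds_expectation_Flip:
  assumes "\<And>b. b \<in> {0, 1} \<Longrightarrow> Q ((fst s)((a, nval x s, nval y s) := b), snd s)"
    and "2 * r \<le> X ((fst s)((a, nval x s, nval y s) := 0), snd s) + X ((fst s)((a, nval x s, nval y s) := 1), snd s)"
  shows "bounds_expectation n f (Flip a x y) s 1 r X Q"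
proof -
  let ?u = "\<lambda>b. ((fst s)((a, nval x s, nval y s) := (if b then 1 else 0)), snd s)"
  let ?D = "map_pmf ?u (bernoulli_pmf (1 / 2))"
  have "exec n f (Flip a x y) s 1 ?D"
    unfolding exec_def by (simp add: bind_map_pmf pmf.map_comp o_def map_pmf_def bind_assoc_pmf bind_return_pmf)
  moreover have "measure_pmf.expectation ?D X = (X (?u True) + X (?u False)) / 2"
    by simp
  moreover have "finite (set_pmf ?D)" by simp
  ultimately show ?thesis unfolding bounds_expectation_def using assms
    by (intro exI[of _ ?D]) auto
qed

lemma runs_to_state: "runs_to n f C s t Q \<Longrightarrow> s' = s \<Longrightarrow> runs_to n f C s' t Q"
  by simp

lemma bounds_expectation_runs_to_Seq:
  assumes "runs_to n f C s t (\<lambda>s'. bounds_expectation n f C' s' t' r X Q)"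
  shows "bounds_expectation n f (Seq C C') s (Suc (t + t')) r X Q"
  by (rule bounds_expectation_Seq[where Y = "\<lambda>_. r"], rule bounds_expectation_runs_to,
      rule runs_to_weaken[OF assms order_refl]) auto


section \<open>The program\<close>

text \<open>Natural arrays: 2 sampled items, 3 items that fit on their own, 4 and 5 loop counters, 6 selected item,
  7 stop flag, 8 the power of two \<open>1 / p\<close>, 9 to 11 coin flipping, 12 sparsity, 13 degree of an item.
  Real arrays: 2 coefficients \<open>C\<close>, 3 weights, 4 row loads \<open>c\<close>, 5 and 6 sums of the coefficients and of
  their squares over the sampled items, 7 risk, 8 and 9 oracle answers, 10 price, 11 best ratio,
  12 current ratio, 13 \<open>D\<close>, 14 \<open>p\<close>.\<close>

abbreviation "e0 \<equiv> NConst 0"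
abbreviation "eN \<equiv> NGet 0 e0 e0"
abbreviation "eM \<equiv> NGet 0 e0 (NConst 1)"
abbreviation "eRows \<equiv> NAdd (NAdd eM eM) eN"
abbreviation "vi \<equiv> nvar 4"
abbreviation "vj \<equiv> nvar 5"
abbreviation "vb \<equiv> nvar 6"
abbreviation "rconst v \<equiv> ROfNat (NConst v)"

text \<open>\<open>x\<close> is the membership bit of the item, so subtracting \<open>x\<close>
  times its coefficient turns sums over \<open>R\<close> into sums over \<open>R - {i}\<close>. One
  program thus serves the selection, where the item is outside \<open>R\<close>, and the survival
  test.\<close>

definition risk_step_prog :: com where
  "risk_step_prog =
     (let small = NAdd eM vj; q = RGet 2 vi small; x = ROfNat (NGet 2 e0 vi);
          load = RAdd (RSub (RGet 5 e0 small) (RMul x q)) (RMul (rvar 14) (RSub (rvar 13) (RGet 4 e0 small)))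
      in Cond (RLess (rconst 0) (RAdd (RGet 2 vi vj) q))
        (rassign 7 (RAdd (rvar 7)
          (RAdd (RAdd (RSub (RGet 5 e0 vj) (RMul x (RGet 2 vi vj)))
                      (RMul (rvar 14) (RSub (rvar 13) (RGet 4 e0 vj))))
                (RMul (rconst 9) (RSub (RMul load load) (RSub (RGet 6 e0 small) (RMul x (RMul q q))))))))
        Skip)"

definition risk_prog :: com where
  "risk_prog = Seq (rassign 7 (rconst 0)) (for_loop 5 eM risk_step_prog)"

definition price_prog :: com where
  "price_prog = Seq (rassign 10 (rconst 0))
     (for_loop 5 eRows (rassign 10 (RAdd (rvar 10) (RMul (RGet 2 vi vj) (RGet 3 e0 vj)))))"

definition evaluate_prog :: com where
  "evaluate_prog =
     Seq (Query 2 e0 8 e0 e0) (Seq (NSet 2 e0 vi (NConst 1)) (Seq (Query 2 e0 9 e0 e0)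
       (Seq (NSet 2 e0 vi e0) (Seq price_prog
         (Seq (rassign 12 (RDiv (RMul (RSub (rvar 9) (rvar 8)) (RSub (rconst 1) (rvar 7))) (rvar 10)))
           (Cond (RLess (rvar 11) (rvar 12)) (Seq (rassign 11 (rvar 12)) (nassign 6 vi)) Skip))))))"

text \<open>The best ratio starts at 0 and remains 0 only if no candidate has positive gain, which
  is the second stopping condition.\<close>

definition select_prog :: com where
  "select_prog = Seq (rassign 11 (rconst 0)) (for_loop 4 eN (Seq risk_prog
     (Cond (BAnd (NLess e0 (NGet 3 e0 vi)) (BAnd (NLess (NGet 2 e0 vi) (NConst 1))
         (BNot (RLess (RSub (rconst 1) (RDiv (rconst 1) (rconst 200))) (rvar 7)))))
       evaluate_prog Skip)))"

text \<open>One fair coin per doubling of the counter from 1 up to \<open>1 / p\<close>; the result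
  stays 1 only if no coin shows 0.\<close>

definition flip_loop :: com where
  "flip_loop = While (NLess (nvar 9) (nvar 8))
     (Seq (Flip 11 e0 e0) (Seq (Cond (NLess (nvar 11) (NConst 1)) (nassign 10 e0) Skip)
       (nassign 9 (NAdd (nvar 9) (nvar 9)))))"

definition flip_prog :: com where
  "flip_prog = Seq (nassign 9 (NConst 1)) (Seq (nassign 10 (NConst 1)) flip_loop)"

text \<open>Loads and weights advance for every pick; only the sums over the sample are multiplied
  by the coin \<open>x\<close>. The flag is raised as soon as a further pick might exceed
  \<open>D\<close>.\<close>

definition update_row_prog :: com where
  "update_row_prog =
     (let q = RGet 2 vb vj; x = ROfNat (nvar 10) in
      Seq (RSet 4 e0 vj (RAdd (RGet 4 e0 vj) q))
     (Seq (RSet 3 e0 vj (RMul (RGet 3 e0 vj) (RAdd (rconst 1) (RMul (RDiv (rconst 1) (rconst 100)) q))))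
     (Seq (RSet 5 e0 vj (RAdd (RGet 5 e0 vj) (RMul x q)))
     (Seq (RSet 6 e0 vj (RAdd (RGet 6 e0 vj) (RMul x (RMul q q))))
       (Cond (RLess (RSub (rvar 13) (rconst 1)) (RGet 4 e0 vj)) (nassign 7 (NConst 1)) Skip)))))"

definition update_prog :: com where
  "update_prog = Seq (for_loop 5 eRows update_row_prog) (NSet 2 e0 vb (nvar 10))"

definition round_prog :: com where
  "round_prog = Seq select_prog
     (Cond (RLess (rconst 0) (rvar 11)) (Seq flip_prog update_prog) (nassign 7 (NConst 1)))"

definition main_loop :: com where
  "main_loop = While (NLess (nvar 7) (NConst 1)) round_prog"

definition output_prog :: com where
  "output_prog = for_loop 4 eN (Seq risk_prog
     (Cond (BAnd (NLess e0 (NGet 2 e0 vi)) (RLess (rvar 7) (rconst 1))) (NSet 1 e0 vi (NConst 1)) (NSet 1 e0 vi e0)))"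


section \<open>Frame conditions and the memory representation of a run\<close>

definition same_except :: "nat set \<Rightarrow> nat set \<Rightarrow> state \<Rightarrow> state \<Rightarrow> bool" where
  "same_except X Y s s' \<longleftrightarrow> (\<forall>a i j. a \<notin> X \<longrightarrow> fst s' (a, i, j) = fst s (a, i, j))
     \<and> (\<forall>a i j. a \<notin> Y \<longrightarrow> snd s' (a, i, j) = snd s (a, i, j))"

lemma same_except_refl: "same_except X Y s s" by (simp add: same_except_def)

lemma same_except_trans:
  assumes "same_except X Y s s'" "same_except X' Y' s' s''" "X \<union> X' \<subseteq> X''" "Y \<union> Y' \<subseteq> Y''"
  shows "same_except X'' Y'' s s''"
proof -
  have "a \<notin> X \<and> a \<notin> X'" if "a \<notin> X''" for a using that assms(3) by blast
  moreover have "a \<notin> Y \<and> a \<notin> Y'" if "a \<notin> Y''" for a using that assms(4) by blast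
  ultimately show ?thesis using assms(1,2) unfolding same_except_def by simp
qed

lemma same_exceptD:
  "same_except X Y s s' \<Longrightarrow> a \<notin> X \<Longrightarrow> fst s' (a, i, j) = fst s (a, i, j)"
  "same_except X Y s s' \<Longrightarrow> a \<notin> Y \<Longrightarrow> snd s' (a, i, j) = snd s (a, i, j)"
  unfolding same_except_def by auto

text \<open>Here \<open>\<epsilon> = 1 / 100\<close> and \<open>\<delta> = 1 / 200\<close>, which
  together cost about 1.5 percent of the value. A power of two as \<open>1 / p\<close> makes
  \<open>p\<close> exactly realizable with fair coins.\<close>

locale packing_program = sampled_packing n m C G A f p D "1 / 100" "1 / 200"
  for n m C G A f p D +
  fixes L :: nat
  assumes p_eq: "p = 1 / 2 ^ L"
begin

definition rep :: "nat set \<Rightarrow> (nat \<Rightarrow> real) \<Rightarrow> (nat \<Rightarrow> real) \<Rightarrow> state \<Rightarrow> bool" where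
  "rep R c w s \<longleftrightarrow> R \<subseteq> G \<and> fst s (0, 0, 0) = n \<and> fst s (0, 0, 1) = m
     \<and> fst s (8, 0, 0) = 2 ^ L \<and> snd s (13, 0, 0) = D \<and> snd s (14, 0, 0) = p
     \<and> (\<forall>a<n. fst s (2, 0, a) = (if a \<in> R then 1 else 0)
          \<and> fst s (3, 0, a) = (if a \<in> G then 1 else 0) \<and> (\<forall>r<M. snd s (2, a, r) = C a r))
     \<and> (\<forall>r<M. snd s (3, 0, r) = w r \<and> snd s (4, 0, r) = c r
          \<and> snd s (5, 0, r) = (\<Sum>i\<in>R. C i r) \<and> snd s (6, 0, r) = (\<Sum>i\<in>R. (C i r)\<^sup>2))"

lemma repD:
  assumes "rep R c w s"
  shows "R \<subseteq> G" "finite R" "fst s (0, 0, 0) = n" "fst s (0, 0, Suc 0) = m" "fst s (8, 0, 0) = 2 ^ L"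
    "snd s (13, 0, 0) = D" "snd s (14, 0, 0) = p"
    "a < n \<Longrightarrow> fst s (2, 0, a) = (if a \<in> R then 1 else 0)"
    "a < n \<Longrightarrow> fst s (3, 0, a) = (if a \<in> G then 1 else 0)"
    "a < n \<Longrightarrow> r < M \<Longrightarrow> snd s (2, a, r) = C a r"
    "r < M \<Longrightarrow> snd s (3, 0, r) = w r" "r < M \<Longrightarrow> snd s (4, 0, r) = c r"
    "r < M \<Longrightarrow> snd s (5, 0, r) = (\<Sum>i\<in>R. C i r)" "r < M \<Longrightarrow> snd s (6, 0, r) = (\<Sum>i\<in>R. (C i r)\<^sup>2)"
  using assms finite_sub_G unfolding rep_def by auto

lemma rep_cong:
  assumes "rep R c w s" "same_except X Y s s'" "X \<inter> {0, 2, 3, 8} = {}" "Y \<inter> {2, 3, 4, 5, 6, 13, 14} = {}"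
  shows "rep R c w s'"
proof -
  have "x \<notin> X" if "x \<in> {0, 2, 3, 8}" for x using that assms(3) by (meson disjoint_iff)
  moreover have "y \<notin> Y" if "y \<in> {2, 3, 4, 5, 6, 13, 14}" for y using that assms(4) by (meson disjoint_iff)
  ultimately show ?thesis using assms(1) same_exceptD[OF assms(2)] unfolding rep_def by simp
qed

lemma row_set_rep:
  assumes "rep R c w s"
  shows "row_set n 2 0 s = R"
proof -
  have "l < n" if "l \<in> R" for l using that repD(1)[OF assms] G_sub by auto
  then show ?thesis unfolding row_set_def by (auto simp: repD(8)[OF assms] split: if_splits)
qed

lemma risk_prog_spec:
  assumes rep: "rep R c w s" and i: "fst s (4, 0, 0) = a" "a < n"
  shows "runs_to n f risk_prog s (m * 6 + 6) (\<lambda>s'. same_except {5} {7} s s' \<and> snd s' (7, 0, 0) = risk (R - {a}) c a)"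
proof -
  define I where "I j s' \<longleftrightarrow> same_except {5} {7} s s' \<and>
    snd s' (7, 0, 0) = (\<Sum>l<j. if 0 < C a l + C a (m + l) then row_risk (R - {a}) c l else 0)" for j s'
  have fin: "finite R" using repD[OF rep] by blast
  have minus: "(\<Sum>i\<in>R - {a}. h i) = (\<Sum>i\<in>R. h i) - (if a \<in> R then 1 else 0) * h a" for h :: "nat \<Rightarrow> real"
    using fin by (simp add: sum_diff1)
  have body: "runs_to n f risk_step_prog t 2 (\<lambda>s'. fst s' (5, 0, 0) = j \<and> I (Suc j) (set_nvar 5 (Suc j) s'))"
    if j: "j < m" and t: "I j t" "fst t (5, 0, 0) = j" for j t
  proof -
    have "same_except {5} {7} s t" using t(1) by (simp add: I_def)
    then have rt: "rep R c w t" by (rule rep_cong[OF rep]) auto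
    have it: "fst t (4, 0, 0) = a" using same_exceptD[of "{5}" "{7}" s t] t i by (simp add: I_def)
    have jj: "j < M" "m + j < M" using j by auto
    have frame: "same_except {5} {7} s (set_nvar 5 (Suc j) t)"
      "same_except {5} {7} s (set_nvar 5 (Suc j) (set_rvar 7 x t))" for x
      using t(1) by (auto simp: I_def same_except_def)
    note cells = t(2) it repD(3,4,6,7)[OF rt] repD(8,9)[OF rt i(2)] repD(10)[OF rt i(2) jj(1)] repD(10)[OF rt i(2) jj(2)]
      repD(11-14)[OF rt jj(1)] repD(11-14)[OF rt jj(2)]
    show ?thesis
      unfolding risk_step_prog_def Let_def
      apply (rule runs_to_le)
       apply (rule runs_to_Cond)
        apply (rule runs_to_rassign)
      subgoal
        using frame(2) t(1) unfolding I_def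
        by (simp add: cells) (simp add: row_risk_def minus power2_eq_square)
       apply (rule runs_to_Skip)
      subgoal
        using frame(1) t(1) unfolding I_def by (simp add: cells)
      apply simp
      done
  qed
  have fin_sum: "(\<Sum>l<m. if 0 < C a l + C a (m + l) then row_risk (R - {a}) c l else 0) = risk (R - {a}) c a"
    unfolding risk_def touched_def by (simp add: sum.If_cases lessThan_def Collect_conj_eq)
  have "runs_to n f (for_loop 5 eM risk_step_prog) (set_rvar 7 0 s) (m * (2 + 4) + 4) (I m)"
  proof (rule runs_to_for_loop[where I = I])
    show "I 0 (set_nvar 5 0 (set_rvar 7 0 s))" by (auto simp: I_def same_except_def)
    show "nval eM t = m" if "I j t" for j t
      using that repD[OF rep] same_exceptD[of "{5}" "{7}" s t] by (simp add: I_def)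
  qed (rule body)
  then show ?thesis unfolding risk_prog_def
    apply (intro runs_to_le[OF runs_to_Seq[OF runs_to_rassign]])
     apply simp
     apply (rule runs_to_weaken, assumption, rule order_refl)
    using fin_sum by (auto simp: I_def)
qed

lemma price_prog_spec:
  assumes rep: "rep R c w s" and i: "fst s (4, 0, 0) = a" "a < n"
  shows "runs_to n f price_prog s (M * 5 + 6) (\<lambda>s'. same_except {5} {10} s s' \<and> snd s' (10, 0, 0) = price w a)"
proof -
  define I where "I j s' \<longleftrightarrow> same_except {5} {10} s s' \<and> snd s' (10, 0, 0) = (\<Sum>r<j. C a r * w r)" for j s'
  have "runs_to n f (for_loop 5 eRows (rassign 10 (RAdd (rvar 10) (RMul (RGet 2 vi vj) (RGet 3 e0 vj)))))
      (set_rvar 10 0 s) (M * (1 + 4) + 4) (I M)"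
  proof (rule runs_to_for_loop[where I = I])
    show "I 0 (set_nvar 5 0 (set_rvar 10 0 s))" by (auto simp: I_def same_except_def)
    fix j t assume t: "I j t"
    have fr: "same_except {5} {10} s t" using t by (simp add: I_def)
    have rt: "rep R c w t" by (rule rep_cong[OF rep fr]) auto
    show "nval eRows t = M" using repD(3,4)[OF rt] by simp
    assume j: "j < M" and tj: "fst t (5, 0, 0) = j"
    have it: "fst t (4, 0, 0) = a" using same_exceptD(1)[OF fr] i by simp
    have fr': "same_except {5} {10} s (set_nvar 5 (Suc j) (set_rvar 10 x t))" for x
      using fr by (auto simp: same_except_def)
    show "runs_to n f (rassign 10 (RAdd (rvar 10) (RMul (RGet 2 vi vj) (RGet 3 e0 vj)))) t 1
        (\<lambda>s'. fst s' (5, 0, 0) = j \<and> I (Suc j) (set_nvar 5 (Suc j) s'))"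
      using fr' t unfolding I_def
      by (intro runs_to_rassign) (simp add: tj it repD(10)[OF rt i(2) j] repD(11)[OF rt j])
  qed
  then show ?thesis unfolding price_prog_def price_def
    apply (intro runs_to_le[OF runs_to_Seq[OF runs_to_rassign]])
     apply simp
     apply (rule runs_to_weaken, assumption, rule order_refl)
    by (auto simp: I_def)
qed

lemma evaluate_prog_spec:
  assumes rep: "rep R c w s" and i: "fst s (4, 0, 0) = a" "a < n" and a: "a \<notin> R"
    and K: "snd s (7, 0, 0) = risk R c a"
  shows "runs_to n f evaluate_prog s (M * 5 + 24) (\<lambda>s'. same_except {5, 6} {8, 9, 10, 11, 12} s s' \<and>
    (if snd s (11, 0, 0) < gain R c a / price w a
     then snd s' (11, 0, 0) = gain R c a / price w a \<and> fst s' (6, 0, 0) = a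
     else snd s' (11, 0, 0) = snd s (11, 0, 0) \<and> fst s' (6, 0, 0) = fst s (6, 0, 0)))"
    (is "runs_to _ _ _ _ _ ?Q")
proof -
  define s4 where "s4 = set_rvar 9 (f (insert a R)) (set_rvar 8 (f R) s)"
  have Ra: "fst s (2, 0, a) = 0" using repD(8)[OF rep i(2)] a by simp
  have rs: "row_set n 2 0 (fst s, y) = R" for y using row_set_rep[OF rep] by (simp add: row_set_def)
  have rs': "row_set n 2 0 ((fst s)((2, 0, a) := Suc 0), y) = insert a R" for y
    using rs[of y] i(2) by (auto simp: row_set_def)
  \<comment> \<open>Writing 0 back restores the indicator row, because \<open>a\<close> is not in
    \<open>R\<close>; only the two oracle answers remain changed.\<close>
  have s4: "((fst s)((2, 0, a) := 0), (snd s)((8, 0, 0) := f R, (9, 0, 0) := f (insert a R))) = s4"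
    unfolding s4_def set_rvar_def using Ra fun_upd_triv[of "fst s" "(2, 0, a)"] by simp
  have fr4: "same_except {} {8, 9} s s4" unfolding s4_def by (auto simp: same_except_def)
  have rep4: "rep R c w s4" by (rule rep_cong[OF rep fr4]) auto
  have i4: "fst s4 (4, 0, 0) = a" using same_exceptD(1)[OF fr4] i by simp
  have rest: "runs_to n f (Seq (rassign 12 (RDiv (RMul (RSub (rvar 9) (rvar 8)) (RSub (rconst 1) (rvar 7))) (rvar 10)))
           (Cond (RLess (rvar 11) (rvar 12)) (Seq (rassign 11 (rvar 12)) (nassign 6 vi)) Skip)) t 6 ?Q"
    if t: "same_except {5} {10} s4 t \<and> snd t (10, 0, 0) = price w a" for t
  proof -
    have fr: "same_except {5} {8, 9, 10} s t" by (rule same_except_trans[OF fr4 conjunct1[OF t]]) auto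
    have v: "snd t (8, 0, 0) = f R" "snd t (9, 0, 0) = f (insert a R)"
      using same_exceptD(2)[OF conjunct1[OF t]] by (simp_all add: s4_def)
    note cells = same_exceptD[OF fr] v i K conjunct2[OF t]
    have fr1: "same_except {5, 6} {8, 9, 10, 11, 12} s (set_rvar 12 x t)"
      "same_except {5, 6} {8, 9, 10, 11, 12} s (set_nvar 6 z (set_rvar 11 y (set_rvar 12 x t)))" for x y z
      using fr by (auto simp: same_except_def)
    show ?thesis
      apply (rule runs_to_le)
       apply (rule runs_to_Seq, rule runs_to_rassign, rule runs_to_Cond, rule runs_to_Seq,
         rule runs_to_rassign, rule runs_to_nassign)
      subgoal using fr1 by (simp add: cells gain_def)
       apply (rule runs_to_Skip)
      subgoal using fr1 by (simp add: cells gain_def)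
      apply simp
      done
  qed
  have "runs_to n f (Seq price_prog (Seq (rassign 12 (RDiv (RMul (RSub (rvar 9) (rvar 8)) (RSub (rconst 1) (rvar 7))) (rvar 10)))
           (Cond (RLess (rvar 11) (rvar 12)) (Seq (rassign 11 (rvar 12)) (nassign 6 vi)) Skip))) s4 (Suc (M * 5 + 6 + 6)) ?Q"
    by (rule runs_to_Seq, rule runs_to_weaken[OF price_prog_spec[OF rep4 i4 i(2)] order_refl], rule rest)
  then have *: "runs_to n f (Seq price_prog (Seq (rassign 12 (RDiv (RMul (RSub (rvar 9) (rvar 8)) (RSub (rconst 1) (rvar 7))) (rvar 10)))
           (Cond (RLess (rvar 11) (rvar 12)) (Seq (rassign 11 (rvar 12)) (nassign 6 vi)) Skip)))
       ((fst s)((2, 0, a) := 0), (snd s)((8, 0, 0) := f R, (9, 0, 0) := f (insert a R))) (Suc (M * 5 + 6 + 6)) ?Q"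
    by (simp only: s4)
  show ?thesis
    unfolding evaluate_prog_def
    apply (rule runs_to_le)
     apply (rule runs_to_Seq, rule runs_to_Query, rule runs_to_Seq, rule runs_to_NSet,
       rule runs_to_Seq, rule runs_to_Query, rule runs_to_Seq, rule runs_to_NSet)
     apply (rule runs_to_state[OF *])
     apply (simp add: i rs rs' row_set_rep[OF rep])
    apply simp
    done
qed

lemma select_prog_spec:
  assumes rep: "rep R c w s" and cons: "consistent R c w g"
  shows "runs_to n f select_prog s (n * (m * 6 + M * 5 + 40) + 6) (\<lambda>s'. same_except {4, 5, 6} {7, 8, 9, 10, 11, 12} s s' \<and>
    (\<forall>b\<in>candidates R c. gain R c b / price w b \<le> snd s' (11, 0, 0)) \<and>
    (0 < snd s' (11, 0, 0) \<longrightarrow> fst s' (6, 0, 0) \<in> candidates R c \<and>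
      gain R c (fst s' (6, 0, 0)) / price w (fst s' (6, 0, 0)) = snd s' (11, 0, 0)))"
proof -
  define I where "I i s' \<longleftrightarrow> same_except {4, 5, 6} {7, 8, 9, 10, 11, 12} s s' \<and> 0 \<le> snd s' (11, 0, 0) \<and>
    (\<forall>b\<in>candidates R c. b < i \<longrightarrow> gain R c b / price w b \<le> snd s' (11, 0, 0)) \<and>
    (0 < snd s' (11, 0, 0) \<longrightarrow> fst s' (6, 0, 0) \<in> candidates R c \<and>
      gain R c (fst s' (6, 0, 0)) / price w (fst s' (6, 0, 0)) = snd s' (11, 0, 0))" for i s'
  let ?B = "Seq risk_prog (Cond (BAnd (NLess e0 (NGet 3 e0 vi)) (BAnd (NLess (NGet 2 e0 vi) (NConst 1))
         (BNot (RLess (RSub (rconst 1) (RDiv (rconst 1) (rconst 200))) (rvar 7))))) evaluate_prog Skip)"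
  have "runs_to n f (for_loop 4 eN ?B) (set_rvar 11 0 s) (n * ((m * 6 + M * 5 + 32) + 4) + 4) (I n)"
  proof (rule runs_to_for_loop[where I = I])
    show "I 0 (set_nvar 4 0 (set_rvar 11 0 s))" by (auto simp: I_def same_except_def)
    fix a t assume t: "I a t"
    have fr: "same_except {4, 5, 6} {7, 8, 9, 10, 11, 12} s t" using t by (simp add: I_def)
    have rt: "rep R c w t" by (rule rep_cong[OF rep fr]) auto
    show "nval eN t = n" using repD(3)[OF rt] by simp
    assume a: "a < n" and it: "fst t (4, 0, 0) = a"
    let ?P = "\<lambda>s'. fst s' (4, 0, 0) = a \<and> I (Suc a) (set_nvar 4 (Suc a) s')"
    have next_I: "?P t'" if fr': "same_except {5, 6} {7, 8, 9, 10, 11, 12} t t'"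
      and b: "a \<in> candidates R c \<Longrightarrow> (if snd t (11, 0, 0) < gain R c a / price w a
         then snd t' (11, 0, 0) = gain R c a / price w a \<and> fst t' (6, 0, 0) = a
         else snd t' (11, 0, 0) = snd t (11, 0, 0) \<and> fst t' (6, 0, 0) = fst t (6, 0, 0))"
       "a \<notin> candidates R c \<Longrightarrow> snd t' (11, 0, 0) = snd t (11, 0, 0) \<and> fst t' (6, 0, 0) = fst t (6, 0, 0)" for t'
    proof -
      have i': "fst t' (4, 0, 0) = a" using same_exceptD(1)[OF fr'] it by simp
      have "same_except {4, 5, 6} {7, 8, 9, 10, 11, 12} s t'" by (rule same_except_trans[OF fr fr']) auto
      then have fr'': "same_except {4, 5, 6} {7, 8, 9, 10, 11, 12} s (set_nvar 4 (Suc a) t')"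
        by (auto simp: same_except_def)
      show ?thesis
      proof (cases "a \<in> candidates R c \<and> snd t (11, 0, 0) < gain R c a / price w a")
        case True
        then show ?thesis using b i' fr'' t unfolding I_def by (force simp: less_Suc_eq)
      next
        case False
        then have "snd t' (11, 0, 0) = snd t (11, 0, 0)" "fst t' (6, 0, 0) = fst t (6, 0, 0)"
          using b by (auto split: if_splits)
        moreover have "a \<in> candidates R c \<Longrightarrow> gain R c a / price w a \<le> snd t (11, 0, 0)" using False by auto
        ultimately show ?thesis using i' fr'' t unfolding I_def by (auto simp: less_Suc_eq)
      qed
    qed
    have cond: "runs_to n f (Cond (BAnd (NLess e0 (NGet 3 e0 vi)) (BAnd (NLess (NGet 2 e0 vi) (NConst 1))
         (BNot (RLess (RSub (rconst 1) (RDiv (rconst 1) (rconst 200))) (rvar 7))))) evaluate_prog Skip) t'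
         (Suc (max (M * 5 + 24) 0)) ?P"
      if t': "same_except {5} {7} t t' \<and> snd t' (7, 0, 0) = risk (R - {a}) c a" for t'
    proof -
      have ft: "same_except {5} {7} t t'" using t' by blast
      have rt': "rep R c w t'" by (rule rep_cong[OF rt ft]) auto
      have it': "fst t' (4, 0, 0) = a" using same_exceptD(1)[OF ft] it by simp
      have bv: "bval (BAnd (NLess e0 (NGet 3 e0 vi)) (BAnd (NLess (NGet 2 e0 vi) (NConst 1))
         (BNot (RLess (RSub (rconst 1) (RDiv (rconst 1) (rconst 200))) (rvar 7))))) t' \<longleftrightarrow> a \<in> candidates R c"
        using repD(8,9)[OF rt' a] t' it' by (auto simp: candidates_def not_less)
      show ?thesis
      proof (rule runs_to_Cond)
        assume "bval (BAnd (NLess e0 (NGet 3 e0 vi)) (BAnd (NLess (NGet 2 e0 vi) (NConst 1))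
         (BNot (RLess (RSub (rconst 1) (RDiv (rconst 1) (rconst 200))) (rvar 7))))) t'"
        then have ac: "a \<in> candidates R c" using bv by blast
        then have aR: "a \<notin> R" by (simp add: candidates_def)
        then have K: "snd t' (7, 0, 0) = risk R c a" using t' by simp
        show "runs_to n f evaluate_prog t' (M * 5 + 24) ?P"
        proof (rule runs_to_weaken[OF evaluate_prog_spec[OF rt' it' a aR K] order_refl])
          fix t'' assume q: "same_except {5, 6} {8, 9, 10, 11, 12} t' t'' \<and>
            (if snd t' (11, 0, 0) < gain R c a / price w a
             then snd t'' (11, 0, 0) = gain R c a / price w a \<and> fst t'' (6, 0, 0) = a
             else snd t'' (11, 0, 0) = snd t' (11, 0, 0) \<and> fst t'' (6, 0, 0) = fst t' (6, 0, 0))"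
          show "?P t''"
          proof (rule next_I)
            show "same_except {5, 6} {7, 8, 9, 10, 11, 12} t t''"
              by (rule same_except_trans[OF ft conjunct1[OF q]]) auto
          qed (use q ac same_exceptD[OF ft] in auto)
        qed
      next
        assume "\<not> bval (BAnd (NLess e0 (NGet 3 e0 vi)) (BAnd (NLess (NGet 2 e0 vi) (NConst 1))
         (BNot (RLess (RSub (rconst 1) (RDiv (rconst 1) (rconst 200))) (rvar 7))))) t'"
        then have ac: "a \<notin> candidates R c" using bv by blast
        have "?P t'"
        proof (rule next_I)
          show "same_except {5, 6} {7, 8, 9, 10, 11, 12} t t'"
            by (rule same_except_trans[OF ft same_except_refl]) auto
        qed (use ac same_exceptD[OF ft] in auto)
        then show "runs_to n f Skip t' 0 ?P" by (rule runs_to_Skip)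
      qed
    qed
    show "runs_to n f ?B t (m * 6 + M * 5 + 32) ?P"
      by (rule runs_to_le, rule runs_to_Seq, rule runs_to_weaken[OF risk_prog_spec[OF rt it a] order_refl],
        rule cond, assumption) simp
  qed
  then have *: "runs_to n f (for_loop 4 eN ?B) (set_rvar 11 0 s) (n * ((m * 6 + M * 5 + 32) + 4) + 4) (\<lambda>s'. same_except {4, 5, 6} {7, 8, 9, 10, 11, 12} s s' \<and>
    (\<forall>b\<in>candidates R c. gain R c b / price w b \<le> snd s' (11, 0, 0)) \<and>
    (0 < snd s' (11, 0, 0) \<longrightarrow> fst s' (6, 0, 0) \<in> candidates R c \<and>
      gain R c (fst s' (6, 0, 0)) / price w (fst s' (6, 0, 0)) = snd s' (11, 0, 0)))"
    by (rule runs_to_weaken) (use G_sub in \<open>auto simp: I_def candidates_def\<close>)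
  show ?thesis unfolding select_prog_def
    apply (rule runs_to_le)
     apply (rule runs_to_Seq, rule runs_to_rassign)
     apply (rule runs_to_state[OF *])
     apply simp
    apply (simp add: algebra_simps)
    done
qed

text \<open>Generalized over the current result \<open>\<alpha>\<close>: with \<open>l\<close> coins
  to come it stays 1 with probability \<open>\<alpha> / 2 ^ l\<close>. One coin averages the value
  for result 0 with the value for \<open>\<alpha>\<close>, which is the identity
  \<open>half\<close>.\<close>

lemma flip_loop_spec:
  assumes "fst s (9, 0, 0) = 2 ^ i" "fst s (8, 0, 0) = 2 ^ (i + l)" "fst s (10, 0, 0) = \<alpha>" "\<alpha> \<in> {0, 1}"
  shows "bounds_expectation n f flip_loop s (l * 9 + 1) (real \<alpha> / 2 ^ l * Y + (1 - real \<alpha> / 2 ^ l) * Z)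
    (\<lambda>s'. if fst s' (10, 0, 0) = 1 then Y else Z)
    (\<lambda>s'. same_except {9, 10, 11} {} s s' \<and> fst s' (10, 0, 0) \<in> {0, 1})"
  using assms
proof (induction l arbitrary: s i \<alpha>)
  case 0
  then have "\<not> bval (NLess (nvar 9) (nvar 8)) s" by simp
  then have "bounds_expectation n f flip_loop s (Suc 0) (real \<alpha> * Y + (1 - real \<alpha>) * Z)
    (\<lambda>s'. if fst s' (10, 0, 0) = 1 then Y else Z)
    (\<lambda>s'. same_except {9, 10, 11} {} s s' \<and> fst s' (10, 0, 0) \<in> {0, 1})"
    unfolding flip_loop_def using 0 by (intro bounds_expectation_While) (auto simp: same_except_refl)
  then show ?case by simp
next
  case (Suc l)
  let ?X = "\<lambda>s'. if fst s' (10, 0, 0) = 1 then Y else Z"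
  let ?Q = "\<lambda>s'. same_except {9, 10, 11} {} s s' \<and> fst s' (10, 0, 0) \<in> {0, 1}"
  let ?r = "real \<alpha> / 2 ^ Suc l * Y + (1 - real \<alpha> / 2 ^ Suc l) * Z"
  let ?B = "Seq (Flip 11 e0 e0) (Seq (Cond (NLess (nvar 11) (NConst 1)) (nassign 10 e0) Skip)
       (nassign 9 (NAdd (nvar 9) (nvar 9))))"
  define v where "v x = (real x / 2 ^ l * Y + (1 - real x / 2 ^ l) * Z)" for x :: nat
  define P where "P s' \<longleftrightarrow> same_except {9, 10, 11} {} s s' \<and> fst s' (9, 0, 0) = 2 ^ Suc i
    \<and> fst s' (10, 0, 0) \<in> {0, 1}" for s'
  have half: "v 0 + v \<alpha> = 2 * ?r" unfolding v_def by (simp add: field_simps)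
  have rest: "bounds_expectation n f (Seq (Cond (NLess (nvar 11) (NConst 1)) (nassign 10 e0) Skip)
       (nassign 9 (NAdd (nvar 9) (nvar 9)))) t 4 (v (if fst t (11, 0, 0) = 0 then 0 else \<alpha>))
       (\<lambda>s'. v (fst s' (10, 0, 0))) P"
    if t: "same_except {11} {} s t" for t
  proof (rule bounds_expectation_runs_to)
    have fr: "same_except {9, 10, 11} {} s (set_nvar 9 y t)"
      "same_except {9, 10, 11} {} s (set_nvar 9 y (set_nvar 10 z t))" for y z
      using t by (auto simp: same_except_def)
    show "runs_to n f (Seq (Cond (NLess (nvar 11) (NConst 1)) (nassign 10 e0) Skip)
       (nassign 9 (NAdd (nvar 9) (nvar 9)))) t 4
       (\<lambda>s'. P s' \<and> v (if fst t (11, 0, 0) = 0 then 0 else \<alpha>) \<le> v (fst s' (10, 0, 0)))"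
      apply (rule runs_to_le)
       apply (rule runs_to_Seq, rule runs_to_Cond)
        apply (rule runs_to_nassign, rule runs_to_nassign)
      subgoal using fr Suc.prems same_exceptD[OF t] by (simp add: P_def)
       apply (rule runs_to_Skip, rule runs_to_nassign)
      subgoal using fr Suc.prems same_exceptD[OF t] by (simp add: P_def)
      apply simp
      done
  qed
  have body: "bounds_expectation n f ?B s (Suc (1 + 4)) ?r (\<lambda>s'. v (fst s' (10, 0, 0))) P"
    apply (rule bounds_expectation_Seq[where P = "same_except {11} {} s"
          and Y = "\<lambda>t. v (if fst t (11, 0, 0) = 0 then 0 else \<alpha>)"])
     apply (rule bounds_expectation_Flip)
    subgoal by (auto simp: same_except_def)
    subgoal using half by simp
    apply (rule rest)
    apply assumption
    done
  have loop: "bounds_expectation n f flip_loop t (l * 9 + 1) (v (fst t (10, 0, 0))) ?X ?Q" if t: "P t" for t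
  proof -
    have fr: "same_except {9, 10, 11} {} s t" using t by (simp add: P_def)
    have "bounds_expectation n f flip_loop t (l * 9 + 1) (v (fst t (10, 0, 0))) ?X
        (\<lambda>s'. same_except {9, 10, 11} {} t s' \<and> fst s' (10, 0, 0) \<in> {0, 1})"
      unfolding v_def
    proof (rule Suc.IH)
      show "fst t (9, 0, 0) = 2 ^ Suc i" "fst t (10, 0, 0) \<in> {0, 1}" using t by (simp_all add: P_def)
      show "fst t (8, 0, 0) = 2 ^ (Suc i + l)" using same_exceptD(1)[OF fr] Suc.prems by simp
    qed simp
    then show ?thesis unfolding bounds_expectation_def using same_except_trans[OF fr] by blast
  qed
  have "bounds_expectation n f flip_loop s (Suc (Suc (Suc (1 + 4) + (l * 9 + 1)))) ?r ?X ?Q"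
    unfolding flip_loop_def
    apply (rule bounds_expectation_While)
     apply (rule bounds_expectation_Seq[OF body])
    using loop apply (simp add: flip_loop_def)
    using Suc.prems power_strict_increasing[of i "i + Suc l" "2 :: nat"] by simp
  then show ?case by (rule bounds_expectation_le) auto
qed

lemma flip_prog_spec:
  assumes "rep R c w s"
  shows "bounds_expectation n f flip_prog s (L * 9 + 5) (p * Y + (1 - p) * Z)
    (\<lambda>s'. if fst s' (10, 0, 0) = 1 then Y else Z)
    (\<lambda>s'. same_except {9, 10, 11} {} s s' \<and> fst s' (10, 0, 0) \<in> {0, 1})"
proof -
  let ?t = "set_nvar 10 1 (set_nvar 9 1 s)"
  let ?X = "\<lambda>s'. if fst s' (10, 0, 0) = 1 then Y else Z"
  let ?Q = "\<lambda>s'. same_except {9, 10, 11} {} s s' \<and> fst s' (10, 0, 0) \<in> {0, 1}"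
  have fr: "same_except {9, 10, 11} {} s ?t" by (auto simp: same_except_def)
  have "bounds_expectation n f flip_loop ?t (L * 9 + 1) (real 1 / 2 ^ L * Y + (1 - real 1 / 2 ^ L) * Z)
    ?X (\<lambda>s'. same_except {9, 10, 11} {} ?t s' \<and> fst s' (10, 0, 0) \<in> {0, 1})"
    by (rule flip_loop_spec[where i = 0]) (use repD(5)[OF assms] in auto)
  then have *: "bounds_expectation n f flip_loop ?t (L * 9 + 1) (p * Y + (1 - p) * Z) ?X ?Q"
    unfolding bounds_expectation_def p_eq using same_except_trans[OF fr] by (simp only: of_nat_1) blast
  have "bounds_expectation n f flip_prog s (Suc (1 + Suc (1 + (L * 9 + 1)))) (p * Y + (1 - p) * Z) ?X ?Q"
    unfolding flip_prog_def
    by (rule bounds_expectation_runs_to_Seq, rule runs_to_nassign,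
        rule bounds_expectation_runs_to_Seq, rule runs_to_nassign) (use * in simp)
  then show ?thesis by (rule bounds_expectation_le) auto
qed

lemma update_prog_spec:
  assumes rep: "rep R c w s" and b: "fst s (6, 0, 0) = b" "b \<in> G" "b \<notin> R"
    and \<alpha>: "fst s (10, 0, 0) = \<alpha>" "\<alpha> \<in> {0, 1}" and stop: "fst s (7, 0, 0) = 0"
  shows "runs_to n f update_prog s (M * 14 + 6) (\<lambda>s'. fst s' (10, 0, 0) = \<alpha>
    \<and> rep (if \<alpha> = 1 then insert b R else R) (advance b c) (reweight b w) s'
    \<and> fst s' (7, 0, 0) = (if \<exists>r<M. D - 1 < advance b c r then 1 else 0))"
proof -
  have bn: "b < n" using b G_sub by auto
  define I where "I r s' \<longleftrightarrow> same_except {5, 7} {3, 4, 5, 6} s s'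
    \<and> (\<forall>q<M. snd s' (4, 0, q) = (if q < r then advance b c q else c q)
        \<and> snd s' (3, 0, q) = (if q < r then reweight b w q else w q)
        \<and> snd s' (5, 0, q) = (\<Sum>i\<in>R. C i q) + (if q < r then real \<alpha> * C b q else 0)
        \<and> snd s' (6, 0, q) = (\<Sum>i\<in>R. (C i q)\<^sup>2) + (if q < r then real \<alpha> * (C b q)\<^sup>2 else 0))
    \<and> fst s' (7, 0, 0) = (if \<exists>q<r. D - 1 < advance b c q then 1 else 0)" for r s'
  have rows: "runs_to n f (for_loop 5 eRows update_row_prog) s (M * (10 + 4) + 4) (I M)"
  proof (rule runs_to_for_loop[where I = I])
    show "I 0 (set_nvar 5 0 s)"
      using repD(11-14)[OF rep] stop by (auto simp: I_def same_except_def)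
    fix r t assume t: "I r t"
    have fr: "same_except {5, 7} {3, 4, 5, 6} s t" using t by (simp add: I_def)
    have cn: "fst t (0, 0, 0) = n" "fst t (0, 0, Suc 0) = m" "fst t (6, 0, 0) = b" "fst t (10, 0, 0) = \<alpha>"
      "snd t (13, 0, 0) = D"
      using same_exceptD[OF fr] repD(3-6)[OF rep] b \<alpha> by simp_all
    show "nval eRows t = M" using cn by simp
    assume r: "r < M" and tr: "fst t (5, 0, 0) = r"
    have Cb: "snd t (2, b, r) = C b r" using same_exceptD(2)[OF fr] repD(10)[OF rep bn r] by simp
    have rows: "snd t (4, 0, r) = c r" "snd t (3, 0, r) = w r" "snd t (5, 0, r) = (\<Sum>i\<in>R. C i r)"
      "snd t (6, 0, r) = (\<Sum>i\<in>R. (C i r)\<^sup>2)" using t r by (auto simp: I_def)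
    let ?m = "(snd t)((4, 0, r) := advance b c r, (3, 0, r) := reweight b w r,
      (5, 0, r) := (\<Sum>i\<in>R. C i r) + real \<alpha> * C b r, (6, 0, r) := (\<Sum>i\<in>R. (C i r)\<^sup>2) + real \<alpha> * (C b r)\<^sup>2)"
    have fr': "same_except {5, 7} {3, 4, 5, 6} s (set_nvar 5 (Suc r) (fst t, ?m))"
      "same_except {5, 7} {3, 4, 5, 6} s (set_nvar 5 (Suc r) (set_nvar 7 1 (fst t, ?m)))"
      using fr by (auto simp: same_except_def)
    have rows': "\<forall>q<M. ?m (4, 0, q) = (if q < Suc r then advance b c q else c q)
        \<and> ?m (3, 0, q) = (if q < Suc r then reweight b w q else w q)
        \<and> ?m (5, 0, q) = (\<Sum>i\<in>R. C i q) + (if q < Suc r then real \<alpha> * C b q else 0)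
        \<and> ?m (6, 0, q) = (\<Sum>i\<in>R. (C i q)\<^sup>2) + (if q < Suc r then real \<alpha> * (C b q)\<^sup>2 else 0)"
      using t unfolding I_def by (auto simp: less_Suc_eq)
    have flag: "fst t (7, 0, 0) = (if \<exists>q<r. D - 1 < advance b c q then 1 else 0)" using t by (simp add: I_def)
    let ?P = "\<lambda>s'. fst s' (5, 0, 0) = r \<and> I (Suc r) (set_nvar 5 (Suc r) s')"
    have last: "runs_to n f (Cond (RLess (RSub (rvar 13) (rconst 1)) (RGet 4 e0 vj)) (nassign 7 (NConst 1)) Skip)
        (fst t, ?m) (Suc (max 1 0)) ?P"
      apply (rule runs_to_Cond)
       apply (rule runs_to_nassign)
      subgoal using fr'(2) rows' tr cn unfolding I_def by (auto simp: less_Suc_eq)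
      apply (rule runs_to_Skip)
      subgoal using fr'(1) rows' tr cn flag unfolding I_def by (auto simp: less_Suc_eq)
      done
    show "runs_to n f update_row_prog t 10 ?P"
      unfolding update_row_prog_def Let_def
      apply (rule runs_to_le)
       apply (rule runs_to_Seq, rule runs_to_RSet, rule runs_to_Seq, rule runs_to_RSet,
         rule runs_to_Seq, rule runs_to_RSet, rule runs_to_Seq, rule runs_to_RSet)
       apply (rule runs_to_state[OF last])
       apply (simp add: tr cn Cb rows advance_def reweight_def power2_eq_square)
      apply simp
      done
  qed
  have insertion: "runs_to n f (NSet 2 e0 vb (nvar 10)) t 1 (\<lambda>s'. fst s' (10, 0, 0) = \<alpha>
      \<and> rep (if \<alpha> = 1 then insert b R else R) (advance b c) (reweight b w) s'
      \<and> fst s' (7, 0, 0) = (if \<exists>r<M. D - 1 < advance b c r then 1 else 0))" if t: "I M t" for t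
  proof (rule runs_to_NSet)
    have fr: "same_except {5, 7} {3, 4, 5, 6} s t" using t by (simp add: I_def)
    note cells = same_exceptD[OF fr] b \<alpha>
    have "rep (if \<alpha> = 1 then insert b R else R) (advance b c) (reweight b w) ((fst t)((2, 0, b) := \<alpha>), snd t)"
      using rep t \<alpha>(2) b(2,3) finite_sub_G[of R] unfolding rep_def I_def by (auto simp: cells)
    then show "fst ((fst t)((2, nval e0 t, nval vb t) := nval (nvar 10) t), snd t) (10, 0, 0) = \<alpha> \<and>
      rep (if \<alpha> = 1 then insert b R else R) (advance b c) (reweight b w)
         ((fst t)((2, nval e0 t, nval vb t) := nval (nvar 10) t), snd t) \<and>
      fst ((fst t)((2, nval e0 t, nval vb t) := nval (nvar 10) t), snd t) (7, 0, 0)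
        = (if \<exists>r<M. D - 1 < advance b c r then 1 else 0)"
      using t by (simp add: cells I_def)
  qed
  show ?thesis unfolding update_prog_def
    by (rule runs_to_le, rule runs_to_Seq, rule runs_to_weaken[OF rows order_refl], rule insertion, assumption) simp
qed

lemma output_prog_spec:
  assumes rep: "rep R c w s"
  shows "runs_to n f output_prog s (n * (m * 6 + 13) + 4) (\<lambda>s'. row_set n 1 0 s' = survivors R c)"
proof -
  define I where "I i s' \<longleftrightarrow> same_except {1, 4, 5} {7} s s' \<and>
    (\<forall>a<i. fst s' (1, 0, a) = (if a \<in> survivors R c then 1 else 0))" for i s'
  let ?B = "Seq risk_prog
     (Cond (BAnd (NLess e0 (NGet 2 e0 vi)) (RLess (rvar 7) (rconst 1))) (NSet 1 e0 vi (NConst 1)) (NSet 1 e0 vi e0))"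
  have "runs_to n f (for_loop 4 eN ?B) s (n * ((m * 6 + 9) + 4) + 4) (I n)"
  proof (rule runs_to_for_loop[where I = I])
    show "I 0 (set_nvar 4 0 s)" by (auto simp: I_def same_except_def)
    fix a t assume t: "I a t"
    have fr: "same_except {1, 4, 5} {7} s t" using t by (simp add: I_def)
    have rt: "rep R c w t" by (rule rep_cong[OF rep fr]) auto
    show "nval eN t = n" using repD(3)[OF rt] by simp
    assume a: "a < n" and it: "fst t (4, 0, 0) = a"
    let ?P = "\<lambda>s'. fst s' (4, 0, 0) = a \<and> I (Suc a) (set_nvar 4 (Suc a) s')"
    have cond: "runs_to n f (Cond (BAnd (NLess e0 (NGet 2 e0 vi)) (RLess (rvar 7) (rconst 1)))
        (NSet 1 e0 vi (NConst 1)) (NSet 1 e0 vi e0)) t' (Suc (max 1 1)) ?P"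
      if t': "same_except {5} {7} t t' \<and> snd t' (7, 0, 0) = risk (R - {a}) c a" for t'
    proof -
      have ft: "same_except {5} {7} t t'" using t' by blast
      have rt': "rep R c w t'" by (rule rep_cong[OF rt ft]) auto
      have it': "fst t' (4, 0, 0) = a" using same_exceptD(1)[OF ft] it by simp
      have fr': "same_except {1, 4, 5} {7} s t'" by (rule same_except_trans[OF fr ft]) auto
      have fr'': "same_except {1, 4, 5} {7} s (set_nvar 4 (Suc a) ((fst t')((1, 0, a) := x), snd t'))" for x
        using fr' by (auto simp: same_except_def)
      have out: "\<forall>b<a. fst t' (1, 0, b) = (if b \<in> survivors R c then 1 else 0)"
        using t same_exceptD(1)[OF ft] by (simp add: I_def)
      have bv: "bval (BAnd (NLess e0 (NGet 2 e0 vi)) (RLess (rvar 7) (rconst 1))) t' \<longleftrightarrow> a \<in> survivors R c"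
        using repD(8)[OF rt' a] t' it' by (auto simp: survivors_def)
      show ?thesis
        apply (rule runs_to_Cond)
         apply (rule runs_to_NSet)
        subgoal using bv it' fr'' out unfolding I_def by (auto simp: less_Suc_eq)
        apply (rule runs_to_NSet)
        subgoal using bv it' fr'' out unfolding I_def by (auto simp: less_Suc_eq)
        done
    qed
    show "runs_to n f ?B t (m * 6 + 9) ?P"
      by (rule runs_to_le, rule runs_to_Seq, rule runs_to_weaken[OF risk_prog_spec[OF rt it a] order_refl],
        rule cond, assumption) simp
  qed
  then have "runs_to n f output_prog s (n * ((m * 6 + 9) + 4) + 4) (\<lambda>s'. row_set n 1 0 s' = survivors R c)"
    unfolding output_prog_def
  proof (rule runs_to_weaken)
    fix t assume "I n t"
    moreover have "survivors R c \<subseteq> {..<n}" using repD(1)[OF rep] G_sub by (auto simp: survivors_def)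
    ultimately show "row_set n 1 0 t = survivors R c" unfolding row_set_def I_def
      by (auto split: if_splits)
  qed simp
  then show ?thesis by (rule runs_to_le) (simp add: algebra_simps)
qed

section \<open>The main loop as a submartingale\<close>

definition stopped :: "nat set \<Rightarrow> (nat \<Rightarrow> real) \<Rightarrow> bool" where
  "stopped R c \<longleftrightarrow> (\<exists>r<M. D - 1 < c r) \<or> (\<forall>a\<in>candidates R c. gain R c a \<le> 0)"

definition flag_correct :: "nat set \<Rightarrow> (nat \<Rightarrow> real) \<Rightarrow> state \<Rightarrow> bool" where
  "flag_correct R c s \<longleftrightarrow> fst s (7, 0, 0) = 0 \<and> (\<forall>r<M. c r \<le> D - 1) \<or> fst s (7, 0, 0) = 1 \<and> stopped R c"

lemma flag_correctI:
  assumes "fst s (7, 0, 0) = (if \<exists>r<M. D - 1 < c r then 1 else 0)"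
  shows "flag_correct R c s"
proof (cases "\<exists>r<M. D - 1 < c r")
  case True
  then show ?thesis using assms by (simp add: flag_correct_def stopped_def)
next
  case False
  then have "\<forall>r<M. c r \<le> D - 1" by (meson not_less)
  then show ?thesis using assms False by (simp add: flag_correct_def)
qed

text \<open>A post-expectation may depend on the state only, so sample and loads are read back from
  memory. The factor is that of \<open>potential_stop\<close> with
  \<open>\<delta> = 1 / 200\<close>.\<close>

definition output_value :: "state \<Rightarrow> real" where
  "output_value s = (1 + p * D / (1 / 200)) * (f (survivors (row_set n 2 0 s) (\<lambda>r. snd s (4, 0, r))) - f {})"

definition good_state :: "state \<Rightarrow> bool" where
  "good_state s \<longleftrightarrow> (\<exists>R c w g. rep R c w s \<and> consistent R c w g)"

text \<open>\<open>rep\<close> determines the loads on rows below \<open>M\<close> only, whereas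
  \<open>output_value\<close> reads an entire row of memory.\<close>

lemma survivors_cong:
  assumes "\<And>r. r < M \<Longrightarrow> c r = c' r"
  shows "survivors R c = survivors R c'"
proof -
  have "row_risk X c j = row_risk X c' j" if "j < m" for X j
    using that assms unfolding row_risk_def by simp
  then have "risk X c a = risk X c' a" for X a
    unfolding risk_def by (intro sum.cong) (auto simp: touched_def)
  then show ?thesis unfolding survivors_def by simp
qed

lemma output_value_rep:
  assumes "rep R c w s"
  shows "output_value s = (1 + p * D / (1 / 200)) * (f (survivors R c) - f {})"
  using row_set_rep[OF assms] survivors_cong[of "\<lambda>r. snd s (4, 0, r)" c R] repD(12)[OF assms]
  unfolding output_value_def by simp

definition round_time :: nat where
  "round_time = n * (m * 6 + M * 5 + 40) + L * 9 + M * 14 + 30"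

lemma main_loop_spec:
  assumes "rep R c w s" "consistent R c w g" "flag_correct R c s"
    "real n * D - (\<Sum>a<n. c (2 * m + a)) \<le> real N"
  shows "bounds_expectation n f main_loop s ((N + 1) * (round_time + 2) + 1) (potential R c w g) output_value good_state"
  using assms
proof (induction N arbitrary: R c w g s rule: less_induct)
  case (less N)
  note rep = less.prems(1) and cons = less.prems(2)
  have done_case: "bounds_expectation n f main_loop t 1 (potential R c' w' g') output_value good_state"
    if "rep R c' w' t" "consistent R c' w' g'" "fst t (7, 0, 0) = 1" "stopped R c'" for R c' w' g' t
  proof -
    have "potential R c' w' g' \<le> output_value t"
      using potential_stop[OF that(2)] that(4) output_value_rep[OF that(1)] unfolding stopped_def by simp
    then have "bounds_expectation n f main_loop t (Suc 0) (potential R c' w' g') output_value good_state"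
      unfolding main_loop_def using that by (intro bounds_expectation_While) (auto simp: good_state_def)
    then show ?thesis by simp
  qed
  show ?case
  proof (cases "fst s (7, 0, 0) = 1")
    case True
    then show ?thesis using done_case[OF rep cons] less.prems(3)
      by (intro bounds_expectation_le[OF done_case[OF rep cons]]) (auto simp: flag_correct_def)
  next
    case False
    then have flag: "fst s (7, 0, 0) = 0" and room: "\<forall>r<M. c r \<le> D - 1"
      using less.prems(3) by (auto simp: flag_correct_def)
    obtain s1 where ex: "exec n f select_prog s (n * (m * 6 + M * 5 + 40) + 6) (return_pmf s1)"
      and fr: "same_except {4, 5, 6} {7, 8, 9, 10, 11, 12} s s1"
      and best: "\<And>b. b \<in> candidates R c \<Longrightarrow> gain R c b / price w b \<le> snd s1 (11, 0, 0)"
      and sel: "0 < snd s1 (11, 0, 0) \<Longrightarrow> fst s1 (6, 0, 0) \<in> candidates R c \<and>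
        gain R c (fst s1 (6, 0, 0)) / price w (fst s1 (6, 0, 0)) = snd s1 (11, 0, 0)"
      using select_prog_spec[OF rep cons] unfolding runs_to_def by blast
    have rep1: "rep R c w s1" by (rule rep_cong[OF rep fr]) auto
    have flag1: "fst s1 (7, 0, 0) = 0" using same_exceptD(1)[OF fr] flag by simp
    have select: "runs_to n f select_prog s (n * (m * 6 + M * 5 + 40) + 6) (\<lambda>t. t = s1)"
      using ex unfolding runs_to_def by blast
    have unfold: "bounds_expectation n f main_loop s (Suc t) r X Q"
      if "bounds_expectation n f (Seq round_prog main_loop) s t r X Q" for t r X Q
      unfolding main_loop_def
      by (rule bounds_expectation_While) (use that flag in \<open>auto simp: main_loop_def\<close>)
    have round: "bounds_expectation n f round_prog s round_time r X Q"
      if "bounds_expectation n f (Cond (RLess (rconst 0) (rvar 11)) (Seq flip_prog update_prog) (nassign 7 (NConst 1)))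
        s1 (L * 9 + M * 14 + 20) r X Q" for r X Q
    proof (rule bounds_expectation_le)
      show "bounds_expectation n f round_prog s (Suc (n * (m * 6 + M * 5 + 40) + 6 + (L * 9 + M * 14 + 20))) r X Q"
        unfolding round_prog_def
        by (rule bounds_expectation_runs_to_Seq, rule runs_to_weaken[OF select order_refl]) (use that in simp)
    qed (auto simp: round_time_def)
    show ?thesis
    proof (cases "0 < snd s1 (11, 0, 0)")
      case no: False
      have "gain R c a \<le> 0" if a: "a \<in> candidates R c" for a
      proof -
        have "0 < price w a" using a price_pos[OF cons] by (simp add: candidates_def)
        moreover have "gain R c a / price w a \<le> 0" using best[OF a] no by simp
        ultimately show ?thesis by (simp add: divide_le_0_iff)
      qed
      then have st: "stopped R c" by (simp add: stopped_def)
      have "bounds_expectation n f (nassign 7 (NConst 1)) s1 1 (potential R c w g) (\<lambda>_. potential R c w g)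
          (\<lambda>t. rep R c w t \<and> fst t (7, 0, 0) = 1)"
      proof (rule bounds_expectation_runs_to, rule runs_to_nassign)
        have "same_except {7} {} s1 (set_nvar 7 1 s1)" by (simp add: same_except_def)
        then have "rep R c w (set_nvar 7 1 s1)" by (rule rep_cong[OF rep1]) auto
        then show "(rep R c w (set_nvar 7 (nval (NConst 1) s1) s1) \<and> fst (set_nvar 7 (nval (NConst 1) s1) s1) (7, 0, 0) = 1)
          \<and> potential R c w g \<le> potential R c w g" by simp
      qed
      then have "bounds_expectation n f (Cond (RLess (rconst 0) (rvar 11)) (Seq flip_prog update_prog) (nassign 7 (NConst 1)))
          s1 (Suc 1) (potential R c w g) (\<lambda>_. potential R c w g) (\<lambda>t. rep R c w t \<and> fst t (7, 0, 0) = 1)"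
        using no by (intro bounds_expectation_Cond) auto
      then have "bounds_expectation n f round_prog s round_time (potential R c w g) (\<lambda>_. potential R c w g)
          (\<lambda>t. rep R c w t \<and> fst t (7, 0, 0) = 1)"
        by (intro round) (rule bounds_expectation_le, auto)
      then have "bounds_expectation n f (Seq round_prog main_loop) s (Suc (round_time + 1)) (potential R c w g) output_value good_state"
        by (rule bounds_expectation_Seq) (use done_case cons st in auto)
      from unfold[OF this] show ?thesis by (rule bounds_expectation_le) auto
    next
      case yes: True
      define b where "b = fst s1 (6, 0, 0)"
      have bc: "b \<in> candidates R c" and bb: "gain R c b / price w b = snd s1 (11, 0, 0)"
        using sel[OF yes] unfolding b_def by auto
      have bG: "b \<in> G" and bR: "b \<notin> R" using bc by (auto simp: candidates_def)
      let ?c = "advance b c" and ?w = "reweight b w" and ?g = "g(b := f (insert b R) - f R)"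
      let ?Y = "potential (insert b R) ?c ?w ?g" and ?Z = "potential R ?c ?w g"
      have step: "potential R c w g \<le> p * ?Y + (1 - p) * ?Z"
        by (rule potential_step[OF cons room bc]) (use best bb in simp)
      have cons': "consistent R ?c ?w g" by (rule consistent_advance[OF cons bG room])
      have cons'': "consistent (insert b R) ?c ?w ?g" by (rule consistent_insert[OF cons' bG bR])
      have bn: "b < n" using bG G_sub by auto
      have sum_le: "(\<Sum>a<n. c (2 * m + a)) + 1 \<le> (\<Sum>a<n. ?c (2 * m + a))"
      proof -
        have "C b (2 * m + b) \<le> (\<Sum>a<n. C b (2 * m + a))"
          using bn C_nonneg[OF bG] by (intro member_le_sum) auto
        then show ?thesis using C_own[OF bG] by (simp add: advance_def sum.distrib)
      qed
      \<comment> \<open>While the flag is clear each private row has at least one unit of room, so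
        the fuel is at least \<open>n\<close>, and \<open>n\<close> is positive as the item
        \<open>b\<close> exists.\<close>
      have N0: "0 < N"
      proof -
        have "(\<Sum>a<n. c (2 * m + a)) \<le> (\<Sum>a<n. D - 1)" using room by (intro sum_mono) auto
        then have "real n \<le> real n * D - (\<Sum>a<n. c (2 * m + a))" by (simp add: algebra_simps)
        then have "real n \<le> real N" using less.prems(4) by linarith
        then show ?thesis using bn by simp
      qed
      have fuel: "real n * D - (\<Sum>a<n. ?c (2 * m + a)) \<le> real (N - 1)"
        using less.prems(4) sum_le N0 by (simp add: of_nat_diff)
      define P where "P t \<longleftrightarrow> fst t (10, 0, 0) = 1 \<and> rep (insert b R) ?c ?w t \<and> flag_correct (insert b R) ?c t
          \<or> fst t (10, 0, 0) = 0 \<and> rep R ?c ?w t \<and> flag_correct R ?c t" for t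
      let ?X = "\<lambda>t. if fst t (10, 0, 0) = 1 then ?Y else ?Z"
      have upd: "bounds_expectation n f update_prog t (M * 14 + 6) (?X t) ?X P"
        if t: "same_except {9, 10, 11} {} s1 t \<and> fst t (10, 0, 0) \<in> {0, 1}" for t
      proof -
        have ft: "same_except {9, 10, 11} {} s1 t" using t by blast
        have rt: "rep R c w t" by (rule rep_cong[OF rep1 ft]) auto
        have *: "fst t (6, 0, 0) = b" "fst t (7, 0, 0) = 0"
          using same_exceptD(1)[OF ft] flag1 by (auto simp: b_def)
        show ?thesis
          apply (rule bounds_expectation_runs_to)
          apply (rule runs_to_weaken[OF update_prog_spec[OF rt *(1) bG bR refl _ *(2)] order_refl])
          using t by (auto simp: P_def intro: flag_correctI)
      qed
      have "bounds_expectation n f (Seq flip_prog update_prog) s1 (Suc (L * 9 + 5 + (M * 14 + 6))) (p * ?Y + (1 - p) * ?Z) ?X P"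
        by (rule bounds_expectation_Seq[OF flip_prog_spec[OF rep1]]) (rule upd)
      then have "bounds_expectation n f (Cond (RLess (rconst 0) (rvar 11)) (Seq flip_prog update_prog) (nassign 7 (NConst 1)))
          s1 (Suc (Suc (L * 9 + 5 + (M * 14 + 6)))) (p * ?Y + (1 - p) * ?Z) ?X P"
        using yes by (intro bounds_expectation_Cond) auto
      then have "bounds_expectation n f round_prog s round_time (potential R c w g) ?X P"
        using step by (intro round) (rule bounds_expectation_le, auto)
      moreover have "bounds_expectation n f main_loop t ((N - 1 + 1) * (round_time + 2) + 1) (?X t) output_value good_state"
        if t: "P t" for t
      proof (cases "fst t (10, 0, 0) = 1")
        case True
        then have "rep (insert b R) ?c ?w t" "flag_correct (insert b R) ?c t" using t by (auto simp: P_def)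
        then show ?thesis unfolding if_P[OF True] using N0 by (intro less.IH cons'' fuel) auto
      next
        case False
        then have "rep R ?c ?w t" "flag_correct R ?c t" using t by (auto simp: P_def)
        then show ?thesis unfolding if_not_P[OF False] using N0 by (intro less.IH cons' fuel) auto
      qed
      ultimately have "bounds_expectation n f (Seq round_prog main_loop) s
          (Suc (round_time + ((N - 1 + 1) * (round_time + 2) + 1))) (potential R c w g) output_value good_state"
        by (rule bounds_expectation_Seq)
      from unfold[OF this] show ?thesis by (rule bounds_expectation_le) (use N0 in auto)
    qed
  qed
qed

end


section \<open>Initialization\<close>

text \<open>A quotient by capacity 0 has the default value 0, so such an entry is stored as small
  size 0; an item of positive size there is ruled out by the comparison with the capacity.\<close>

definition setup_entry_prog :: com where
  "setup_entry_prog =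
     Seq (Cond (RLess (rconst 0) (RGet 0 vi vj)) (nassign 13 (NAdd (nvar 13) (NConst 1))) Skip)
     (Seq (Cond (RLess (RGet 1 e0 vj) (RGet 0 vi vj)) (NSet 3 e0 vi e0) Skip)
       (Cond (RLess (RDiv (rconst 1) (rconst 2)) (RDiv (RGet 0 vi vj) (RGet 1 e0 vj)))
         (RSet 2 vi vj (rconst 1))
         (RSet 2 vi (NAdd eM vj) (RDiv (RGet 0 vi vj) (RGet 1 e0 vj)))))"

definition setup_item_prog :: com where
  "setup_item_prog =
     Seq (NSet 3 e0 vi (NConst 1)) (Seq (nassign 13 e0) (Seq (for_loop 5 eM setup_entry_prog)
       (Seq (RSet 2 vi (NAdd (NAdd eM eM) vi) (rconst 1))
         (Cond (NLess (nvar 12) (nvar 13)) (nassign 12 (nvar 13)) Skip))))"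

definition double_prog :: com where
  "double_prog = While (RLess (ROfNat (nvar 8))
       (RMul (rconst 200000) (RMul (ROfNat (nvar 12)) (ROfNat (NAdd eRows (NConst 1))))))
     (nassign 8 (NAdd (nvar 8) (nvar 8)))"

text \<open>The floor 10000 for the sparsity \<open>K\<close> keeps
  \<open>p * D / \<delta> = 100 / K\<close> below 1/100 and the pair part of the initial risk,
  \<open>9 / (4 * K)\<close>, below 1/1000. The factor 200000 yields
  \<open>D \<ge> 100000 * (M + 1)\<close>.\<close>

definition setup_prog :: com where
  "setup_prog =
     Seq (nassign 12 (NConst 10000)) (Seq (for_loop 4 eN setup_item_prog)
       (Seq (for_loop 5 eRows (RSet 3 e0 vj (rconst 1))) (Seq (nassign 8 (NConst 1)) (Seq double_prog
         (Seq (rassign 13 (RDiv (ROfNat (nvar 8)) (RMul (rconst 2) (ROfNat (nvar 12)))))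
           (rassign 14 (RDiv (rconst 1) (ROfNat (nvar 8)))))))))"

definition packing_algorithm :: com where
  "packing_algorithm = Seq setup_prog (Seq main_loop output_prog)"

text \<open>Doubling happens only below the threshold \<open>B\<close>, so the bound
  \<open>2 * B\<close> is preserved. The lower bound makes \<open>D\<close> large; the upper one
  keeps \<open>1 / p\<close>, and with it the number of rounds, polynomial.\<close>

lemma double_prog_spec:
  fixes s :: state
  defines "B \<equiv> 200000 * fst s (12, 0, 0) * (2 * fst s (0, 0, 1) + fst s (0, 0, 0) + 1)"
  assumes "fst s (8, 0, 0) = 2 ^ i" "(2 :: nat) ^ i \<le> 2 * B" "B \<le> 2 ^ (i + d)"
  shows "runs_to n f double_prog s (d * 3 + 2) (\<lambda>s'. same_except {8} {} s s' \<and>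
    (\<exists>l. fst s' (8, 0, 0) = 2 ^ l \<and> B \<le> 2 ^ l \<and> 2 ^ l \<le> 2 * B))"
  using assms(2-4) unfolding B_def
proof (induction d arbitrary: s i)
  case (0 s i)
  let ?B = "\<lambda>s. 200000 * fst s (12, 0, 0) * (2 * fst s (0, 0, 1) + fst s (0, 0, 0) + 1)"
  have "real (?B s) \<le> real (2 ^ i)" using 0 by (simp only: of_nat_le_iff add_0_right)
  then have nb: "\<not> bval (RLess (ROfNat (nvar 8))
       (RMul (rconst 200000) (RMul (ROfNat (nvar 12)) (ROfNat (NAdd eRows (NConst 1)))))) s"
    using 0 by (simp add: algebra_simps)
  have "runs_to n f double_prog s (0 + 0 + 2) (\<lambda>s'. same_except {8} {} s s' \<and>
    (\<exists>l. fst s' (8, 0, 0) = 2 ^ l \<and> ?B s \<le> 2 ^ l \<and> 2 ^ l \<le> 2 * ?B s))"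
    unfolding double_prog_def
    by (rule runs_to_While) (use nb 0 same_except_refl in auto)
  then show ?case by simp
next
  case (Suc d s i)
  let ?B = "\<lambda>s. 200000 * fst s (12, 0, 0) * (2 * fst s (0, 0, 1) + fst s (0, 0, 0) + 1)"
  let ?Q = "\<lambda>s s'. same_except {8} {} s s' \<and>
    (\<exists>l. fst s' (8, 0, 0) = 2 ^ l \<and> ?B s \<le> 2 ^ l \<and> 2 ^ l \<le> 2 * ?B s)"
  let ?b = "RLess (ROfNat (nvar 8))
       (RMul (rconst 200000) (RMul (ROfNat (nvar 12)) (ROfNat (NAdd eRows (NConst 1)))))"
  have b_iff: "bval ?b s \<longleftrightarrow> 2 ^ i < ?B s"
  proof -
    have "bval ?b s \<longleftrightarrow> real (2 ^ i) < real (?B s)" using Suc.prems(1) by (simp add: algebra_simps)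
    then show ?thesis by (simp only: of_nat_less_iff)
  qed
  have "runs_to n f double_prog s (1 + (d * 3 + 2) + 2) (?Q s)"
    unfolding double_prog_def
  proof (rule runs_to_While)
    assume "bval ?b s"
    then have lt: "2 ^ i < ?B s" using b_iff by blast
    let ?t = "set_nvar 8 (2 ^ Suc i) s"
    have Bt: "?B ?t = ?B s" by simp
    have "runs_to n f double_prog ?t (d * 3 + 2) (?Q ?t)"
    proof (rule Suc.IH)
      show "fst ?t (8, 0, 0) = 2 ^ Suc i" by simp
      show "2 ^ Suc i \<le> 2 * ?B ?t" using lt unfolding Bt by simp
      show "?B ?t \<le> 2 ^ (Suc i + d)" using Suc.prems(3) unfolding Bt by simp
    qed
    moreover have "?Q s s'" if "?Q ?t s'" for s'
    proof -
      have "same_except {8} {} s ?t" by (simp add: same_except_def)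
      then have "same_except {8} {} s s'" by (rule same_except_trans) (use that in auto)
      then show ?thesis using that unfolding Bt by blast
    qed
    ultimately have *: "runs_to n f double_prog ?t (d * 3 + 2) (?Q s)"
      by (rule runs_to_weaken[OF _ order_refl])
    show "runs_to n f (nassign 8 (NAdd (nvar 8) (nvar 8))) s 1
        (\<lambda>s'. runs_to n f (While ?b (nassign 8 (NAdd (nvar 8) (nvar 8)))) s' (d * 3 + 2) (?Q s))"
      unfolding double_prog_def[symmetric]
      by (rule runs_to_nassign, rule runs_to_state[OF *]) (simp add: Suc.prems(1) mult_2)
  next
    assume "\<not> bval ?b s"
    then show "?Q s s" using b_iff Suc.prems(1,2) same_except_refl by (meson not_less)
  qed
  then show ?case by (rule runs_to_le) simp
qed

section \<open>The normalized instance and its computation\<close>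

context
  fixes n m :: nat and S :: "nat \<Rightarrow> nat \<Rightarrow> real" and c :: "nat \<Rightarrow> real" and f :: "nat set \<Rightarrow> real"
begin

definition coef :: "nat \<Rightarrow> nat \<Rightarrow> real" where
  "coef a r =
     (if r < m then if 1 / 2 < S a r / c r then 1 else 0
      else if r < 2 * m then if 1 / 2 < S a (r - m) / c (r - m) then 0 else S a (r - m) / c (r - m)
      else if r = 2 * m + a then 1 else 0)"

definition fitting :: "nat set" where
  "fitting = {a. a < n \<and> (\<forall>j<m. S a j \<le> c j)}"

definition item_degree :: "nat \<Rightarrow> nat" where
  "item_degree a = card {j. j < m \<and> 0 < S a j}"

definition holds_input :: "state \<Rightarrow> bool" where
  "holds_input s \<longleftrightarrow> fst s (0, 0, 0) = n \<and> fst s (0, 0, 1) = m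
    \<and> (\<forall>a<n. \<forall>j<m. snd s (0, a, j) = S a j) \<and> (\<forall>j<m. snd s (1, 0, j) = c j)"

lemma holds_input_cong:
  assumes "holds_input s" "same_except X Y s s'" "0 \<notin> X" "0 \<notin> Y" "1 \<notin> Y"
  shows "holds_input s'"
  using assms same_exceptD[OF assms(2)] unfolding holds_input_def by simp

lemma setup_item_prog_spec:
  assumes inp: "holds_input s" and i: "fst s (4, 0, 0) = a" "a < n" and zero: "\<And>r. snd s (2, a, r) = 0"
  shows "runs_to n f setup_item_prog s (m * 14 + 14) (\<lambda>s'. same_except {3, 5, 12, 13} {2} s s'
    \<and> (\<forall>b. fst s' (3, 0, b) = (if b = a then if a \<in> fitting then 1 else 0 else fst s (3, 0, b)))
    \<and> (\<forall>b r. snd s' (2, b, r) = (if b = a then coef a r else snd s (2, b, r)))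
    \<and> fst s' (12, 0, 0) = max (fst s (12, 0, 0)) (item_degree a))"
proof -
  define s1 where "s1 = set_nvar 13 0 ((fst s)((3, 0, a) := 1), snd s)"
  \<comment> \<open>An iteration writes one of the two coefficients of a constraint; the other one
    is right because the array starts out zero.\<close>
  define I where "I j s' \<longleftrightarrow> same_except {3, 5, 13} {2} s s'
    \<and> (\<forall>b. fst s' (3, 0, b) = (if b = a then if \<forall>l<j. S a l \<le> c l then 1 else 0 else fst s (3, 0, b)))
    \<and> (\<forall>b r. snd s' (2, b, r)
        = (if b = a then if r < j \<or> m \<le> r \<and> r < m + j then coef a r else 0 else snd s (2, b, r)))
    \<and> fst s' (13, 0, 0) = card {l. l < j \<and> 0 < S a l}" for j s'
  have loop: "runs_to n f (for_loop 5 eM setup_entry_prog) s1 (m * (9 + 4) + 4) (I m)"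
  proof (rule runs_to_for_loop[where I = I])
    show "I 0 (set_nvar 5 0 s1)"
      using zero by (auto simp: I_def s1_def same_except_def)
    fix j t assume t: "I j t"
    have fr: "same_except {3, 5, 13} {2} s t" using t by (simp add: I_def)
    have it: "holds_input t" by (rule holds_input_cong[OF inp fr]) auto
    have cn: "fst t (0, 0, 0) = n" "fst t (0, 0, Suc 0) = m" using it by (simp_all add: holds_input_def)
    show "nval eM t = m" using cn by simp
    assume j: "j < m" and tj: "fst t (5, 0, 0) = j"
    have ti: "fst t (4, 0, 0) = a" using same_exceptD(1)[OF fr] i by simp
    have Sc: "snd t (0, a, j) = S a j" "snd t (1, 0, j) = c j" using it i(2) j by (auto simp: holds_input_def)
    define N where "N = (fst t)((13, 0, 0) := card {l. l < Suc j \<and> 0 < S a l},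
      (3, 0, a) := (if \<forall>l<Suc j. S a l \<le> c l then 1 else 0))"
    have setj: "{l. l < Suc j \<and> 0 < S a l} = (if 0 < S a j then insert j {l. l < j \<and> 0 < S a l} else {l. l < j \<and> 0 < S a l})"
      by (auto simp: less_Suc_eq)
    have card: "card {l. l < Suc j \<and> 0 < S a l} = fst t (13, 0, 0) + (if 0 < S a j then 1 else 0)"
      using t unfolding setj I_def by simp
    have fit: "fst t (3, 0, a) = (if \<forall>l<j. S a l \<le> c l then 1 else 0)" using t by (simp add: I_def)
    have fitS: "(\<forall>l<Suc j. S a l \<le> c l) \<longleftrightarrow> (\<forall>l<j. S a l \<le> c l) \<and> S a j \<le> c j" by (auto simp: less_Suc_eq)
    let ?P = "\<lambda>s'. fst s' (5, 0, 0) = j \<and> I (Suc j) (set_nvar 5 (Suc j) s')"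
    have Nfr: "same_except {3, 5, 13} {2} s (set_nvar 5 (Suc j) (N, (snd t)((2, a, r) := x)))" for r x
      using fr by (auto simp: same_except_def N_def)
    have last: "runs_to n f (Cond (RLess (RDiv (rconst 1) (rconst 2)) (RDiv (RGet 0 vi vj) (RGet 1 e0 vj)))
         (RSet 2 vi vj (rconst 1))
         (RSet 2 vi (NAdd eM vj) (RDiv (RGet 0 vi vj) (RGet 1 e0 vj)))) (N, snd t) (Suc (max 1 1)) ?P"
    proof (rule runs_to_Cond)
      have vals: "nval vi (N, snd t) = a" "nval vj (N, snd t) = j" "nval eM (N, snd t) = m"
        "snd t (0, a, j) = S a j" "snd t (1, 0, j) = c j" using ti tj cn Sc by (simp_all add: N_def)
      have new: "?P (N, (snd t)((2, a, r) := x))"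
        if "\<And>q. q < Suc j \<or> m \<le> q \<and> q < m + Suc j \<Longrightarrow>
           (if q = r then x else if q < j \<or> m \<le> q \<and> q < m + j then coef a q else 0) = coef a q"
          "r = j \<or> r = m + j" for r x
      proof -
        have "((snd t)((2, a, r) := x)) (2, b, q)
          = (if b = a then if q < Suc j \<or> m \<le> q \<and> q < m + Suc j then coef a q else 0 else snd s (2, b, q))" for b q
        proof (cases "b = a")
          case True
          show ?thesis
          proof (cases "q < Suc j \<or> m \<le> q \<and> q < m + Suc j")
            case in_range: True
            have "((snd t)((2, a, r) := x)) (2, b, q)
              = (if q = r then x else if q < j \<or> m \<le> q \<and> q < m + j then coef a q else 0)"
              using t True unfolding I_def by simp
            then show ?thesis using that(1)[OF in_range] in_range True by simp
          next
            case False
            then have "q \<noteq> r" "\<not> (q < j \<or> m \<le> q \<and> q < m + j)" using that(2) by auto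
            then show ?thesis using t True unfolding I_def if_not_P[OF False] by auto
          qed
        next
          case False
          then show ?thesis using t unfolding I_def by simp
        qed
        moreover have "N (3, 0, b) = (if b = a then if \<forall>l<Suc j. S a l \<le> c l then 1 else 0 else fst s (3, 0, b))" for b
          using t unfolding I_def N_def by simp
        ultimately show ?thesis using Nfr tj unfolding I_def by (simp add: N_def)
      qed
      show "runs_to n f (RSet 2 vi vj (rconst 1)) (N, snd t) 1 ?P"
        if "bval (RLess (RDiv (rconst 1) (rconst 2)) (RDiv (RGet 0 vi vj) (RGet 1 e0 vj))) (N, snd t)"
      proof (rule runs_to_RSet)
        have big: "1 / 2 < S a j / c j" using that vals by simp
        have "?P (N, (snd t)((2, a, j) := 1))"
          by (rule new) (use big j in \<open>auto simp: coef_def less_Suc_eq\<close>)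
        then show "?P (fst (N, snd t), (snd (N, snd t))((2, nval vi (N, snd t), nval vj (N, snd t)) := rval (rconst 1) (N, snd t)))"
          unfolding vals by simp
      qed
      show "runs_to n f (RSet 2 vi (NAdd eM vj) (RDiv (RGet 0 vi vj) (RGet 1 e0 vj))) (N, snd t) 1 ?P"
        if "\<not> bval (RLess (RDiv (rconst 1) (rconst 2)) (RDiv (RGet 0 vi vj) (RGet 1 e0 vj))) (N, snd t)"
      proof (rule runs_to_RSet)
        have small: "\<not> 1 / 2 < S a j / c j" using that vals by simp
        have "?P (N, (snd t)((2, a, m + j) := S a j / c j))"
          by (rule new) (use small j in \<open>auto simp: coef_def less_Suc_eq\<close>)
        then show "?P (fst (N, snd t), (snd (N, snd t))((2, nval vi (N, snd t), nval (NAdd eM vj) (N, snd t))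
            := rval (RDiv (RGet 0 vi vj) (RGet 1 e0 vj)) (N, snd t)))"
          using vals by (simp only: nval.simps rval.simps fst_conv snd_conv)
      qed
    qed
    show "runs_to n f setup_entry_prog t 9 ?P"
      unfolding setup_entry_prog_def
      apply (rule runs_to_le)
       apply (rule runs_to_Seq, rule runs_to_Cond)
        apply (rule runs_to_nassign, rule runs_to_Seq, rule runs_to_Cond)
         apply (rule runs_to_NSet, rule runs_to_state[OF last])
      subgoal using ti tj Sc card fit fitS by (auto simp: N_def set_nvar_def)
        apply (rule runs_to_Skip, rule runs_to_state[OF last])
      subgoal using ti tj Sc card fit fitS by (auto simp: N_def set_nvar_def fun_eq_iff)
       apply (rule runs_to_Skip, rule runs_to_Seq, rule runs_to_Cond)
        apply (rule runs_to_NSet, rule runs_to_state[OF last])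
      subgoal using ti tj Sc card fit fitS by (auto simp: N_def set_nvar_def fun_eq_iff)
       apply (rule runs_to_Skip, rule runs_to_state[OF last])
      subgoal using ti tj Sc card fit fitS by (auto simp: N_def set_nvar_def fun_eq_iff prod_eq_iff)
      apply simp
      done
  qed
  let ?Q = "\<lambda>s'. same_except {3, 5, 12, 13} {2} s s'
    \<and> (\<forall>b. fst s' (3, 0, b) = (if b = a then if a \<in> fitting then 1 else 0 else fst s (3, 0, b)))
    \<and> (\<forall>b r. snd s' (2, b, r) = (if b = a then coef a r else snd s (2, b, r)))
    \<and> fst s' (12, 0, 0) = max (fst s (12, 0, 0)) (item_degree a)"
  have rest: "runs_to n f (Seq (RSet 2 vi (NAdd (NAdd eM eM) vi) (rconst 1))
         (Cond (NLess (nvar 12) (nvar 13)) (nassign 12 (nvar 13)) Skip)) t 4 ?Q" if t: "I m t" for t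
  proof -
    have fr: "same_except {3, 5, 13} {2} s t" using t by (simp add: I_def)
    have it: "holds_input t" by (rule holds_input_cong[OF inp fr]) auto
    have cn: "fst t (0, 0, Suc 0) = m" "fst t (4, 0, 0) = a" "fst t (12, 0, 0) = fst s (12, 0, 0)"
      using it i same_exceptD(1)[OF fr] by (simp_all add: holds_input_def)
    have deg: "fst t (13, 0, 0) = item_degree a" using t by (simp add: I_def item_degree_def)
    have fit: "fst t (3, 0, b) = (if b = a then if a \<in> fitting then 1 else 0 else fst s (3, 0, b))" for b
      using t i(2) by (simp add: I_def fitting_def)
    have new: "((snd t)((2, a, 2 * m + a) := 1)) (2, b, r) = (if b = a then coef a r else snd s (2, b, r))" for b r
      using t by (auto simp: I_def coef_def)
    define u where "u = (fst t, (snd t)((2, a, 2 * m + a) := 1))"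
    have fru: "same_except {3, 5, 12, 13} {2} s u" "same_except {3, 5, 12, 13} {2} s (set_nvar 12 x u)" for x
      using fr by (auto simp: same_except_def u_def)
    have fu: "fst u = fst t" "\<And>b r. snd u (2, b, r) = (if b = a then coef a r else snd s (2, b, r))"
      using new by (simp_all add: u_def)
    have last: "runs_to n f (Cond (NLess (nvar 12) (nvar 13)) (nassign 12 (nvar 13)) Skip) u (Suc (max 1 0)) ?Q"
      apply (rule runs_to_Cond)
       apply (rule runs_to_nassign)
      subgoal using fru fu fit deg cn by simp
      apply (rule runs_to_Skip)
      subgoal using fru fu fit deg cn by simp
      done
    show ?thesis
      apply (rule runs_to_le)
       apply (rule runs_to_Seq, rule runs_to_RSet, rule runs_to_state[OF last])
       apply (simp add: u_def cn mult_2)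
      apply simp
      done
  qed
  have main: "runs_to n f (Seq (for_loop 5 eM setup_entry_prog)
       (Seq (RSet 2 vi (NAdd (NAdd eM eM) vi) (rconst 1))
         (Cond (NLess (nvar 12) (nvar 13)) (nassign 12 (nvar 13)) Skip))) s1 (Suc (m * (9 + 4) + 4 + 4)) ?Q"
    by (rule runs_to_Seq, rule runs_to_weaken[OF loop order_refl], rule rest)
  show ?thesis unfolding setup_item_prog_def
    apply (rule runs_to_le)
     apply (rule runs_to_Seq, rule runs_to_NSet, rule runs_to_Seq, rule runs_to_nassign, rule runs_to_state[OF main])
     apply (simp add: s1_def i)
    apply simp
    done
qed

definition ready :: "nat \<Rightarrow> nat \<Rightarrow> state \<Rightarrow> bool" where
  "ready K L s \<longleftrightarrow> 10000 \<le> K \<and> (K = 10000 \<or> (\<exists>a<n. K = item_degree a)) \<and> (\<forall>a<n. item_degree a \<le> K)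
    \<and> 200000 * K * (2 * m + n + 1) \<le> 2 ^ L \<and> 2 ^ L \<le> 2 * (200000 * K * (2 * m + n + 1))
    \<and> fst s (0, 0, 0) = n \<and> fst s (0, 0, 1) = m \<and> fst s (8, 0, 0) = 2 ^ L \<and> fst s (7, 0, 0) = 0
    \<and> snd s (13, 0, 0) = 2 ^ L / (2 * real K) \<and> snd s (14, 0, 0) = 1 / 2 ^ L
    \<and> (\<forall>a<n. fst s (2, 0, a) = 0 \<and> fst s (3, 0, a) = (if a \<in> fitting then 1 else 0) \<and> (\<forall>r. snd s (2, a, r) = coef a r))
    \<and> (\<forall>r<2 * m + n. snd s (3, 0, r) = 1 \<and> snd s (4, 0, r) = 0 \<and> snd s (5, 0, r) = 0 \<and> snd s (6, 0, r) = 0)"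

lemma setup_prog_spec:
  "runs_to n f setup_prog (init_state n m S c)
     (n * (m * 14 + 18) + (2 * m + n) * 5 + (10000 + m) * (2 * m + n + 1) * 600000 + 30) (\<lambda>s'. \<exists>K L. ready K L s')"
proof -
  define s0 where "s0 = init_state n m S c"
  have inp0: "holds_input s0" by (auto simp: holds_input_def s0_def init_state_def)
  have zn: "fst s0 (x, i, j) = 0" if "x \<noteq> 0" for x i j using that by (simp add: s0_def init_state_def)
  have zr: "snd s0 (x, i, j) = 0" if "x \<noteq> 0" "x \<noteq> 1" for x i j using that by (simp add: s0_def init_state_def)
  define I where "I i s \<longleftrightarrow> same_except {3, 4, 5, 12, 13} {2} s0 s
     \<and> (\<forall>b<i. fst s (3, 0, b) = (if b \<in> fitting then 1 else 0))
     \<and> (\<forall>b r. snd s (2, b, r) = (if b < i then coef b r else 0))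
     \<and> 10000 \<le> fst s (12, 0, 0) \<and> (fst s (12, 0, 0) = 10000 \<or> (\<exists>a<i. fst s (12, 0, 0) = item_degree a))
     \<and> (\<forall>b<i. item_degree b \<le> fst s (12, 0, 0))" for i s
  have items: "runs_to n f (for_loop 4 eN setup_item_prog) (set_nvar 12 10000 s0) (n * (m * 14 + 14 + 4) + 4) (I n)"
  proof (rule runs_to_for_loop[where I = I])
    show "I 0 (set_nvar 4 0 (set_nvar 12 10000 s0))" by (auto simp: I_def same_except_def zr)
    fix a t assume t: "I a t"
    have fr: "same_except {3, 4, 5, 12, 13} {2} s0 t" using t by (simp add: I_def)
    have it: "holds_input t" by (rule holds_input_cong[OF inp0 fr]) auto
    show "nval eN t = n" using it by (simp add: holds_input_def)
    assume a: "a < n" and ta: "fst t (4, 0, 0) = a"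
    have zero: "snd t (2, a, r) = 0" for r using t by (simp add: I_def)
    show "runs_to n f setup_item_prog t (m * 14 + 14) (\<lambda>s'. fst s' (4, 0, 0) = a \<and> I (Suc a) (set_nvar 4 (Suc a) s'))"
    proof (rule runs_to_weaken[OF setup_item_prog_spec[OF it ta a zero] order_refl])
      fix t' assume q: "same_except {3, 5, 12, 13} {2} t t'
        \<and> (\<forall>b. fst t' (3, 0, b) = (if b = a then if a \<in> fitting then 1 else 0 else fst t (3, 0, b)))
        \<and> (\<forall>b r. snd t' (2, b, r) = (if b = a then coef a r else snd t (2, b, r)))
        \<and> fst t' (12, 0, 0) = max (fst t (12, 0, 0)) (item_degree a)"
      have "same_except {3, 4, 5, 12, 13} {2} s0 t'" by (rule same_except_trans[OF fr conjunct1[OF q]]) auto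
      then have fr': "same_except {3, 4, 5, 12, 13} {2} s0 (set_nvar 4 (Suc a) t')" by (auto simp: same_except_def)
      have i': "fst t' (4, 0, 0) = a" using same_exceptD(1)[OF conjunct1[OF q]] ta by simp
      have K: "10000 \<le> fst t (12, 0, 0)" "fst t (12, 0, 0) = 10000 \<or> (\<exists>b<a. fst t (12, 0, 0) = item_degree b)"
        "\<forall>b<a. item_degree b \<le> fst t (12, 0, 0)" using t by (auto simp: I_def)
      have K': "10000 \<le> fst t' (12, 0, 0)"
        "fst t' (12, 0, 0) = 10000 \<or> (\<exists>b<Suc a. fst t' (12, 0, 0) = item_degree b)"
        "\<forall>b<Suc a. item_degree b \<le> fst t' (12, 0, 0)"
        using K q by (auto simp: less_Suc_eq max_def)
      have "\<forall>b<Suc a. fst t' (3, 0, b) = (if b \<in> fitting then 1 else 0)"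
        "\<forall>b r. snd t' (2, b, r) = (if b < Suc a then coef b r else 0)"
        using q t unfolding I_def by (auto simp: less_Suc_eq)
      then show "fst t' (4, 0, 0) = a \<and> I (Suc a) (set_nvar 4 (Suc a) t')"
        using fr' i' K' unfolding I_def by simp
    qed
  qed
  define J where "J s \<longleftrightarrow> (\<exists>t. I n t \<and> same_except {5} {3} t s) \<and> (\<forall>r<2 * m + n. snd s (3, 0, r) = 1)" for s
  have weights: "runs_to n f (for_loop 5 eRows (RSet 3 e0 vj (rconst 1))) t ((2 * m + n) * (1 + 4) + 4) J" if t: "I n t" for t
  proof -
    define W where "W j s \<longleftrightarrow> same_except {5} {3} t s \<and> (\<forall>r<j. snd s (3, 0, r) = 1)" for j s
    have "same_except {3, 4, 5, 12, 13} {2} s0 t" using t by (simp add: I_def)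
    then have it: "holds_input t" by (rule holds_input_cong[OF inp0]) auto
    have "runs_to n f (for_loop 5 eRows (RSet 3 e0 vj (rconst 1))) t ((2 * m + n) * (1 + 4) + 4) (W (2 * m + n))"
    proof (rule runs_to_for_loop[where I = W])
      show "W 0 (set_nvar 5 0 t)" by (simp add: W_def same_except_def)
      fix j u assume u: "W j u"
      have fr: "same_except {5} {3} t u" using u by (simp add: W_def)
      have "holds_input u" by (rule holds_input_cong[OF it fr]) auto
      then show "nval eRows u = 2 * m + n" by (simp add: holds_input_def)
      assume "fst u (5, 0, 0) = j"
      moreover have "same_except {5} {3} t (set_nvar 5 (Suc j) (fst u, (snd u)((3, 0, j) := 1)))"
        using fr by (auto simp: same_except_def)
      ultimately show "runs_to n f (RSet 3 e0 vj (rconst 1)) u 1 (\<lambda>s'. fst s' (5, 0, 0) = j \<and> W (Suc j) (set_nvar 5 (Suc j) s'))"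
        using u by (intro runs_to_RSet) (auto simp: W_def less_Suc_eq)
    qed
    then show ?thesis
      by (rule runs_to_weaken[OF _ order_refl]) (unfold J_def W_def, use t in blast)
  qed
  have degree_le: "item_degree a \<le> m" for a
    using card_mono[of "{..<m}" "{j. j < m \<and> 0 < S a j}"] by (auto simp: item_degree_def)
  \<comment> \<open>Instead of a logarithm, the threshold bound itself limits the number of
    doublings, since \<open>d \<le> 2 ^ d\<close>; this is still polynomial.\<close>
  define d where "d = (10000 + m) * (2 * m + n + 1) * 200000"
  have final: "runs_to n f (Seq (nassign 8 (NConst 1)) (Seq double_prog
         (Seq (rassign 13 (RDiv (ROfNat (nvar 8)) (RMul (rconst 2) (ROfNat (nvar 12)))))
           (rassign 14 (RDiv (rconst 1) (ROfNat (nvar 8))))))) t (d * 3 + 8) (\<lambda>s'. \<exists>K L. ready K L s')"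
    if t: "J t" for t
  proof -
    obtain u where u: "I n u" "same_except {5} {3} u t" using t unfolding J_def by blast
    have fru: "same_except {3, 4, 5, 12, 13} {2} s0 u" using u(1) by (simp add: I_def)
    have frt: "same_except {3, 4, 5, 12, 13} {2, 3} s0 t" by (rule same_except_trans[OF fru u(2)]) auto
    have inp: "holds_input t" by (rule holds_input_cong[OF inp0 frt]) auto
    define K where "K = fst t (12, 0, 0)"
    have Ku: "K = fst u (12, 0, 0)" using same_exceptD(1)[OF u(2)] by (simp add: K_def)
    have K: "10000 \<le> K" "K = 10000 \<or> (\<exists>a<n. K = item_degree a)" "\<forall>a<n. item_degree a \<le> K"
      using u(1) unfolding I_def Ku by auto
    have Km: "K \<le> 10000 + m" using K(2) degree_le by (auto intro: trans_le_add2)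
    let ?t = "set_nvar 8 1 t"
    let ?B = "200000 * fst ?t (12, 0, 0) * (2 * fst ?t (0, 0, 1) + fst ?t (0, 0, 0) + 1)"
    have B: "?B = 200000 * K * (2 * m + n + 1)" using inp by (simp add: K_def holds_input_def)
    have Bd: "200000 * K * (2 * m + n + 1) \<le> d"
      unfolding d_def using mult_le_mono1[OF Km, of "2 * m + n + 1"] by simp
    have "d \<le> 2 ^ d" by (rule less_imp_le[OF less_exp])
    with Bd have Bexp: "?B \<le> 2 ^ (0 + d)" unfolding B add_0 by (rule le_trans)
    have B1: "2 ^ 0 \<le> 2 * ?B" unfolding B using K(1) by simp
    have dbl: "runs_to n f double_prog ?t (d * 3 + 2) (\<lambda>s'. same_except {8} {} ?t s' \<and>
      (\<exists>l. fst s' (8, 0, 0) = 2 ^ l \<and> ?B \<le> 2 ^ l \<and> 2 ^ l \<le> 2 * ?B))"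
      by (rule double_prog_spec[OF _ B1 Bexp]) simp
    have fin: "runs_to n f (Seq (rassign 13 (RDiv (ROfNat (nvar 8)) (RMul (rconst 2) (ROfNat (nvar 12)))))
           (rassign 14 (RDiv (rconst 1) (ROfNat (nvar 8))))) v (Suc (1 + 1)) (\<lambda>s'. \<exists>K L. ready K L s')"
      if v: "same_except {8} {} ?t v \<and> (\<exists>l. fst v (8, 0, 0) = 2 ^ l \<and> ?B \<le> 2 ^ l \<and> 2 ^ l \<le> 2 * ?B)" for v
    proof -
      obtain l where l: "fst v (8, 0, 0) = 2 ^ l" "200000 * K * (2 * m + n + 1) \<le> 2 ^ l"
        "2 ^ l \<le> 2 * (200000 * K * (2 * m + n + 1))" using v unfolding B by blast
      have frv: "same_except {8} {} t v" using v by (auto simp: same_except_def)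
      let ?w = "set_rvar 14 (1 / 2 ^ l) (set_rvar 13 (2 ^ l / (2 * real K)) v)"
      have frw: "same_except {8} {13, 14} t ?w" using frv by (auto simp: same_except_def)
      have fr0: "same_except {3, 4, 5, 8, 12, 13} {2, 3, 13, 14} s0 ?w" by (rule same_except_trans[OF frt frw]) auto
      have "ready K l ?w"
        unfolding ready_def
      proof (intro conjI allI impI K(1,2) l)
        show "item_degree a \<le> K" if "a < n" for a using K(3) that by blast
        show "fst ?w (0, 0, 0) = n" "fst ?w (0, 0, 1) = m"
          using inp same_exceptD(1)[OF frw] by (simp_all add: holds_input_def)
        show "fst ?w (8, 0, 0) = 2 ^ l" using l by simp
        show "fst ?w (7, 0, 0) = 0" using same_exceptD(1)[OF fr0] zn by simp
        show "snd ?w (13, 0, 0) = 2 ^ l / (2 * real K)" "snd ?w (14, 0, 0) = 1 / 2 ^ l" by simp_all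
        show "fst ?w (2, 0, a) = 0" for a using same_exceptD(1)[OF fr0] zn by simp
        show "fst ?w (3, 0, a) = (if a \<in> fitting then 1 else 0)" if "a < n" for a
          using same_exceptD(1)[OF frw] same_exceptD(1)[OF u(2)] u(1) that by (simp add: I_def)
        show "snd ?w (2, a, r) = coef a r" if "a < n" for a r
          using same_exceptD(2)[OF frw] same_exceptD(2)[OF u(2)] u(1) that by (simp add: I_def)
        show "snd ?w (3, 0, r) = 1" if "r < 2 * m + n" for r
          using same_exceptD(2)[OF frw] t that by (simp add: J_def)
        show "snd ?w (4, 0, r) = 0" "snd ?w (5, 0, r) = 0" "snd ?w (6, 0, r) = 0" for r
          using same_exceptD(2)[OF fr0] zr by simp_all
      qed
      moreover have "fst v (12, 0, 0) = K" using same_exceptD(1)[OF frv] by (simp add: K_def)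
      ultimately show ?thesis
        by (intro runs_to_Seq runs_to_rassign) (auto simp: l(1))
    qed
    have "runs_to n f (Seq double_prog (Seq (rassign 13 (RDiv (ROfNat (nvar 8)) (RMul (rconst 2) (ROfNat (nvar 12)))))
           (rassign 14 (RDiv (rconst 1) (ROfNat (nvar 8)))))) ?t (Suc (d * 3 + 2 + Suc (1 + 1))) (\<lambda>s'. \<exists>K L. ready K L s')"
      by (rule runs_to_Seq, rule runs_to_weaken[OF dbl order_refl], rule fin)
    note * = this
    show ?thesis
      by (rule runs_to_le, rule runs_to_Seq, rule runs_to_nassign, rule runs_to_state[OF *]) simp_all
  qed
  have tail: "runs_to n f (Seq (for_loop 5 eRows (RSet 3 e0 vj (rconst 1))) (Seq (nassign 8 (NConst 1)) (Seq double_prog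
         (Seq (rassign 13 (RDiv (ROfNat (nvar 8)) (RMul (rconst 2) (ROfNat (nvar 12)))))
           (rassign 14 (RDiv (rconst 1) (ROfNat (nvar 8)))))))) t (Suc ((2 * m + n) * (1 + 4) + 4 + (d * 3 + 8)))
      (\<lambda>s'. \<exists>K L. ready K L s')" if "I n t" for t
    by (rule runs_to_Seq, rule runs_to_weaken[OF weights[OF that] order_refl], rule final)
  have body: "runs_to n f (Seq (for_loop 4 eN setup_item_prog) (Seq (for_loop 5 eRows (RSet 3 e0 vj (rconst 1)))
      (Seq (nassign 8 (NConst 1)) (Seq double_prog
         (Seq (rassign 13 (RDiv (ROfNat (nvar 8)) (RMul (rconst 2) (ROfNat (nvar 12)))))
           (rassign 14 (RDiv (rconst 1) (ROfNat (nvar 8))))))))) (set_nvar 12 10000 s0)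
      (Suc (n * (m * 14 + 14 + 4) + 4 + Suc ((2 * m + n) * (1 + 4) + 4 + (d * 3 + 8)))) (\<lambda>s'. \<exists>K L. ready K L s')"
    by (rule runs_to_Seq, rule runs_to_weaken[OF items order_refl], rule tail)
  show ?thesis
    unfolding setup_prog_def s0_def[symmetric]
    by (rule runs_to_le, rule runs_to_Seq, rule runs_to_nassign, rule runs_to_state[OF body])
      (simp_all add: d_def algebra_simps)
qed

lemma packing_program_input:
  assumes data: "nonneg_data n m S c" and mono: "monotone_set_fun {..<n} f" and sub: "submodular {..<n} f"
    and A: "feasible n m S c A" and K: "0 < K" "200000 * K * (2 * m + n + 1) \<le> 2 ^ L"
  shows "packing_program n m coef fitting A f (1 / 2 ^ L) (2 ^ L / (2 * real K)) L"
proof -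
  have Sn: "0 \<le> S a j" and cn: "0 \<le> c j" if "a < n" "j < m" for a j
    using data that by (auto simp: nonneg_data_def)
  have An: "A \<subseteq> {..<n}" and Ac: "\<And>j. j < m \<Longrightarrow> (\<Sum>i\<in>A. S i j) \<le> c j" using A by (auto simp: feasible_def)
  have finA: "finite A" using An finite_subset by blast
  have u0: "0 \<le> S a j / c j" if "a < n" "j < m" for a j using Sn[OF that] cn[OF that] by simp
  have u1: "S a j / c j \<le> 1" if "a \<in> fitting" "j < m" for a j
    using that cn[of a j] by (cases "c j = 0") (auto simp: fitting_def divide_le_eq_1)
  have sumA: "(\<Sum>i\<in>A. S i j / c j) \<le> 1" if "j < m" for j
  proof (cases "c j = 0")
    case False
    moreover have "0 \<le> c j" using data that by (simp add: nonneg_data_def)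
    ultimately have "(\<Sum>i\<in>A. S i j) / c j \<le> 1" using Ac[OF that] by (simp add: divide_le_eq_1)
    then show ?thesis by (simp add: sum_divide_distrib)
  qed simp
  have Afit: "A \<subseteq> fitting"
  proof
    fix a assume a: "a \<in> A"
    have "S a j \<le> c j" if j: "j < m" for j
    proof -
      have "S a j \<le> (\<Sum>i\<in>A. S i j)" using a finA An Sn j by (intro member_le_sum) auto
      then show ?thesis using Ac[OF j] by simp
    qed
    then show "a \<in> fitting" using a An by (auto simp: fitting_def)
  qed
  have "2 * K \<le> 200000 * K * (2 * m + n + 1)" by simp
  then have "real (2 * K) \<le> real (2 ^ L)" using K(2) le_trans by (simp only: of_nat_le_iff)
  then have D1: "2 * real K \<le> 2 ^ L" by simp
  show ?thesis
  proof unfold_locales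
    show "fitting \<subseteq> {..<n}" by (auto simp: fitting_def)
    fix a r assume a: "a \<in> fitting"
    then have an: "a < n" by (simp add: fitting_def)
    show "0 \<le> coef a r"
      using u0[OF an, of "r - m"] by (auto simp: coef_def)
    show "coef a r \<le> 1"
      using u1[OF a, of "r - m"] by (auto simp: coef_def)
  next
    show "coef a (2 * m + a) = 1" for a by (simp add: coef_def)
    show "A \<subseteq> fitting" by (rule Afit)
    fix r assume r: "r < 2 * m + n"
    consider "r < m" | "m \<le> r" "r < 2 * m" | "2 * m \<le> r" by linarith
    then show "(\<Sum>e\<in>A. coef e r) \<le> 1"
    proof cases
      case 1
      let ?B = "{e \<in> A. 1 / 2 < S e r / c r}"
      have "(\<Sum>e\<in>A. coef e r) = (\<Sum>e\<in>A. if 1 / 2 < S e r / c r then 1 else 0)"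
        using 1 by (simp add: coef_def)
      also have "\<dots> = real (card ?B)" using finA by (simp add: sum.If_cases Int_def)
      finally have eq: "(\<Sum>e\<in>A. coef e r) = real (card ?B)" .
      show ?thesis
      proof (cases "?B = {}")
        case False
        \<comment> \<open>The count of big items is an integer below 2.\<close>
        have "(\<Sum>e\<in>?B. 1 / 2) < (\<Sum>e\<in>?B. S e r / c r)" using finA False by (intro sum_strict_mono) auto
        also have "\<dots> \<le> (\<Sum>e\<in>A. S e r / c r)" using finA u0 An 1 by (intro sum_mono2) auto
        also have "\<dots> \<le> 1" by (rule sumA[OF 1])
        finally have "real (card ?B) < 2" by simp
        then show ?thesis unfolding eq by simp
      next
        case True
        then show ?thesis unfolding eq by (simp only: card.empty of_nat_0)
      qed
    next
      case 2
      then have j: "r - m < m" by simp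
      have "(\<Sum>e\<in>A. coef e r) \<le> (\<Sum>e\<in>A. S e (r - m) / c (r - m))"
        using 2 u0 An j by (intro sum_mono) (auto simp: coef_def)
      also have "\<dots> \<le> 1" by (rule sumA[OF j])
      finally show ?thesis .
    next
      case 3
      then have "(\<Sum>e\<in>A. coef e r) = (\<Sum>e\<in>A. if e = r - 2 * m then 1 else 0)"
        by (intro sum.cong) (auto simp: coef_def)
      also have "\<dots> \<le> 1" using finA by simp
      finally show ?thesis .
    qed
  next
    show "monotone_set_fun {..<n} f" "submodular {..<n} f" by fact+
    show "(0 :: real) < 1 / 2 ^ L" "1 / 2 ^ L \<le> (1 :: real)" by simp_all
    show "1 \<le> 2 ^ L / (2 * real K)" using D1 K(1) by simp
  qed simp_all
qed

text \<open>Per unit of \<open>D\<close>, the income is at least 0.981 after the losses from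
  \<open>\<epsilon>\<close>, \<open>\<delta>\<close> and \<open>ln M\<close>, and the initial debt
  is at most \<open>1 / 2 + 9 / (4 * K) \<le> 0.501\<close>. The difference 0.48, multiplied by
  \<open>p * D = 1 / (2 * K)\<close>, gives \<open>6 / 25 / K\<close>.\<close>

lemma initial_potential_ge:
  fixes K D p F :: real and M :: nat
  assumes K: "10000 \<le> K" and D: "100000 * (real M + 1) \<le> D" and pD: "p * D = 1 / (2 * K)" and F: "0 \<le> F"
    and p: "0 < p"
  shows "F * (6 / 25) / K \<le> p * F * ((1 - 1 / 200) * ((D - 1) * (1 - 1 / 100) - ln (real M) / (1 / 100))
    - D * (K * (p * D + 9 * (p * D)\<^sup>2)))"
proof -
  have D0: "100000 \<le> D" using D by (rule order_trans[rotated]) simp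
  have "ln (real M) \<le> real M" by (cases "M = 0") (auto intro: less_imp_le ln_less_self)
  then have lnM: "ln (real M) \<le> D / 100000" using D by simp
  have "K * (p * D + 9 * (p * D)\<^sup>2) = 1 / 2 + 9 / (4 * K)"
    unfolding pD using K by (simp add: field_simps power2_eq_square)
  also have "\<dots> \<le> 501 / 1000" using K by (simp add: field_simps)
  finally have "D * (K * (p * D + 9 * (p * D)\<^sup>2)) \<le> D * (501 / 1000)" using D0 by (intro mult_left_mono) auto
  moreover have "D * (981 / 1000) \<le> (1 - 1 / 200) * ((D - 1) * (1 - 1 / 100) - ln (real M) / (1 / 100))"
    using lnM D0 by (simp add: field_simps)
  ultimately have "D * (981 / 1000) - D * (501 / 1000) \<le> (1 - 1 / 200) * ((D - 1) * (1 - 1 / 100) - ln (real M) / (1 / 100))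
    - D * (K * (p * D + 9 * (p * D)\<^sup>2))" by (intro diff_mono)
  moreover have "D * (48 / 100) = D * (981 / 1000) - D * (501 / 1000)" by simp
  ultimately have "p * F * (D * (48 / 100)) \<le> p * F * ((1 - 1 / 200) * ((D - 1) * (1 - 1 / 100) - ln (real M) / (1 / 100))
    - D * (K * (p * D + 9 * (p * D)\<^sup>2)))" using p F by (intro mult_left_mono) (simp_all only: mult_nonneg_nonneg less_imp_le)
  moreover have "p * F * (D * (48 / 100)) = F * (48 / 100) * (p * D)" by simp
  moreover have "F * (48 / 100) * (p * D) = F * (6 / 25) / K" unfolding pD by simp
  ultimately show ?thesis by metis
qed

section \<open>Feasibility, running time and approximation ratio\<close>

lemma survivors_feasible:
  assumes data: "nonneg_data n m S c"
    and prog: "packing_program n m coef fitting A f p D L"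
    and R: "R \<subseteq> fitting" and c': "\<forall>r<2 * m + n. c' r \<le> D"
  shows "feasible n m S c (sampled_packing.survivors m coef p D R c')"
proof -
  interpret packing_program n m coef fitting A f p D L by (rule prog)
  have "(\<Sum>i\<in>survivors R c'. S i j) \<le> c j" if j: "j < m" for j
  proof -
    have cj: "0 \<le> c j" using data j by (simp add: nonneg_data_def)
    have le: "(\<Sum>i\<in>survivors R c'. S i j / c j) \<le> 1"
    proof (rule survivors_load_le_1[OF R c' j])
      fix a assume a: "a \<in> fitting"
      then have "0 \<le> S a j" "S a j \<le> c j" using data j by (auto simp: fitting_def nonneg_data_def)
      then have "0 \<le> S a j / c j" "S a j / c j \<le> 1" using cj by (auto simp: divide_le_eq_1)
      then show "coef a j = 1 \<and> coef a (m + j) = 0 \<and> 0 < S a j / c j \<and> S a j / c j \<le> 1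
        \<or> coef a j = 0 \<and> coef a (m + j) = S a j / c j \<and> 0 \<le> S a j / c j \<and> S a j / c j \<le> 1 / 2"
      proof (cases "1 / 2 < S a j / c j")
        case True
        then have "0 < S a j / c j" by linarith
        with True \<open>S a j / c j \<le> 1\<close> j show ?thesis by (simp add: coef_def)
      next
        case False
        with \<open>0 \<le> S a j / c j\<close> j show ?thesis by (simp add: coef_def)
      qed
    qed
    show ?thesis
    proof (cases "c j = 0")
      \<comment> \<open>The normalized load carries no information at capacity 0, but fitting items
        have no positive size there.\<close>
      case True
      have "S i j \<le> 0" if "i \<in> survivors R c'" for i
      proof -
        have "i \<in> fitting" using that R by (auto simp: survivors_def)
        then show ?thesis using j True by (auto simp: fitting_def)
      qed
      then show ?thesis using True by (simp add: sum_nonpos)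
    next
      case False
      then have "(\<Sum>i\<in>survivors R c'. S i j) / c j \<le> 1" using le by (simp add: sum_divide_distrib)
      then show ?thesis using False cj by (simp add: divide_le_eq_1)
    qed
  qed
  moreover have "survivors R c' \<subseteq> {..<n}" using R G_sub by (auto simp: survivors_def)
  ultimately show ?thesis by (simp add: feasible_def)
qed

text \<open>With \<open>x = n + m + 1\<close>, the inverse probability \<open>2 ^ L\<close> is of
  order \<open>x\<^sup>2\<close>, so there are of order \<open>x ^ 3\<close> rounds, each of order
  \<open>x\<^sup>2\<close>; this explains the exponent 5.\<close>

lemma total_time_le:
  assumes K: "K \<le> 10000 + m" and L: "2 ^ L \<le> 2 * (200000 * K * (2 * m + n + 1))"
  shows "n * (m * 14 + 18) + (2 * m + n) * 5 + (10000 + m) * (2 * m + n + 1) * 600000 + 30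
    + ((n * 2 ^ L + 1) * (n * (m * 6 + (2 * m + n) * 5 + 40) + L * 9 + (2 * m + n) * 14 + 30 + 2) + 1)
    + (n * (m * 6 + 13) + 4) + 2 \<le> 10 ^ 21 * (n + m + 1) ^ 5"
proof -
  define x where "x = n + m + 1"
  have x1: "1 \<le> x" and nx: "n \<le> x" and mx: "m \<le> x" and Mx: "2 * m + n + 1 \<le> 2 * x" and tx: "10000 + m \<le> 10000 * x"
    by (auto simp: x_def)
  have p12: "1 \<le> x ^ 2" "x \<le> x ^ 2" using x1 by (auto simp: power2_eq_square)
  have p3: "1 \<le> x ^ 3" using x1 by simp
  have p25: "x ^ 2 \<le> x ^ 5" using x1 by (intro power_increasing) auto
  have p15: "1 \<le> x ^ 5" using x1 by simp
  have KM: "(10000 + m) * (2 * m + n + 1) \<le> 20000 * x ^ 2"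
    using mult_le_mono[OF tx Mx] by (simp add: power2_eq_square)
  have "K * (2 * m + n + 1) \<le> 20000 * x ^ 2"
    using mult_le_mono1[OF K, of "2 * m + n + 1"] KM by (rule le_trans)
  then have Q: "2 ^ L \<le> 8000000000 * x ^ 2" using L by (simp add: mult.assoc)
  have L': "L \<le> 8000000000 * x ^ 2" using less_imp_le[OF less_exp[of L]] Q by (rule le_trans)
  have "n * (m * 14 + 18) \<le> x * (x * 14 + 18 * x)" using nx mx x1 by (intro mult_le_mono add_le_mono) auto
  then have t1: "n * (m * 14 + 18) \<le> 32 * x ^ 2" by (simp add: power2_eq_square algebra_simps)
  have "n * (m * 6 + (2 * m + n) * 5 + 40) \<le> x * (x * 6 + (2 * x) * 5 + 40 * x)"
    using nx mx Mx x1 by (intro mult_le_mono add_le_mono) auto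
  then have t2: "n * (m * 6 + (2 * m + n) * 5 + 40) \<le> 56 * x ^ 2" by (simp add: power2_eq_square algebra_simps)
  have "n * (m * 6 + 13) \<le> x * (x * 6 + 13 * x)" using nx mx x1 by (intro mult_le_mono add_le_mono) auto
  then have t3: "n * (m * 6 + 13) \<le> 19 * x ^ 2" by (simp add: power2_eq_square algebra_simps)
  have M2: "2 * m + n \<le> 2 * x ^ 2" using Mx p12 by linarith
  have r: "n * (m * 6 + (2 * m + n) * 5 + 40) + L * 9 + (2 * m + n) * 14 + 30 + 2 \<le> 80000000000 * x ^ 2"
  proof -
    have "n * (m * 6 + (2 * m + n) * 5 + 40) + L * 9 + (2 * m + n) * 14 + 30 + 2
        \<le> 56 * x ^ 2 + 8000000000 * x ^ 2 * 9 + 2 * x ^ 2 * 14 + 30 * x ^ 2 + 2 * x ^ 2"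
      by (intro add_le_mono t2 mult_le_mono1[OF L'] mult_le_mono1[OF M2]) (use p12 in simp_all)
    then show ?thesis by simp
  qed
  have "n * 2 ^ L \<le> x * (8000000000 * x ^ 2)" using nx Q by (rule mult_le_mono)
  also have "\<dots> = 8000000000 * x ^ 3" by (simp add: power3_eq_cube power2_eq_square)
  finally have N: "n * 2 ^ L + 1 \<le> 9000000000 * x ^ 3" using p3 by linarith
  have "(n * 2 ^ L + 1) * (n * (m * 6 + (2 * m + n) * 5 + 40) + L * 9 + (2 * m + n) * 14 + 30 + 2)
      \<le> (9000000000 * x ^ 3) * (80000000000 * x ^ 2)" by (rule mult_le_mono[OF N r])
  also have "\<dots> = 720000000000000000000 * x ^ 5" by (simp add: power_add[symmetric])
  finally have t4: "(n * 2 ^ L + 1) * (n * (m * 6 + (2 * m + n) * 5 + 40) + L * 9 + (2 * m + n) * 14 + 30 + 2)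
      \<le> 720000000000000000000 * x ^ 5" .
  have "n * (m * 14 + 18) + (2 * m + n) * 5 + (10000 + m) * (2 * m + n + 1) * 600000 + 30
    + ((n * 2 ^ L + 1) * (n * (m * 6 + (2 * m + n) * 5 + 40) + L * 9 + (2 * m + n) * 14 + 30 + 2) + 1)
    + (n * (m * 6 + 13) + 4) + 2
    \<le> 32 * x ^ 5 + 2 * x ^ 5 * 5 + 20000 * x ^ 5 * 600000 + 30 * x ^ 5
      + (720000000000000000000 * x ^ 5 + x ^ 5) + (19 * x ^ 5 + 4 * x ^ 5) + 2 * x ^ 5"
  proof -
    have 5: "y \<le> z * x ^ 2 \<Longrightarrow> y \<le> z * x ^ 5" for y z using mult_le_mono2[OF p25, of z] by (rule le_trans[rotated])
    show ?thesis
      by (intro add_le_mono 5[OF t1] 5[OF t3] t4 mult_le_mono1[OF 5[OF M2]] mult_le_mono1[OF 5[OF KM]])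
        (use p15 in simp_all)
  qed
  also have "\<dots> \<le> 10 ^ 21 * x ^ 5" by simp
  finally show ?thesis unfolding x_def .
qed

theorem packing_algorithm_correct:
  assumes data: "nonneg_data n m S c" and sparse: "column_sparse k n m S"
    and nonneg: "nonneg_set_fun {..<n} f" and mono: "monotone_set_fun {..<n} f" and sub: "submodular {..<n} f"
  obtains Ds where "exec n f packing_algorithm (init_state n m S c) (10 ^ 21 * (n + m + 1) ^ 5) Ds"
    "\<And>s. s \<in> set_pmf Ds \<Longrightarrow> feasible n m S c (row_set n 1 0 s)"
    "OPT n m S c f / (17 / 4 * real (max 10000 k)) \<le> measure_pmf.expectation Ds (\<lambda>s. f (row_set n 1 0 s))"
proof -
  have "feasible n m S c {}" using data by (simp add: feasible_def nonneg_data_def)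
  moreover have finF: "finite {T. feasible n m S c T}"
    by (rule finite_subset[of _ "Pow {..<n}"]) (auto simp: feasible_def)
  ultimately have "OPT n m S c f \<in> f ` {T. feasible n m S c T}" unfolding OPT_def by (intro Max_in) auto
  then obtain A where A: "feasible n m S c A" and OPT: "OPT n m S c f = f A" by auto
  let ?ts = "n * (m * 14 + 18) + (2 * m + n) * 5 + (10000 + m) * (2 * m + n + 1) * 600000 + 30"
  obtain s1 K L where s1: "exec n f setup_prog (init_state n m S c) ?ts (return_pmf s1)" and ready: "ready K L s1"
    using setup_prog_spec unfolding runs_to_def by blast
  have K: "10000 \<le> K" "K = 10000 \<or> (\<exists>a<n. K = item_degree a)" "\<And>a. a < n \<Longrightarrow> item_degree a \<le> K"
    and L: "200000 * K * (2 * m + n + 1) \<le> 2 ^ L" "2 ^ L \<le> 2 * (200000 * K * (2 * m + n + 1))"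
    using ready unfolding ready_def by auto
  define p :: real where "p = 1 / 2 ^ L"
  define D :: real where "D = 2 ^ L / (2 * real K)"
  have prog: "packing_program n m coef fitting A f p D L"
    unfolding p_def D_def using K(1) by (intro packing_program_input[OF data mono sub A _ L(1)]) simp
  interpret packing_program n m coef fitting A f p D L by (rule prog)
  have "snd s1 (13, 0, 0) = D" "snd s1 (14, 0, 0) = p" using ready by (simp_all add: ready_def p_def D_def)
  then have rep1: "rep {} (\<lambda>_. 0) (\<lambda>_. 1) s1" using ready unfolding rep_def ready_def by simp
  have flag1: "flag_correct {} (\<lambda>_. 0) s1" using ready D_ge_1 unfolding flag_correct_def ready_def by auto
  have nD: "real n * D - (\<Sum>a<n. (\<lambda>_. 0) (2 * m + a)) \<le> real (n * 2 ^ L)"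
  proof -
    have "D \<le> 2 ^ L" unfolding D_def using K(1) by (simp add: divide_le_eq)
    then show ?thesis by (simp add: mult_left_mono)
  qed
  let ?tm = "(n * 2 ^ L + 1) * (round_time + 2) + 1" and ?to = "n * (m * 6 + 13) + 4"
  let ?pot = "potential {} (\<lambda>_. 0) (\<lambda>_. 1) (\<lambda>_. 0)"
  define X where "X s = (1 + p * D / (1 / 200)) * (f (row_set n 1 0 s) - f {})" for s
  have loop: "bounds_expectation n f main_loop s1 ?tm ?pot output_value good_state"
    by (rule main_loop_spec[OF rep1 consistent_init flag1 nD])
  have out: "bounds_expectation n f output_prog s ?to (output_value s) X (\<lambda>s. feasible n m S c (row_set n 1 0 s))"
    if good: "good_state s" for s
  proof -
    obtain R c' w g where rs: "rep R c' w s" and cons: "consistent R c' w g"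
      using good unfolding good_state_def by blast
    have "feasible n m S c (survivors R c')"
      by (rule survivors_feasible[OF data prog R_sub[OF cons] c_le_D[OF cons]])
    then show ?thesis
      by (intro bounds_expectation_runs_to runs_to_weaken[OF output_prog_spec[OF rs] order_refl])
        (simp add: X_def output_value_rep[OF rs])
  qed
  have rest: "bounds_expectation n f (Seq main_loop output_prog) s1 (Suc (?tm + ?to)) ?pot X (\<lambda>s. feasible n m S c (row_set n 1 0 s))"
    by (rule bounds_expectation_Seq[OF loop out])
  have start: "runs_to n f setup_prog (init_state n m S c) ?ts (\<lambda>s. s = s1)" using s1 unfolding runs_to_def by blast
  have all: "bounds_expectation n f packing_algorithm (init_state n m S c) (Suc (?ts + Suc (?tm + ?to))) ?pot X
      (\<lambda>s. feasible n m S c (row_set n 1 0 s))"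
    unfolding packing_algorithm_def
    by (rule bounds_expectation_runs_to_Seq, rule runs_to_weaken[OF start order_refl]) (use rest in simp)
  have degree_le: "item_degree a \<le> m" for a
    using card_mono[of "{..<m}" "{j. j < m \<and> 0 < S a j}"] by (auto simp: item_degree_def)
  have Km: "K \<le> 10000 + m" using K(2) degree_le by (auto intro: trans_le_add2)
  have Kk: "K \<le> max 10000 k" using K(2) sparse by (auto simp: column_sparse_def item_degree_def)
  have "Suc (?ts + Suc (?tm + ?to)) \<le> 10 ^ 21 * (n + m + 1) ^ 5"
    using total_time_le[OF Km L(2)] unfolding round_time_def by simp
  with all have "bounds_expectation n f packing_algorithm (init_state n m S c) (10 ^ 21 * (n + m + 1) ^ 5) ?pot X
      (\<lambda>s. feasible n m S c (row_set n 1 0 s))" by (rule bounds_expectation_le) simp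
  then obtain Ds where Ds: "exec n f packing_algorithm (init_state n m S c) (10 ^ 21 * (n + m + 1) ^ 5) Ds"
    "finite (set_pmf Ds)" "\<And>s. s \<in> set_pmf Ds \<Longrightarrow> feasible n m S c (row_set n 1 0 s)"
    "?pot \<le> measure_pmf.expectation Ds X" unfolding bounds_expectation_def by blast
  let ?E = "measure_pmf.expectation Ds (\<lambda>s. f (row_set n 1 0 s))"
  have "integrable (measure_pmf Ds) (\<lambda>s. f (row_set n 1 0 s))" by (rule integrable_measure_pmf_finite[OF Ds(2)])
  from Bochner_Integration.integral_diff[OF this, of "\<lambda>_. f {}"]
  have "measure_pmf.expectation Ds (\<lambda>s. f (row_set n 1 0 s) - f {}) = ?E - f {}" by simp
  then have EX: "measure_pmf.expectation Ds X = (1 + p * D / (1 / 200)) * (?E - f {})"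
    unfolding X_def by simp
  have card_touched: "real (card (touched a)) \<le> real K" if a: "a \<in> fitting" for a
  proof -
    have an: "a < n" using a by (simp add: fitting_def)
    have "touched a \<subseteq> {j. j < m \<and> 0 < S a j}"
    proof
      fix j assume j: "j \<in> touched a"
      then have jm: "j < m" and pos: "0 < coef a j + coef a (m + j)" by (auto simp: touched_def)
      have "S a j \<noteq> 0" using pos jm by (auto simp: coef_def split: if_splits)
      moreover have "0 \<le> S a j" using data an jm by (simp add: nonneg_data_def)
      ultimately show "j \<in> {j. j < m \<and> 0 < S a j}" using jm by simp
    qed
    then have "card (touched a) \<le> item_degree a" unfolding item_degree_def by (intro card_mono) auto
    then show ?thesis using K(3)[OF an] by simp
  qed
  have f0: "0 \<le> f {}" using nonneg by (simp add: nonneg_set_fun_def)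
  have F: "0 \<le> f A - f {}" using mono_on_G[of "{}" A] A_sub by simp
  have Kr: "10000 \<le> real K" using K(1) by simp
  have pD: "p * D = 1 / (2 * real K)" by (simp add: p_def D_def)
  have Dbig: "100000 * (real (2 * m + n) + 1) \<le> D"
  proof -
    have "real (200000 * K * (2 * m + n + 1)) \<le> real (2 ^ L)" using L(1) by (simp only: of_nat_le_iff)
    then show ?thesis unfolding D_def using Kr by (simp add: le_divide_eq algebra_simps)
  qed
  have "(f A - f {}) * (6 / 25) / real K \<le> ?pot"
    using initial_potential_ge[OF Kr Dbig pD F p_pos] potential_init[OF card_touched, of "\<lambda>_. 0"]
    unfolding horizon_def by (rule order_trans)
  then have main: "(f A - f {}) * (6 / 25) / real K \<le> (1 + p * D / (1 / 200)) * (?E - f {})"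
    using Ds(4) unfolding EX by simp
  define Y where "Y = ?E - f {}"
  have coefK: "1 \<le> 1 + p * D / (1 / 200)" "1 + p * D / (1 / 200) \<le> 101 / 100" unfolding pD using Kr by (auto simp: field_simps)
  \<comment> \<open>The coefficient can be replaced by its upper bound 101/100 only on a nonnegative
    factor.\<close>
  have Y0: "0 \<le> Y"
  proof -
    have "0 \<le> (f A - f {}) * (6 / 25) / real K" using F by simp
    then have "0 \<le> (1 + p * D / (1 / 200)) * Y" using main unfolding Y_def by linarith
    then show ?thesis using coefK(1) zero_le_mult_iff[of "1 + p * D / (1 / 200)" Y] by linarith
  qed
  have "(f A - f {}) * (6 / 25) / real K \<le> Y * (101 / 100)"
    using main mult_right_mono[OF coefK(2) Y0] unfolding Y_def by linarith
  \<comment> \<open>The slack left by the constant 17/4: \<open>4 / 17 * 1.01\<close> is about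
    0.2377, below \<open>6 / 25\<close>.\<close>
  moreover have "(f A - f {}) / (17 / 4 * real K) * (101 / 100) \<le> (f A - f {}) * (6 / 25) / real K"
    using F Kr by (simp add: field_simps)
  ultimately have "(f A - f {}) / (17 / 4 * real K) * (101 / 100) \<le> Y * (101 / 100)"
    by (rule order_trans[rotated])
  then have gain: "(f A - f {}) / (17 / 4 * real K) \<le> Y" by (rule mult_right_le_imp_le) simp
  have "f A / (17 / 4 * real K) = (f A - f {}) / (17 / 4 * real K) + f {} / (17 / 4 * real K)"
    by (simp add: diff_divide_distrib)
  \<comment> \<open>The analysis concerns \<open>f - f {}\<close> only; the constant part is kept in
    full by any output set, while the claim asks for a small fraction of it.\<close>
  also have "\<dots> \<le> Y + f {}"
  proof (rule add_mono[OF gain])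
    have "f {} / (17 / 4 * real K) \<le> f {} / 1" using f0 Kr by (intro divide_left_mono) auto
    then show "f {} / (17 / 4 * real K) \<le> f {}" by simp
  qed
  finally have E: "f A / (17 / 4 * real K) \<le> ?E" unfolding Y_def by simp
  have "f A / (17 / 4 * real (max 10000 k)) \<le> f A / (17 / 4 * real K)"
    using Kk Kr F f0 by (intro divide_left_mono) auto
  with E have "OPT n m S c f / (17 / 4 * real (max 10000 k)) \<le> ?E" unfolding OPT by (rule order_trans[rotated])
  with Ds(1,3) show thesis by (rule that)
qed

end

text \<open>Five terms of the exponential series give \<open>e \<ge> 2.7\<close>. From there on
  \<open>x\<^sup>2 - 17 / 4 * (x - 1)\<close> is positive, being
  \<open>(x - 2.7) * (x - 1.55)\<close> plus 0.065.\<close>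

lemma ratio_ge: "17 / 4 \<le> exp (1 :: real) ^ 2 / (exp 1 - 1)"
proof -
  define x :: real where "x = exp 1"
  have "27 / 10 \<le> (\<Sum>k<5. (1 :: real) ^ k / fact k)" by (simp add: eval_nat_numeral)
  also have "\<dots> \<le> exp 1"
  proof -
    have "(\<Sum>k<5. inverse (fact k) * (1 :: real) ^ k) \<le> (\<Sum>k. inverse (fact k) * 1 ^ k)"
      using summable_exp[of "1 :: real"] by (intro sum_le_suminf) auto
    then show ?thesis unfolding exp_def by (simp add: divide_inverse scaleR_conv_of_real mult.commute)
  qed
  finally have x: "27 / 10 \<le> x" by (simp add: x_def)
  have "0 \<le> (x - 27 / 10) * (x - 155 / 100)" using x by (intro mult_nonneg_nonneg) auto
  then have "17 / 4 * (x - 1) \<le> x ^ 2" using x by (simp add: power2_eq_square algebra_simps)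
  then show ?thesis using x unfolding x_def[symmetric] by (simp add: le_divide_eq)
qed

theorem theorem6:
  "\<exists>(P :: com) (p :: nat poly) (g :: nat \<Rightarrow> real).
     g \<in> o(\<lambda>k. real k) \<and>
     (\<forall>k. 0 < exp 1 ^ 2 / (exp 1 - 1) * real k + g k) \<and>
     (\<forall>(n :: nat) (m :: nat) (k :: nat) (S :: nat \<Rightarrow> nat \<Rightarrow> real) (c :: nat \<Rightarrow> real)
        (f :: nat set \<Rightarrow> real).
        nonneg_data n m S c \<and> column_sparse k n m S \<and>
        nonneg_set_fun {..<n} f \<and> monotone_set_fun {..<n} f \<and> submodular {..<n} f \<longrightarrow>
        halts_within P n m S c f (poly p (n + m)) \<and>
        (\<forall>T \<in> set_pmf (out_dist P n m S c f (poly p (n + m))). feasible n m S c T) \<and>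
        measure_pmf.expectation (out_dist P n m S c f (poly p (n + m))) f
          \<ge> OPT n m S c f / (exp 1 ^ 2 / (exp 1 - 1) * real k + g k))"
proof -
  define p :: "nat poly" where "p = smult (10 ^ 21) ([:1, 1:] ^ 5)"
  \<comment> \<open>The value 42500 is \<open>17 / 4 * 10000\<close>. It covers all sparsities below
    the floor 10000, including 0, where it keeps the denominator positive.\<close>
  define g :: "nat \<Rightarrow> real" where "g k = (if k < 10000 then 42500 else 0)" for k
  have poly_p: "poly p (n + m) = 10 ^ 21 * (n + m + 1) ^ 5" for n m
    by (simp only: p_def poly_smult poly_power) (simp add: add.commute)
  have "g \<in> o(\<lambda>k. real k)"
  proof (rule landau_o.smallI)
    fix e :: real assume "0 < e"
    show "\<forall>\<^sub>F k in sequentially. norm (g k) \<le> e * norm (real k)"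
      using eventually_ge_at_top[of "10000 :: nat"]
      by (rule eventually_mono) (use \<open>0 < e\<close> in \<open>simp add: g_def\<close>)
  qed
  moreover have ratio: "17 / 4 * real (max 10000 k) \<le> exp 1 ^ 2 / (exp 1 - 1) * real k + g k" for k
  proof (cases "k < 10000")
    case True
    have "0 \<le> exp (1 :: real) ^ 2 / (exp 1 - 1) * real k" using ratio_ge by (intro mult_nonneg_nonneg) auto
    then show ?thesis using True by (simp add: g_def)
  next
    case False
    then show ?thesis using mult_right_mono[OF ratio_ge, of "real k"] by (simp add: g_def)
  qed
  moreover have pos: "0 < exp 1 ^ 2 / (exp 1 - 1) * real k + g k" for k
    by (rule less_le_trans[OF _ ratio]) simp
  moreover have "halts_within packing_algorithm n m S c f (poly p (n + m)) \<and>
        (\<forall>T \<in> set_pmf (out_dist packing_algorithm n m S c f (poly p (n + m))). feasible n m S c T) \<and>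
        measure_pmf.expectation (out_dist packing_algorithm n m S c f (poly p (n + m))) f
          \<ge> OPT n m S c f / (exp 1 ^ 2 / (exp 1 - 1) * real k + g k)"
    if asm: "nonneg_data n m S c" "column_sparse k n m S" "nonneg_set_fun {..<n} f"
      "monotone_set_fun {..<n} f" "submodular {..<n} f" for n m k S c f
  proof -
    obtain Ds where Ds: "exec n f packing_algorithm (init_state n m S c) (10 ^ 21 * (n + m + 1) ^ 5) Ds"
      "\<And>s. s \<in> set_pmf Ds \<Longrightarrow> feasible n m S c (row_set n 1 0 s)"
      "OPT n m S c f / (17 / 4 * real (max 10000 k)) \<le> measure_pmf.expectation Ds (\<lambda>s. f (row_set n 1 0 s))"
      using packing_algorithm_correct[OF asm] by blast
    have run: "run packing_algorithm n m S c f (poly p (n + m)) = map_pmf (Pair Skip) Ds"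
      using Ds(1) unfolding run_eq_prun poly_p exec_def .
    have out: "out_dist packing_algorithm n m S c f (poly p (n + m)) = map_pmf (row_set n 1 0) Ds"
      unfolding out_dist_def run by (simp add: pmf.map_comp o_def)
    have "0 \<le> OPT n m S c f"
    proof -
      have "feasible n m S c {}" using asm(1) by (simp add: feasible_def nonneg_data_def)
      moreover have "finite {T. feasible n m S c T}"
        by (rule finite_subset[of _ "Pow {..<n}"]) (auto simp: feasible_def)
      ultimately have "f {} \<le> OPT n m S c f" unfolding OPT_def by (intro Max_ge) auto
      moreover have "0 \<le> f {}" using asm(3) by (simp add: nonneg_set_fun_def)
      ultimately show ?thesis by simp
    qed
    then have "OPT n m S c f / (exp 1 ^ 2 / (exp 1 - 1) * real k + g k) \<le> OPT n m S c f / (17 / 4 * real (max 10000 k))"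
      using ratio[of k] pos[of k] by (intro divide_left_mono) auto
    then show ?thesis using Ds(2,3) unfolding halts_within_def run out by auto
  qed
  ultimately show ?thesis by blast
qed

end
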